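(* Consider any of the three types of boundary conditions (DD, NN or DN), and let $F\in S'(\mathbb{R})$ with $\operatorname{supp}F\subset[0,\infty)$. For any $\varepsilon\in(0,1)$, a solution $u_s$ to the scattering problem with incident wave $u_{\rm in}(y,t)=F(t-n_0\cdot y)$ is unique in the class $\mathcal{M}_\varepsilon$.
   Context: Geometry. Fix $\phi\in(0,\pi)$, $\Phi:=2\pi-\phi$. Let $W=\{(\rho\cos\theta,\rho\sin\theta):\rho\ge0,\ 0\le\theta\le\phi\}$, $Q:=\mathbb{R}^2\setminus W$, $Q_1:=\{(y_1,0):y_1>0\}$, $Q_2:=\{(\rho\cos\phi,\rho\sin\phi):\rho>0\}$. Let $n_0=(\cos\alpha,\sin\alpha)$ with the standing assumption $\max(0,\phi-\pi/2)<\alpha<\min(\pi/2,\phi)$. Boundary operators. $B_1,B_2$ act on $Q_1,Q_2$ respectively: DD: $B_1=B_2=I$; NN: $B_1=B_2=\partial/\partial n$; DN: $B_1=\partial/\partial n$, $B_2=I$, with $n$ the outward normal to $Q$. Transforms and spaces. $\hat u(\omega)=\int_{\mathbb{R}}e^{i\omega t}u(t)\,dt$, extended to tempered distributions; for distributions supported in $t\ge0$, $\hat u$ extends analytically to $\mathbb{C}^+=\{\operatorname{Im}\omega>0\}$ (Fourier–Laplace transform). $S(\overline Q\times\mathbb{R})$ is the space of $\varphi\in C^\infty(\overline Q\times\mathbb{R})$ with $\sup_{(y,t),|\gamma|\le m}(1+|y|+|t|)^N|\partial^\gamma_{y,t}\varphi|<\infty$ for all $m,N>0$, and $S'(\overline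 Q\times\overline{\mathbb{R}^+})$ is the space of continuous linear functionals on it with support in $\overline Q\times[0,\infty)$. $E_\varepsilon$ is the Banach space of $u\in C(\overline Q)\cap C^1(\overline Q\setminus0)$ with $\|u\|_\varepsilon=\sup_{\overline Q}|u(y)|+\sup_{\overline Q\setminus0}\{y\}^\varepsilon|\nabla u(y)|<\infty$, $\{y\}:=|y|/(1+|y|)$. $\mathcal{M}_\varepsilon$ is the space of $u\in S'(\overline Q\times\overline{\mathbb{R}^+})$ whose Fourier–Laplace transform in $t$, $\hat u(y,\omega)$, is a holomorphic function of $\omega\in\mathbb{C}^+$ with values in $E_\varepsilon$. Scattering problem. Formally: $(\partial_t^2-\Delta)u_s=0$ in $Q$, $B_ju_s=-B_ju_{\rm in}$ on $Q_j$ ($j=1,2$), $u_s=0$ for $t<0$. By definition, $u_s\in\mathcal{M}_\varepsilon$ is a solution if for every $\omega\in\mathbb{C}^+$: $(-\Delta-\omega^2)\hat u_s(y,\omega)=0$ in $Q$ and $B_j\hat u_s(y,\omega)=-\hat F(\omega)\,B_j e^{i\omega n_0\cdot y}$ on $Q_j$, $j=1,2$. *)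

theory Defs
  imports "HOL-Analysis.Analysis" "HOL-Library.FuncSet"
begin

section \<open>Geometry\<close>

definition wedge :: "real \<Rightarrow> (real \<times> real) set" where
  "wedge \<phi> = {(\<rho> * cos \<theta>, \<rho> * sin \<theta>) | \<rho> \<theta>. 0 \<le> \<rho> \<and> 0 \<le> \<theta> \<and> \<theta> \<le> \<phi>}"

definition Q :: "real \<Rightarrow> (real \<times> real) set" where
  "Q \<phi> = - wedge \<phi>"

definition Q1 :: "(real \<times> real) set" where
  "Q1 = {(y1, 0) | y1. y1 > 0}"

definition Q2 :: "real \<Rightarrow> (real \<times> real) set" where
  "Q2 \<phi> = {(\<rho> * cos \<phi>, \<rho> * sin \<phi>) | \<rho>. \<rho> > 0}"

definition n0 :: "real \<Rightarrow> real \<times> real" where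
  "n0 \<alpha> = (cos \<alpha>, sin \<alpha>)"

text \<open>The normals on \<open>Q1\<close> and \<open>Q2 \<phi>\<close> that are outward with respect to \<open>Q \<phi>\<close>, i.e. that point
  into the wedge.\<close>

definition normal1 :: "real \<times> real" where
  "normal1 = (0, 1)"

definition normal2 :: "real \<Rightarrow> real \<times> real" where
  "normal2 \<phi> = (sin \<phi>, - cos \<phi>)"

section \<open>Smooth functions, Schwartz spaces and tempered distributions on closed sets\<close>

text \<open>
  The sets \<open>S\<close> used below (the real line, \<open>closure (Q \<phi>)\<close>, \<open>closure (Q \<phi>) \<times> UNIV\<close>, \<open>UNIV\<close>) are
  closures of open cones or cylinders over them, so Frechet derivatives within \<open>S\<close> are unique,
  agree with ordinary derivatives in the interior, and are their continuous extensions at boundary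
  points. A function on \<open>S\<close> is represented by any total function with these values on \<open>S\<close>; all
  notions below depend only on the values on \<open>S\<close>. A multi-index is a list of basis vectors.
\<close>

primrec iter_pd :: "'a set \<Rightarrow> 'a list \<Rightarrow> ('a::euclidean_space \<Rightarrow> complex) \<Rightarrow> 'a \<Rightarrow> complex" where
  "iter_pd S [] f = f"
| "iter_pd S (b # bs) f = (\<lambda>x. frechet_derivative (iter_pd S bs f) (at x within S) b)"

definition smooth_within :: "'a::euclidean_space set \<Rightarrow> ('a \<Rightarrow> complex) \<Rightarrow> bool" where
  "smooth_within S f \<longleftrightarrow>
     (\<forall>bs. set bs \<subseteq> Basis \<longrightarrow> (\<forall>x\<in>S. iter_pd S bs f differentiable (at x within S)))"

text \<open>For \<open>x = (y, t)\<close> the weight \<open>1 + norm x\<close> is equivalent to \<open>1 + norm y + \<bar>t\<bar>\<close>, so both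
  give the same space and the same topology.\<close>

definition schwartz_values ::
    "'a::euclidean_space set \<Rightarrow> nat \<Rightarrow> nat \<Rightarrow> ('a \<Rightarrow> complex) \<Rightarrow> real set" where
  "schwartz_values S m N f =
     {(1 + norm x) ^ N * norm (iter_pd S bs f x) | bs x. set bs \<subseteq> Basis \<and> length bs \<le> m \<and> x \<in> S}"

definition schwartz_seminorm ::
    "'a::euclidean_space set \<Rightarrow> nat \<Rightarrow> nat \<Rightarrow> ('a \<Rightarrow> complex) \<Rightarrow> real" where
  "schwartz_seminorm S m N f = Sup (schwartz_values S m N f)"

definition schwartz :: "'a::euclidean_space set \<Rightarrow> ('a \<Rightarrow> complex) set" where
  "schwartz S = {f. smooth_within S f \<and> (\<forall>m N. bdd_above (schwartz_values S m N f))}"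

text \<open>Continuity is sequential continuity, the topology of \<open>schwartz S\<close> being given by
  countably many seminorms. Extensionality makes HOL equality of functionals coincide with
  equality on \<open>schwartz S\<close>.\<close>

definition tempered_dist :: "'a::euclidean_space set \<Rightarrow> (('a \<Rightarrow> complex) \<Rightarrow> complex) set" where
  "tempered_dist S = {u \<in> extensional (schwartz S).
     (\<forall>f\<in>schwartz S. \<forall>g\<in>schwartz S. u (\<lambda>x. f x + g x) = u f + u g) \<and>
     (\<forall>f\<in>schwartz S. \<forall>c. u (\<lambda>x. c * f x) = c * u f) \<and>
     (\<forall>fs f. (\<forall>n. fs n \<in> schwartz S) \<longrightarrow> f \<in> schwartz S \<longrightarrow>
        (\<forall>m N. (\<lambda>n::nat. schwartz_seminorm S m N (\<lambda>x. fs n x - f x)) \<longlonglongrightarrow> 0) \<longrightarrow>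
        (\<lambda>n. u (fs n)) \<longlonglongrightarrow> u f)}"

definition dist_supported ::
    "'a::euclidean_space set \<Rightarrow> 'a set \<Rightarrow> (('a \<Rightarrow> complex) \<Rightarrow> complex) \<Rightarrow> bool" where
  "dist_supported S K u \<longleftrightarrow>
     (\<forall>f\<in>schwartz S. closure {x \<in> S. f x \<noteq> 0} \<inter> K = {} \<longrightarrow> u f = 0)"

section \<open>Fourier--Laplace transform\<close>

definition upper_half :: "complex set" where
  "upper_half = {\<omega>. Im \<omega> > 0}"

text \<open>
  For a tempered distribution supported in \<open>t \<ge> 0\<close> and \<open>Im \<omega> > 0\<close>, the Fourier--Laplace transform
  is the pairing with \<open>exp (\<i> \<omega> t)\<close>. This exponential has to be changed for negative \<open>t\<close>, away
  from the support of the distribution, to become a Schwartz function; the pairing does not depend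
  on the choice.
\<close>

definition FL_kernel :: "complex \<Rightarrow> real \<Rightarrow> complex" where
  "FL_kernel \<omega> = (SOME e. e \<in> schwartz UNIV \<and>
     (\<exists>\<delta>>0. \<forall>t\<ge>-\<delta>. e t = exp (\<i> * \<omega> * of_real t)))"

definition FL :: "((real \<Rightarrow> complex) \<Rightarrow> complex) \<Rightarrow> complex \<Rightarrow> complex" where
  "FL F \<omega> = F (FL_kernel \<omega>)"

text \<open>The transform in \<open>t\<close> alone is a distribution in \<open>y\<close>; the next predicate says that it is the
  regular distribution with density \<open>w\<close> on \<open>closure (Q \<phi>)\<close>.\<close>

definition has_FL ::
    "real \<Rightarrow> (((real \<times> real) \<times> real \<Rightarrow> complex) \<Rightarrow> complex) \<Rightarrow> complex \<Rightarrow> (real \<times> real \<Rightarrow> complex) \<Rightarrow> bool" where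
  "has_FL \<phi> u \<omega> w \<longleftrightarrow>
     (\<forall>\<psi>\<in>schwartz (closure (Q \<phi>)).
        u (\<lambda>(y, t). \<psi> y * FL_kernel \<omega> t) = (LINT y:closure (Q \<phi>)|lborel. w y * \<psi> y))"

section \<open>The spaces \<open>E\<close> and \<open>M\<close>\<close>

definition grad :: "real \<Rightarrow> (real \<times> real \<Rightarrow> complex) \<Rightarrow> real \<times> real \<Rightarrow> complex \<times> complex" where
  "grad \<phi> w y = (frechet_derivative w (at y within closure (Q \<phi>)) (1, 0),
                 frechet_derivative w (at y within closure (Q \<phi>)) (0, 1))"

definition E_space :: "real \<Rightarrow> real \<Rightarrow> (real \<times> real \<Rightarrow> complex) set" where
  "E_space \<phi> \<epsilon> = {w. continuous_on (closure (Q \<phi>)) w \<and>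
     (\<forall>y\<in>closure (Q \<phi>) - {0}. w differentiable (at y within closure (Q \<phi>))) \<and>
     continuous_on (closure (Q \<phi>) - {0}) (grad \<phi> w) \<and>
     bdd_above ((\<lambda>y. norm (w y)) ` closure (Q \<phi>)) \<and>
     bdd_above ((\<lambda>y. (norm y / (1 + norm y)) powr \<epsilon> * norm (grad \<phi> w y)) ` (closure (Q \<phi>) - {0}))}"

definition E_norm :: "real \<Rightarrow> real \<Rightarrow> (real \<times> real \<Rightarrow> complex) \<Rightarrow> real" where
  "E_norm \<phi> \<epsilon> w = (SUP y\<in>closure (Q \<phi>). norm (w y)) +
     (SUP y\<in>closure (Q \<phi>) - {0}. (norm y / (1 + norm y)) powr \<epsilon> * norm (grad \<phi> w y))"

definition holomorphic_E :: "real \<Rightarrow> real \<Rightarrow> (complex \<Rightarrow> real \<times> real \<Rightarrow> complex) \<Rightarrow> bool" where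
  "holomorphic_E \<phi> \<epsilon> U \<longleftrightarrow>
     (\<forall>\<omega>\<in>upper_half. U \<omega> \<in> E_space \<phi> \<epsilon>) \<and>
     (\<forall>\<omega>\<in>upper_half. \<exists>V\<in>E_space \<phi> \<epsilon>.
        ((\<lambda>h. E_norm \<phi> \<epsilon> (\<lambda>y. (U (\<omega> + h) y - U \<omega> y) / h - V y)) \<longlongrightarrow> 0) (at 0))"

definition M_space :: "real \<Rightarrow> real \<Rightarrow> (((real \<times> real) \<times> real \<Rightarrow> complex) \<Rightarrow> complex) set" where
  "M_space \<phi> \<epsilon> = {u \<in> tempered_dist (closure (Q \<phi>) \<times> UNIV).
     dist_supported (closure (Q \<phi>) \<times> UNIV) (closure (Q \<phi>) \<times> {0..}) u \<and>
     (\<exists>U. holomorphic_E \<phi> \<epsilon> U \<and> (\<forall>\<omega>\<in>upper_half. has_FL \<phi> u \<omega> (U \<omega>)))}"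

section \<open>The scattering problem\<close>

datatype bc_type = DD | NN | DN

definition normal_deriv ::
    "real \<Rightarrow> real \<times> real \<Rightarrow> (real \<times> real \<Rightarrow> complex) \<Rightarrow> real \<times> real \<Rightarrow> complex" where
  "normal_deriv \<phi> n w y = frechet_derivative w (at y within closure (Q \<phi>)) n"

fun B1 :: "bc_type \<Rightarrow> real \<Rightarrow> (real \<times> real \<Rightarrow> complex) \<Rightarrow> real \<times> real \<Rightarrow> complex" where
  "B1 DD \<phi> w = w"
| "B1 NN \<phi> w = normal_deriv \<phi> normal1 w"
| "B1 DN \<phi> w = normal_deriv \<phi> normal1 w"

fun B2 :: "bc_type \<Rightarrow> real \<Rightarrow> (real \<times> real \<Rightarrow> complex) \<Rightarrow> real \<times> real \<Rightarrow> complex" where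
  "B2 DD \<phi> w = w"
| "B2 NN \<phi> w = normal_deriv \<phi> (normal2 \<phi>) w"
| "B2 DN \<phi> w = w"

definition laplacian :: "(real \<times> real \<Rightarrow> complex) \<Rightarrow> real \<times> real \<Rightarrow> complex" where
  "laplacian f y = (\<Sum>b\<in>Basis. iter_pd UNIV [b, b] f y)"

text \<open>Elements of \<open>E_space\<close> are only once differentiable, so the Helmholtz equation is understood
  in the sense of distributions.\<close>

definition helmholtz :: "real \<Rightarrow> complex \<Rightarrow> (real \<times> real \<Rightarrow> complex) \<Rightarrow> bool" where
  "helmholtz \<phi> \<omega> w \<longleftrightarrow>
     (\<forall>\<psi>. smooth_within UNIV \<psi> \<longrightarrow> compact (closure {y. \<psi> y \<noteq> 0}) \<longrightarrow>
        closure {y. \<psi> y \<noteq> 0} \<subseteq> Q \<phi> \<longrightarrow>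
        (LINT y:Q \<phi>|lborel. w y * (- laplacian \<psi> y - \<omega>\<^sup>2 * \<psi> y)) = 0)"

definition plane_wave :: "real \<Rightarrow> complex \<Rightarrow> real \<times> real \<Rightarrow> complex" where
  "plane_wave \<alpha> \<omega> y = exp (\<i> * \<omega> * of_real (n0 \<alpha> \<bullet> y))"

text \<open>The density \<open>U \<omega>\<close> is uniquely determined by \<open>u\<close> on \<open>closure (Q \<phi>)\<close>, because it is
  continuous there.\<close>

definition scattering_solution ::
    "real \<Rightarrow> real \<Rightarrow> real \<Rightarrow> bc_type \<Rightarrow> ((real \<Rightarrow> complex) \<Rightarrow> complex) \<Rightarrow>
     (((real \<times> real) \<times> real \<Rightarrow> complex) \<Rightarrow> complex) \<Rightarrow> bool" where
  "scattering_solution \<phi> \<alpha> \<epsilon> bc F u \<longleftrightarrow>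
     u \<in> M_space \<phi> \<epsilon> \<and>
     (\<exists>U. holomorphic_E \<phi> \<epsilon> U \<and>
        (\<forall>\<omega>\<in>upper_half.
           has_FL \<phi> u \<omega> (U \<omega>) \<and>
           helmholtz \<phi> \<omega> (U \<omega>) \<and>
           (\<forall>y\<in>Q1. B1 bc \<phi> (U \<omega>) y = - FL F \<omega> * B1 bc \<phi> (plane_wave \<alpha> \<omega>) y) \<and>
           (\<forall>y\<in>Q2 \<phi>. B2 bc \<phi> (U \<omega>) y = - FL F \<omega> * B2 bc \<phi> (plane_wave \<alpha> \<omega>) y)))"

end

theory Submission
  imports Defs "HOL-Computational_Algebra.Polynomial"
begin

text \<open>
  Only the frequencies \<open>\<i> * s\<close> with \<open>s > 0\<close> are needed. There the real and imaginary parts \<open>w\<close> of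
  the difference of the two transforms solve \<open>\<Delta> w = s\<^sup>2 w\<close> with homogeneous boundary data. Testing
  with \<open>g w\<close> gives \<open>\<integral> g (\<bar>\<nabla>w\<bar>\<^sup>2 + s\<^sup>2 w\<^sup>2) + w \<nabla>w \<bullet> \<nabla>g = 0\<close> for \<open>g\<close> of compact support in \<open>Q\<close>. Take for
  \<open>g\<close> the product of the weight \<open>G y = 1 / (cosh (\<mu> y\<^sub>1) cosh (\<mu> y\<^sub>2))\<close>, a cutoff at infinity and a
  cutoff near the boundary. The boundary layers contribute nothing in the limit: \<open>w \<partial>\<^sub>n w\<close> vanishes
  on both sides whatever the type of the boundary condition, and \<open>\<bar>y\<bar> powr (- \<epsilon>)\<close> is integrable
  along the sides since \<open>\<epsilon> < 1\<close>. As \<open>\<bar>\<partial>\<^sub>i G\<bar> \<le> \<mu> G\<close>, the remaining gradient term is absorbed for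
  small \<open>\<mu>\<close>, and \<open>w = 0\<close>.

  Hence \<open>u\<close> and \<open>v\<close> agree on the functions that equal \<open>\<psi> y * exp (- s t)\<close> for \<open>t \<ge> 0\<close>. Sums of these
  are dense: for \<open>f\<close> vanishing for large \<open>t\<close>, approximate \<open>\<partial>\<^sub>t\<^sup>m f\<close> by Bernstein polynomials in
  \<open>x = exp (- t)\<close> whose coefficients are Schwartz functions of \<open>y\<close>. The Bernstein operator commutes
  with derivatives in \<open>y\<close>, and integrating from \<open>t = \<infinity>\<close> recovers the lower derivatives in \<open>t\<close>.
\<close>

section \<open>Smooth step functions\<close>

text \<open>At \<open>\<i> * s\<close> the term \<open>- \<omega>\<^sup>2\<close> equals
  \<open>s\<^sup>2 > 0\<close>, so the operator is real and coercive. Three obstacles shape the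
  rest. A function in \<open>E_space\<close> is bounded but need not be square integrable: hence a
  decaying weight whose gradient is controlled by the weight itself. Its product form in Cartesian
  coordinates lets the majorants be products of functions of one variable. Such a function is only
  once differentiable, its gradient may blow up at the corner, and the equation holds only against
  smooth test functions: so the energy identity goes through mollifiers on compact subsets of
  \<open>Q \<phi>\<close>, and boundary data enter only as limits along shrinking strips. Finally, a
  tempered distribution is continuous for the seminorms of all orders together, so the exponential
  sums must converge with all derivatives, up to the boundary of the closed domain, where the
  symmetry of mixed derivatives has to be proved. The support in t \<ge> 0 permits changing test
  functions for negative t, where the exponentials grow.\<close>

primrec times_diff :: "nat \<Rightarrow> (real \<Rightarrow> real) \<Rightarrow> bool" where
  "times_diff 0 f = True"
| "times_diff (Suc n) f =
     (\<exists>f'. (\<forall>x. (f has_real_derivative f' x) (at x)) \<and> times_diff n f')"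

lemma times_diff_Suc_D: "times_diff (Suc n) f \<Longrightarrow> times_diff n f"
proof (induction n arbitrary: f)
  case (Suc n)
  then show ?case by (metis times_diff.simps(2))
qed simp

lemma times_diff_const: "times_diff n (\<lambda>_. c)"
proof (induction n arbitrary: c)
  case (Suc n)
  then show ?case by (auto intro!: exI[of _ "\<lambda>_. 0"])
qed simp

lemma times_diff_add: "times_diff n f \<Longrightarrow> times_diff n g \<Longrightarrow> times_diff n (\<lambda>x. f x + g x)"
proof (induction n arbitrary: f g)
  case (Suc n)
  from Suc.prems obtain f' g' where
    "\<And>x. (f has_real_derivative f' x) (at x)" "times_diff n f'"
    "\<And>x. (g has_real_derivative g' x) (at x)" "times_diff n g'" by auto
  with Suc.IH show ?case by (auto intro!: exI[of _ "\<lambda>x. f' x + g' x"] derivative_eq_intros)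
qed simp

lemma times_diff_mult: "times_diff n f \<Longrightarrow> times_diff n g \<Longrightarrow> times_diff n (\<lambda>x. f x * g x)"
proof (induction n arbitrary: f g)
  case (Suc n)
  from Suc.prems obtain f' g' where
    "\<And>x. (f has_real_derivative f' x) (at x)" "times_diff n f'"
    "\<And>x. (g has_real_derivative g' x) (at x)" "times_diff n g'" by auto
  moreover have "times_diff n f" "times_diff n g"
    using Suc.prems by (simp_all only: times_diff_Suc_D)
  ultimately show ?case
    using Suc.IH by (auto intro!: exI[of _ "\<lambda>x. f' x * g x + f x * g' x"] derivative_eq_intros
        times_diff_add)
qed simp

lemma times_diff_affine: "times_diff n f \<Longrightarrow> times_diff n (\<lambda>x. f (a * x + c))"
proof (induction n arbitrary: f)
  case (Suc n)
  then obtain f' where f': "\<And>x. (f has_real_derivative f' x) (at x)" "times_diff n f'" by auto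
  have "((\<lambda>x. f (a * x + c)) has_real_derivative a * f' (a * x + c)) (at x)" for x
    by (rule DERIV_cong[OF DERIV_chain2[OF f'(1)]]) (auto intro!: derivative_eq_intros)
  moreover have "times_diff n (\<lambda>x. a * f' (a * x + c))"
    by (rule times_diff_mult[OF times_diff_const Suc.IH[OF f'(2)]])
  ultimately show ?case by (auto intro!: exI[of _ "\<lambda>x. a * f' (a * x + c)"])
qed simp

text \<open>\<open>times_diff\<close> speaks of finitely many derivatives at a time, which makes
  closure under products and affine substitution an induction on n. Once it holds for every n,
  uniqueness of derivatives identifies each witness with \<open>deriv f\<close>, which is then again
  of this kind.\<close>

lemma higher_deriv_of_times_diff:
  assumes "\<And>n. times_diff n f"
  shows "((deriv ^^ n) f has_real_derivative (deriv ^^ Suc n) f x) (at x)"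
proof -
  have step: "(\<forall>x. (g has_real_derivative deriv g x) (at x)) \<and> (\<forall>m. times_diff m (deriv g))"
    if g: "\<forall>m. times_diff m g" for g
  proof -
    have "\<exists>g'. (\<forall>x. (g has_real_derivative g' x) (at x)) \<and> times_diff m g'" for m
      using g[rule_format, of "Suc m"] by simp
    moreover have "g' = deriv g" if "\<forall>x. (g has_real_derivative g' x) (at x)" for g'
      using that by (auto simp: fun_eq_iff intro!: DERIV_imp_deriv[symmetric])
    ultimately show ?thesis by blast
  qed
  have "\<forall>m. times_diff m ((deriv ^^ n) f)"
    by (induction n) (use assms step in auto)
  from step[OF this] show ?thesis by simp
qed

section \<open>The flat function exp (- 1 / t) and its derivatives\<close>

primrec flat_poly :: "nat \<Rightarrow> real poly" where
  "flat_poly 0 = 1"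
| "flat_poly (Suc n) = [:0, 0, 1:] * (flat_poly n - pderiv (flat_poly n))"

text \<open>The nth derivative of exp (- 1 / t), extended by 0 to t \<le> 0. With x = 1 / t,
  differentiation in t is - x^2 d/dx, which turns p(x) exp (- x) into x^2 (p(x) - p'(x)) exp (- x):
  this is the recursion of \<open>flat_poly\<close>.\<close>

definition flat :: "nat \<Rightarrow> real \<Rightarrow> real" where
  "flat n t = (if t \<le> 0 then 0 else poly (flat_poly n) (1 / t) * exp (- (1 / t)))"

lemma poly_times_exp_tendsto_0: "((\<lambda>x::real. poly p x * exp (- x)) \<longlongrightarrow> 0) at_top"
proof -
  have "((\<lambda>x. x ^ i / exp x) \<longlongrightarrow> (0::real)) at_top" for i
    by (rule tendsto_power_div_exp_0)
  then have "((\<lambda>x. \<Sum>i\<le>degree p. coeff p i * (x ^ i / exp x)) \<longlongrightarrow> (\<Sum>i\<le>degree p. coeff p i * 0)) at_top"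
    by (intro tendsto_intros)
  moreover have "(\<Sum>i\<le>degree p. coeff p i * (x ^ i / exp x)) = poly p x * exp (- x)" for x
    by (simp add: poly_altdef sum_distrib_right exp_minus divide_inverse mult.assoc)
  ultimately show ?thesis by simp
qed

lemma flat_has_derivative: "(flat n has_real_derivative flat (Suc n) t) (at t)"
proof -
  consider "t < 0" | "t > 0" | "t = 0" by linarith
  then show ?thesis
  proof cases
    case 1
    have "((\<lambda>_. 0) has_real_derivative 0) (at t)" by simp
    then have "(flat n has_real_derivative 0) (at t)"
      by (rule has_field_derivative_transform_within_open[of _ _ _ "{..<0}"])
        (use 1 in \<open>auto simp: flat_def\<close>)
    with 1 show ?thesis by (simp add: flat_def)
  next
    case 2
    have "((\<lambda>t. poly (flat_poly n) (1 / t) * exp (- (1 / t))) has_real_derivative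
        flat (Suc n) t) (at t)"
      using 2 by (auto intro!: derivative_eq_intros simp: flat_def field_simps power2_eq_square)
    then show ?thesis
      by (rule has_field_derivative_transform_within_open[of _ _ _ "{0<..}"])
        (use 2 in \<open>auto simp: flat_def\<close>)
  next
    case 3
    \<comment> \<open>\<open>pCons 0\<close> supplies the factor 1 / h of the difference quotient at
      0 from the right; the quotient from the left is identically 0.\<close>
    have "((\<lambda>h. poly (pCons 0 (flat_poly n)) (1 / h) * exp (- (1 / h))) \<longlongrightarrow> 0) (at_right (0::real))"
      by (rule filterlim_compose[OF poly_times_exp_tendsto_0])
        (simp add: filterlim_inverse_at_top_right divide_inverse)
    then have r: "((\<lambda>h. flat n h / h) \<longlongrightarrow> 0) (at_right 0)"
      by (rule Lim_transform_eventually)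
        (auto simp: eventually_at_filter flat_def intro!: always_eventually)
    have l: "((\<lambda>h. flat n h / h) \<longlongrightarrow> 0) (at_left 0)"
      by (rule Lim_transform_eventually[of "\<lambda>_. 0"])
        (auto simp: eventually_at_filter flat_def intro!: always_eventually)
    from l r show ?thesis
      using 3 by (simp add: has_field_derivative_iff filterlim_split_at flat_def)
  qed
qed

lemma times_diff_flat: "times_diff m (flat n)"
proof (induction m arbitrary: n)
  case (Suc m)
  then show ?case using flat_has_derivative by (auto intro!: exI[of _ "flat (Suc n)"])
qed simp

section \<open>A bump function and its normalised primitive\<close>

definition bump :: "real \<Rightarrow> real" where
  "bump t = flat 0 (1 * t + 1) * flat 0 ((- 1) * t + 1)"

lemma times_diff_bump: "times_diff n bump"
  unfolding bump_def by (intro times_diff_mult times_diff_affine times_diff_flat)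

lemma bump_nonneg: "0 \<le> bump t"
  by (simp add: bump_def flat_def)

lemma bump_eq_0: "1 \<le> \<bar>t\<bar> \<Longrightarrow> bump t = 0"
  by (auto simp: bump_def flat_def)

lemma continuous_bump: "continuous_on A bump"
proof -
  have "isCont bump x" for x
    using higher_deriv_of_times_diff[OF times_diff_bump, of 0 x] DERIV_isCont by auto
  then show ?thesis by (simp add: continuous_at_imp_continuous_on)
qed

definition bump_mass :: real where
  "bump_mass = integral {-1..1} bump"

lemma bump_mass_pos: "0 < bump_mass"
proof -
  have "integral {-1..1} bump \<noteq> 0"
  proof
    assume "integral {-1..1} bump = 0"
    then have "\<forall>x\<in>{-1..1}. bump x = 0"
      using integral_eq_0_iff[of "-1" 1 bump] bump_nonneg continuous_bump by auto
    then have "bump 0 = 0" by simp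
    then show False by (simp add: bump_def flat_def)
  qed
  moreover have "integral {-1..1} bump \<ge> 0"
    by (intro integral_nonneg integrable_continuous_real continuous_bump bump_nonneg)
  ultimately show ?thesis by (simp add: bump_mass_def)
qed

text \<open>The lower limit lies to the left of both the support of the bump and t, so
  \<open>step0_eq\<close> can exchange it for any other such limit.\<close>

definition step0 :: "real \<Rightarrow> real" where
  "step0 t = integral {min (-2) t..t} bump / bump_mass"

lemma step0_eq:
  assumes "a \<le> -1" "a \<le> t" shows "step0 t = integral {a..t} bump / bump_mass"
proof -
  have int: "bump integrable_on {c..d}" for c d
    by (intro integrable_continuous_real continuous_bump)
  have z: "integral {c..d} bump = 0" if "d \<le> -1" for c d
  proof -
    have "integral {c..d} bump = integral {c..d} (\<lambda>_. 0)"
      by (rule Henstock_Kurzweil_Integration.integral_cong) (use that bump_eq_0 in auto)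
    then show ?thesis by simp
  qed
  show ?thesis
  proof (cases "t \<le> -1")
    case True
    then show ?thesis by (simp add: step0_def z)
  next
    case False
    then have "integral {-1..t} bump = integral {c..t} bump" if "c \<le> -1" for c
      using Henstock_Kurzweil_Integration.integral_combine[of c "-1" t bump] int z[of "-1" c] that
          by auto
    from this[of a] this[of "min (-2) t"] assms show ?thesis by (simp add: step0_def)
  qed
qed

lemma step0_has_derivative: "(step0 has_real_derivative bump t / bump_mass) (at t)"
proof -
  \<comment> \<open>A lower limit that stays fixed while the upper one varies near t; subtracting 1
    makes t an interior point of the interval.\<close>
  let ?a = "min (-2) t - 1"
  have "((\<lambda>u. integral {?a..u} bump) has_real_derivative bump t) (at t within {?a..t+1})"
    by (rule integral_has_real_derivative) (auto intro: continuous_bump)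
  then have "((\<lambda>u. integral {?a..u} bump) has_real_derivative bump t) (at t)"
    by (subst (asm) at_within_interior) auto
  then have "((\<lambda>u. integral {?a..u} bump / bump_mass) has_real_derivative bump t / bump_mass) (at t)"
    by (rule DERIV_cdivide)
  then show ?thesis
    by (rule has_field_derivative_transform_within_open[of _ _ _ "{?a<..}"])
      (auto simp: step0_eq[of ?a])
qed

lemma times_diff_step0: "times_diff n step0"
proof (cases n)
  case (Suc m)
  have "times_diff m (\<lambda>t. bump t / bump_mass)"
    using times_diff_mult[OF times_diff_bump times_diff_const[of _ "inverse bump_mass"]]
    by (simp add: divide_inverse)
  with Suc show ?thesis
    using step0_has_derivative by (auto intro!: exI[of _ "\<lambda>t. bump t / bump_mass"])
qed simp

definition smooth_step :: "nat \<Rightarrow> real \<Rightarrow> real" where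
  "smooth_step n = (deriv ^^ n) step0"

lemma smooth_step_deriv: "(smooth_step n has_real_derivative smooth_step (Suc n) t) (at t)"
  unfolding smooth_step_def by (rule higher_deriv_of_times_diff[OF times_diff_step0])

lemma continuous_smooth_step: "continuous_on A (smooth_step n)"
  using smooth_step_deriv DERIV_isCont by (blast intro: continuous_at_imp_continuous_on)

lemma smooth_step_0: "t \<le> -1 \<Longrightarrow> smooth_step 0 t = 0"
proof -
  assume t: "t \<le> -1"
  have "integral {t..t} bump = 0" by simp
  then show ?thesis using step0_eq[of t t] t by (simp add: smooth_step_def)
qed

lemma smooth_step_1: "1 \<le> t \<Longrightarrow> smooth_step 0 t = 1"
proof -
  assume t: "1 \<le> t"
  have "integral {1..t} bump = integral {1..t} (\<lambda>_. 0)"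
    by (rule Henstock_Kurzweil_Integration.integral_cong) (use bump_eq_0 in auto)
  then have "integral {-1..t} bump = bump_mass"
    using Henstock_Kurzweil_Integration.integral_combine[of "-1" 1 t bump] t
      integrable_continuous_real[OF continuous_bump]
    by (auto simp: bump_mass_def)
  then show ?thesis using step0_eq[of "-1" t] t bump_mass_pos by (simp add: smooth_step_def)
qed

lemma smooth_step_Suc_0: "smooth_step (Suc 0) t = bump t / bump_mass"
  using step0_has_derivative by (simp add: smooth_step_def DERIV_imp_deriv)

lemma smooth_step_Suc_eq_0: "1 \<le> \<bar>t\<bar> \<Longrightarrow> smooth_step (Suc n) t = 0"
proof (induction n arbitrary: t)
  case 0
  then show ?case by (simp add: smooth_step_Suc_0 bump_eq_0)
next
  case (Suc n)
  have *: "smooth_step (Suc (Suc n)) s = 0" if s: "1 < \<bar>s\<bar>" for s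
  proof -
    have "((\<lambda>_. 0) has_real_derivative 0) (at s)" by simp
    then have "(smooth_step (Suc n) has_real_derivative 0) (at s)"
      by (rule has_field_derivative_transform_within_open[of _ _ _ "{..<-1} \<union> {1<..}"])
        (use s Suc.IH in auto)
    from DERIV_unique[OF this smooth_step_deriv] show ?thesis by simp
  qed
  \<comment> \<open>Differentiating a vanishing function works only on the open set; the points - 1
    and 1 are reached by continuity.\<close>
  have "t \<in> closure ({..<-1} \<union> {1<..})" using Suc.prems by (auto simp: abs_le_iff)
  then show ?case
    by (rule continuous_constant_on_closure[OF continuous_smooth_step, rotated]) (use * in auto)
qed

lemma smooth_step_mono: "s \<le> t \<Longrightarrow> smooth_step 0 s \<le> smooth_step 0 t"
  by (rule DERIV_nonneg_imp_nondecreasing)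
    (use smooth_step_deriv[of 0] bump_nonneg bump_mass_pos in \<open>auto simp: smooth_step_Suc_0 intro!: exI\<close>)

lemma smooth_step_range: "0 \<le> smooth_step 0 t" "smooth_step 0 t \<le> 1"
proof -
  have "smooth_step 0 (min t (-1)) \<le> smooth_step 0 t" "smooth_step 0 t \<le> smooth_step 0 (max t 1)"
    by (rule smooth_step_mono, simp)+
  then show "0 \<le> smooth_step 0 t" "smooth_step 0 t \<le> 1"
    by (simp_all add: smooth_step_0 smooth_step_1)
qed

lemma smooth_step_bounded: "\<exists>B. \<forall>t. \<bar>smooth_step n t\<bar> \<le> B"
proof (cases n)
  case 0
  then show ?thesis using smooth_step_range by (auto intro!: exI[of _ 1])
next
  case (Suc m)
  have "compact (smooth_step n ` {-1..1})"
    by (intro compact_continuous_image continuous_smooth_step) simp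
  then obtain B where B: "\<And>t. t \<in> {-1..1} \<Longrightarrow> \<bar>smooth_step n t\<bar> \<le> B"
    using compact_imp_bounded bounded_iff by (metis imageI real_norm_def)
  have "\<bar>smooth_step n t\<bar> \<le> max B 0" for t
    using B[of t] smooth_step_Suc_eq_0[of t m] Suc by (cases "t \<in> {-1..1}") auto
  then show ?thesis by blast
qed

section \<open>Iterated derivatives within closed sets\<close>

text \<open>Points of S approaching x in every coordinate direction make derivatives within S
  unique, also at boundary points. A whole segment is required because
  \<open>iter_pd_commute_dt_dy\<close> differentiates an integral along it.\<close>

definition segment_set :: "'a::euclidean_space set \<Rightarrow> bool" where
  "segment_set S \<longleftrightarrow> (\<forall>x\<in>S. \<forall>b\<in>Basis. \<exists>e>0. \<exists>\<sigma>. \<bar>\<sigma>\<bar> = 1 \<and> (\<forall>d\<in>{0..e}. x + (\<sigma> * d) *\<^sub>R b \<in> S))"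

lemma segment_setD:
  assumes "segment_set S" "x \<in> S" "b \<in> Basis"
  obtains e \<sigma> where "e > 0" "\<bar>\<sigma>\<bar> = 1" "\<And>d. 0 \<le> d \<Longrightarrow> d \<le> e \<Longrightarrow> x + (\<sigma> * d) *\<^sub>R b \<in> S"
  using assms unfolding segment_set_def by (metis atLeastAtMost_iff)

lemma segment_set_UNIV: "segment_set UNIV"
  by (auto simp: segment_set_def intro!: exI[of _ 1])

lemma segment_set_Times:
  assumes "segment_set S" "segment_set T"
  shows "segment_set (S \<times> T)"
  unfolding segment_set_def
proof (intro ballI)
  fix x :: "'a \<times> 'b" and b :: "'a \<times> 'b"
  assume x: "x \<in> S \<times> T" and b: "b \<in> Basis"
  obtain x1 x2 where [simp]: "x = (x1, x2)" by (cases x)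
  from b consider (1) b1 where "b = (b1, 0)" "b1 \<in> Basis" | (2) b2 where "b = (0, b2)" "b2 \<in> Basis"
    by (auto simp: Basis_prod_def)
  then show "\<exists>e>0. \<exists>\<sigma>. \<bar>\<sigma>\<bar> = 1 \<and> (\<forall>d\<in>{0..e}. x + (\<sigma> * d) *\<^sub>R b \<in> S \<times> T)"
  proof cases
    case 1
    with x assms(1) obtain e \<sigma> where "e > 0" "\<bar>\<sigma>\<bar> = 1" "\<And>d. 0 \<le> d \<Longrightarrow> d \<le> e \<Longrightarrow> x1 + (\<sigma> * d) *\<^sub>R b1 \<in> S"
      by (auto elim!: segment_setD)
    with 1 x show ?thesis by - (rule exI[of _ e], rule conjI, simp, rule exI[of _ \<sigma>], auto)
  next
    case 2
    with x assms(2) obtain e \<sigma> where "e > 0" "\<bar>\<sigma>\<bar> = 1" "\<And>d. 0 \<le> d \<Longrightarrow> d \<le> e \<Longrightarrow> x2 + (\<sigma> * d) *\<^sub>R b2 \<in> T"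
      by (auto elim!: segment_setD)
    with 2 x show ?thesis by - (rule exI[of _ e], rule conjI, simp, rule exI[of _ \<sigma>], auto)
  qed
qed

lemma segment_set_derivative_unique:
  fixes S :: "'a::euclidean_space set"
  assumes "segment_set S" "x \<in> S"
    and "(f has_derivative D) (at x within S)" "(f has_derivative E) (at x within S)"
  shows "D = E"
proof (rule frechet_derivative_unique_within[OF assms(3,4)])
  fix b :: 'a and e :: real
  assume b: "b \<in> Basis" and e: "e > 0"
  obtain e' \<sigma> where *: "e' > 0" "\<bar>\<sigma>\<bar> = 1" "\<And>d. 0 \<le> d \<Longrightarrow> d \<le> e' \<Longrightarrow> x + (\<sigma> * d) *\<^sub>R b \<in> S"
    using segment_setD[OF assms(1,2) b] by metis
  show "\<exists>d. 0 < \<bar>d\<bar> \<and> \<bar>d\<bar> < e \<and> x + d *\<^sub>R b \<in> S"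
    using * e by (intro exI[of _ "\<sigma> * min e' (e/2)"]) (auto simp: abs_mult)
qed

lemma frechet_derivative_segment_set:
  assumes "segment_set S" "x \<in> S" "(f has_derivative D) (at x within S)"
  shows "frechet_derivative f (at x within S) = D"
  using segment_set_derivative_unique[OF assms(1,2) _ assms(3)] assms(3)
  by (meson differentiable_def frechet_derivative_works)

lemma sum_inner_Basis:
  fixes g :: "'a::euclidean_space \<Rightarrow> 'b::real_vector"
  assumes "b \<in> Basis" shows "(\<Sum>c\<in>Basis. (b \<bullet> c) *\<^sub>R g c) = g b"
proof -
  have "(\<Sum>c\<in>Basis. (b \<bullet> c) *\<^sub>R g c) = (\<Sum>c\<in>Basis. if c = b then g c else 0)"
    by (rule sum.cong) (use assms in \<open>auto simp: inner_Basis\<close>)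
  with assms show ?thesis by simp
qed

lemma iter_pd_append: "iter_pd S (as @ bs) f = iter_pd S as (iter_pd S bs f)"
  by (induction as) auto

lemma smooth_within_iter_pd:
  "smooth_within S f \<Longrightarrow> set bs \<subseteq> Basis \<Longrightarrow> smooth_within S (iter_pd S bs f)"
  unfolding smooth_within_def iter_pd_append[symmetric] by auto

lemma iter_pd_has_derivative:
  assumes "smooth_within S f" "set bs \<subseteq> Basis" "x \<in> S"
  shows "(iter_pd S bs f has_derivative (\<lambda>h. \<Sum>b\<in>Basis. (h \<bullet> b) *\<^sub>R iter_pd S (b # bs) f x)) (at x
      within S)"
proof -
  let ?D = "frechet_derivative (iter_pd S bs f) (at x within S)"
  have D: "(iter_pd S bs f has_derivative ?D) (at x within S)"
    using assms unfolding smooth_within_def frechet_derivative_works by blast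
  then have lin: "linear ?D" by (rule has_derivative_linear)
  have *: "?D (\<Sum>b\<in>Basis. (h \<bullet> b) *\<^sub>R b) = (\<Sum>b\<in>Basis. (h \<bullet> b) *\<^sub>R ?D b)" for h
    by (simp only: linear_sum[OF lin] linear_cmul[OF lin])
  have "?D = (\<lambda>h. \<Sum>b\<in>Basis. (h \<bullet> b) *\<^sub>R iter_pd S (b # bs) f x)"
  proof
    fix h
    show "?D h = (\<Sum>b\<in>Basis. (h \<bullet> b) *\<^sub>R iter_pd S (b # bs) f x)"
      using *[of h] unfolding euclidean_representation iter_pd.simps .
  qed
  with D show ?thesis by metis
qed

lemma iter_pd_continuous_on:
  "smooth_within S f \<Longrightarrow> set bs \<subseteq> Basis \<Longrightarrow> continuous_on S (iter_pd S bs f)"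
  using iter_pd_has_derivative has_derivative_continuous
  by (fastforce simp: continuous_on_eq_continuous_within)

text \<open>To compute all iterated derivatives it suffices to guess a family \<open>P\<close> indexed by
  multi-indices that starts at \<open>f\<close> and is consistent under one more differentiation.\<close>

lemma iter_pd_eqI:
  fixes S :: "'a::euclidean_space set"
  assumes S: "segment_set S"
    and P0: "\<And>x. x \<in> S \<Longrightarrow> P [] x = f x"
    and P: "\<And>bs x. set bs \<subseteq> Basis \<Longrightarrow> x \<in> S \<Longrightarrow>
      \<exists>D. (P bs has_derivative D) (at x within S) \<and> (\<forall>b\<in>Basis. D b = P (b # bs) x)"
  shows "smooth_within S f"
    and "\<And>bs x. set bs \<subseteq> Basis \<Longrightarrow> x \<in> S \<Longrightarrow> iter_pd S bs f x = P bs x"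
proof -
  have eq: "set bs \<subseteq> Basis \<Longrightarrow> x \<in> S \<Longrightarrow> iter_pd S bs f x = P bs x" for bs x
  proof (induction bs arbitrary: x)
    case (Cons b bs)
    then have bs: "set bs \<subseteq> Basis" and b: "b \<in> Basis" by auto
    obtain D where D: "(P bs has_derivative D) (at x within S)" "\<forall>b\<in>Basis. D b = P (b # bs) x"
      using P[OF bs Cons.prems(2)] by blast
    have "(iter_pd S bs f has_derivative D) (at x within S)"
      by (rule has_derivative_transform[OF Cons.prems(2) _ D(1)]) (rule Cons.IH[OF bs])
    from frechet_derivative_segment_set[OF S Cons.prems(2) this] D(2) b show ?case by simp
  qed (simp add: P0)
  show "iter_pd S bs f x = P bs x" if "set bs \<subseteq> Basis" "x \<in> S" for bs x
    using eq that .
  show "smooth_within S f"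
    unfolding smooth_within_def
  proof (intro allI impI ballI)
    fix bs x assume bs: "set (bs::'a list) \<subseteq> Basis" and x: "x \<in> S"
    obtain D where D: "(P bs has_derivative D) (at x within S)" using P[OF bs x] by blast
    have "(iter_pd S bs f has_derivative D) (at x within S)"
      by (rule has_derivative_transform[OF x _ D]) (rule eq[OF bs])
    then show "iter_pd S bs f differentiable at x within S" by (auto simp: differentiable_def)
  qed
qed

text \<open>Functions are total but only their values on S matter; this allows rewriting below a
  derivative with equations that hold on S alone.\<close>

lemma iter_pd_cong:
  assumes S: "segment_set S" and f: "smooth_within S f" and fg: "\<And>x. x \<in> S \<Longrightarrow> f x = g x"
  shows "smooth_within S g" and "\<And>bs x. set bs \<subseteq> Basis \<Longrightarrow> x \<in> S \<Longrightarrow> iter_pd S bs g x = iter_pd S bs f x"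
proof -
  have D: "\<exists>D. (iter_pd S bs f has_derivative D) (at x within S) \<and> (\<forall>b\<in>Basis. D b =
      iter_pd S (b # bs) f x)"
    if "set bs \<subseteq> Basis" "x \<in> S" for bs x
    by (intro exI conjI, rule iter_pd_has_derivative[OF f that]) (simp add: sum_inner_Basis)
  show "smooth_within S g" and "\<And>bs x. set bs \<subseteq> Basis \<Longrightarrow> x \<in> S \<Longrightarrow> iter_pd S bs g x = iter_pd S bs f x"
    using iter_pd_eqI[OF S, of "\<lambda>bs. iter_pd S bs f" g, OF _ D] fg by auto
qed

lemma iter_pd_has_derivative_ex:
  assumes "smooth_within S f" "set bs \<subseteq> Basis" "x \<in> S"
  obtains D where "(iter_pd S bs f has_derivative D) (at x within S)"
    "\<And>b. b \<in> Basis \<Longrightarrow> D b = iter_pd S (b # bs) f x"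
proof
  show "(iter_pd S bs f has_derivative (\<lambda>h. \<Sum>b\<in>Basis. (h \<bullet> b) *\<^sub>R iter_pd S (b # bs) f x)) (at x
      within S)"
    by (rule iter_pd_has_derivative[OF assms])
qed (simp add: sum_inner_Basis)

lemma iter_pd_lincomb:
  fixes f g :: "'a::euclidean_space \<Rightarrow> complex"
  assumes S: "segment_set S" and f: "smooth_within S f" and g: "smooth_within S g"
  shows "smooth_within S (\<lambda>x. c * f x + d * g x)"
    and "\<And>bs x. set bs \<subseteq> Basis \<Longrightarrow> x \<in> S \<Longrightarrow>
      iter_pd S bs (\<lambda>x. c * f x + d * g x) x = c * iter_pd S bs f x + d * iter_pd S bs g x"
proof -
  have D: "\<exists>D. ((\<lambda>x. c * iter_pd S bs f x + d * iter_pd S bs g x) has_derivative D) (at x within S) \<and>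
      (\<forall>b\<in>Basis. D b = c * iter_pd S (b # bs) f x + d * iter_pd S (b # bs) g x)"
    if bs: "set bs \<subseteq> Basis" and x: "x \<in> S" for bs x
  proof -
    obtain F where F: "(iter_pd S bs f has_derivative F) (at x within S)"
      "\<And>b. b \<in> Basis \<Longrightarrow> F b = iter_pd S (b # bs) f x" using iter_pd_has_derivative_ex[OF f bs x] by metis
    obtain G where G: "(iter_pd S bs g has_derivative G) (at x within S)"
      "\<And>b. b \<in> Basis \<Longrightarrow> G b = iter_pd S (b # bs) g x" using iter_pd_has_derivative_ex[OF g bs x] by metis
    show ?thesis
      by (intro exI[of _ "\<lambda>h. c * F h + d * G h"] conjI) (auto intro!: derivative_eq_intros F(1)
          G(1) simp: F(2) G(2))
  qed
  show "smooth_within S (\<lambda>x. c * f x + d * g x)"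
    and "\<And>bs x. set bs \<subseteq> Basis \<Longrightarrow> x \<in> S \<Longrightarrow>
      iter_pd S bs (\<lambda>x. c * f x + d * g x) x = c * iter_pd S bs f x + d * iter_pd S bs g x"
    using iter_pd_eqI[OF S, of "\<lambda>bs x. c * iter_pd S bs f x + d * iter_pd S bs g x" "\<lambda>x. c * f x +
        d * g x", OF _ D]
    by auto
qed

lemma iter_pd_const:
  assumes S: "segment_set S"
  shows "smooth_within S (\<lambda>_. c)"
    and "\<And>bs x. set bs \<subseteq> Basis \<Longrightarrow> x \<in> S \<Longrightarrow> iter_pd S bs (\<lambda>_. c) x = (if bs = [] then c else 0)"
proof -
  have "\<exists>D. ((\<lambda>x. if bs = [] then c else 0) has_derivative D) (at x within S) \<and>
      (\<forall>b\<in>Basis. D b = (if b # bs = [] then c else 0))" for bs and x :: 'a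
    by (intro exI[of _ "\<lambda>_. 0"]) auto
  from iter_pd_eqI[OF S, of "\<lambda>bs x. if bs = [] then c else 0", OF _ this]
  show "smooth_within S (\<lambda>_. c)"
    and "\<And>bs x. set bs \<subseteq> Basis \<Longrightarrow> x \<in> S \<Longrightarrow> iter_pd S bs (\<lambda>_. c) x = (if bs = [] then c else 0)"
    by auto
qed

lemma iter_pd_sum:
  fixes f :: "'i \<Rightarrow> 'a::euclidean_space \<Rightarrow> complex"
  assumes S: "segment_set S" and "finite I" and "\<And>i. i \<in> I \<Longrightarrow> smooth_within S (f i)"
  shows "smooth_within S (\<lambda>x. \<Sum>i\<in>I. f i x) \<and> (\<forall>bs x. set bs \<subseteq> Basis \<longrightarrow> x \<in> S \<longrightarrow>
      iter_pd S bs (\<lambda>x. \<Sum>i\<in>I. f i x) x = (\<Sum>i\<in>I. iter_pd S bs (f i) x))"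
  using assms(2,3)
proof (induction rule: finite_induct)
  case empty
  then show ?case using iter_pd_const[OF S, where c=0] by auto
next
  case (insert j I)
  from iter_pd_lincomb[OF S, of "f j" "\<lambda>x. \<Sum>i\<in>I. f i x", where c=1 and d=1] insert show ?case by simp
qed

text \<open>Lists the distributions of the derivatives over two factors with repetitions, so the
  Leibniz rule needs no binomial coefficients; it has 2 to the order many terms.\<close>

primrec splits :: "'a list \<Rightarrow> ('a list \<times> 'a list) list" where
  "splits [] = [([], [])]"
| "splits (b # bs) = map (\<lambda>(as, cs). (b # as, cs)) (splits bs) @ map (\<lambda>(as, cs). (as,
    b # cs)) (splits bs)"

lemma splits_subset:
  "(as, cs) \<in> set (splits bs) \<Longrightarrow> set as \<subseteq> set bs \<and> set cs \<subseteq> set bs \<and> length as \<le> length bs \<and>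
      length cs \<le> length bs"
proof (induction bs arbitrary: as cs)
  case (Cons b bs)
  from Cons.prems consider as' where "as = b # as'" "(as', cs) \<in> set (splits bs)"
    | cs' where "cs = b # cs'" "(as, cs') \<in> set (splits bs)" by auto
  then show ?case by cases (drule Cons.IH; auto)+
qed simp

lemma length_splits: "length (splits bs) = 2 ^ length bs"
  by (induction bs) auto

lemma has_derivative_sum_list:
  assumes "\<And>i. i \<in> set xs \<Longrightarrow> (f i has_derivative f' i) F"
  shows "((\<lambda>x. \<Sum>i\<leftarrow>xs. f i x) has_derivative (\<lambda>h. \<Sum>i\<leftarrow>xs. f' i h)) F"
  using assms by (induction xs) (auto intro!: derivative_intros)

lemma iter_pd_mult:
  fixes f g :: "'a::euclidean_space \<Rightarrow> complex"
  assumes S: "segment_set S" and f: "smooth_within S f" and g: "smooth_within S g"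
  shows "smooth_within S (\<lambda>x. f x * g x)"
    and "\<And>bs x. set bs \<subseteq> Basis \<Longrightarrow> x \<in> S \<Longrightarrow>
      iter_pd S bs (\<lambda>x. f x * g x) x = (\<Sum>(as, cs)\<leftarrow>splits bs. iter_pd S as f x * iter_pd S cs g x)"
proof -
  have D: "\<exists>D. ((\<lambda>x. \<Sum>(as, cs)\<leftarrow>splits bs. iter_pd S as f x * iter_pd S cs g x) has_derivative D)
      (at x within S) \<and>
      (\<forall>b\<in>Basis. D b = (\<Sum>(as, cs)\<leftarrow>splits (b # bs). iter_pd S as f x * iter_pd S cs g x))"
    if bs: "set bs \<subseteq> Basis" and x: "x \<in> S" for bs x
  proof -
    define F where "F as h = (\<Sum>b\<in>Basis. (h \<bullet> b) *\<^sub>R iter_pd S (b # as) f x)" for as h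
    define G where "G as h = (\<Sum>b\<in>Basis. (h \<bullet> b) *\<^sub>R iter_pd S (b # as) g x)" for as h
    have [simp]: "F as b = iter_pd S (b # as) f x" "G as b = iter_pd S (b # as) g x" if
        "b \<in> Basis" for b as
      using that by (simp_all add: F_def G_def sum_inner_Basis)
    have "((\<lambda>x. \<Sum>p\<leftarrow>splits bs. iter_pd S (fst p) f x * iter_pd S (snd p) g x) has_derivative
        (\<lambda>h. \<Sum>p\<leftarrow>splits bs. iter_pd S (fst p) f x * G (snd p) h + F (fst p) h * iter_pd S (snd p) g
            x)) (at x within S)"
    proof (rule has_derivative_sum_list)
      fix p assume "p \<in> set (splits bs)"
      then have "set (fst p) \<subseteq> Basis" "set (snd p) \<subseteq> Basis"
        using splits_subset[of "fst p" "snd p" bs] bs by auto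
      from iter_pd_has_derivative[OF f this(1) x] iter_pd_has_derivative[OF g this(2) x]
      show "((\<lambda>x. iter_pd S (fst p) f x * iter_pd S (snd p) g x) has_derivative
        (\<lambda>h. iter_pd S (fst p) f x * G (snd p) h + F (fst p) h * iter_pd S (snd p) g x)) (at x within S)"
        unfolding F_def[symmetric] G_def[symmetric] by (rule has_derivative_mult)
    qed
    then show ?thesis
      by (intro exI conjI) (auto simp: case_prod_unfold sum_list_addf o_def simp del: iter_pd.simps)
  qed
  show "smooth_within S (\<lambda>x. f x * g x)"
    and "\<And>bs x. set bs \<subseteq> Basis \<Longrightarrow> x \<in> S \<Longrightarrow>
      iter_pd S bs (\<lambda>x. f x * g x) x = (\<Sum>(as, cs)\<leftarrow>splits bs. iter_pd S as f x * iter_pd S cs g x)"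
    using iter_pd_eqI[OF S, of "\<lambda>bs x. \<Sum>(as, cs)\<leftarrow>splits bs. iter_pd S as f x * iter_pd S cs g x"
        "\<lambda>x. f x * g x", OF _ D]
    by auto
qed

lemma norm_sum_list_le: "norm (sum_list xs) \<le> (\<Sum>x\<leftarrow>xs. norm x)"
  by (induction xs) (auto intro: order_trans[OF norm_triangle_ineq])

lemma norm_iter_pd_mult_le:
  assumes S: "segment_set S" and f: "smooth_within S f" and g: "smooth_within S g"
    and bs: "set bs \<subseteq> Basis" "length bs \<le> m" and x: "x \<in> S"
    and A: "\<And>as. set as \<subseteq> Basis \<Longrightarrow> length as \<le> m \<Longrightarrow> norm (iter_pd S as f x) \<le> A"
    and B: "\<And>as. set as \<subseteq> Basis \<Longrightarrow> length as \<le> m \<Longrightarrow> norm (iter_pd S as g x) \<le> B"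
  shows "norm (iter_pd S bs (\<lambda>x. f x * g x) x) \<le> 2 ^ m * (A * B)"
proof -
  have A0: "0 \<le> A" using order_trans[OF norm_ge_zero A[of "[]"]] by simp
  have B0: "0 \<le> B" using order_trans[OF norm_ge_zero B[of "[]"]] by simp
  have "norm (iter_pd S bs (\<lambda>x. f x * g x) x) \<le>
      (\<Sum>p\<leftarrow>splits bs. norm (iter_pd S (fst p) f x * iter_pd S (snd p) g x))"
    unfolding iter_pd_mult(2)[OF S f g bs(1) x] case_prod_unfold
    by (rule order_trans[OF norm_sum_list_le]) (simp add: o_def)
  also have "\<dots> \<le> (\<Sum>p\<leftarrow>splits bs. A * B)"
  proof (rule sum_list_mono)
    fix p assume "p \<in> set (splits bs)"
    then have "set (fst p) \<subseteq> Basis" "set (snd p) \<subseteq> Basis" "length (fst p) \<le> m" "length (snd p) \<le> m"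
      using splits_subset[of "fst p" "snd p" bs] bs by auto
    then show "norm (iter_pd S (fst p) f x * iter_pd S (snd p) g x) \<le> A * B"
      unfolding norm_mult by (intro mult_mono A B A0) auto
  qed
  also have "\<dots> = 2 ^ length bs * (A * B)" by (simp add: sum_list_triv length_splits)
  also have "\<dots> \<le> 2 ^ m * (A * B)"
    using A0 B0 bs(2) by (intro mult_right_mono power_increasing) auto
  finally show ?thesis .
qed

section \<open>Multi-indices on product spaces\<close>

definition fst_part :: "('a::zero \<times> 'b::zero) list \<Rightarrow> 'a list" where
  "fst_part bs = map fst (filter (\<lambda>b. snd b = 0) bs)"

text \<open>A basis vector of a product has exactly one nonzero component, so testing
  \<open>snd b\<close> sorts the entries by factor. Each part keeps its order.\<close>

definition snd_part :: "('a::zero \<times> 'b::zero) list \<Rightarrow> 'b list" where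
  "snd_part bs = map snd (filter (\<lambda>b. snd b \<noteq> 0) bs)"

lemma part_simps [simp]:
  "fst_part [] = []" "snd_part [] = []"
  "fst_part ((a, 0) # bs) = a # fst_part bs" "snd_part ((a, 0) # bs) = snd_part bs"
  "c \<noteq> 0 \<Longrightarrow> fst_part ((a, c) # bs) = fst_part bs" "c \<noteq> 0 \<Longrightarrow> snd_part ((a, c) # bs) = c # snd_part bs"
  by (auto simp: fst_part_def snd_part_def)

lemma Basis_prod_cases:
  assumes "b \<in> (Basis :: ('a::euclidean_space \<times> 'b::euclidean_space) set)"
  obtains b1 where "b = (b1, 0)" "b1 \<in> Basis" | b2 where "b = (0, b2)" "b2 \<in> Basis" "b2 \<noteq> 0"
  using assms by (auto simp: Basis_prod_def dest: nonzero_Basis)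

lemma part_Basis:
  fixes bs :: "('a::euclidean_space \<times> 'b::euclidean_space) list"
  assumes "set bs \<subseteq> Basis"
  shows "set (fst_part bs) \<subseteq> Basis" "set (snd_part bs) \<subseteq> Basis"
    "length (fst_part bs) + length (snd_part bs) = length bs"
  using assms by (induction bs) (auto elim!: Basis_prod_cases)

lemma iter_pd_tensor:
  fixes f :: "'a::euclidean_space \<Rightarrow> complex" and g :: "'b::euclidean_space \<Rightarrow> complex"
  assumes S: "segment_set S" and T: "segment_set T" and f: "smooth_within S f" and g: "smooth_within T g"
  shows "smooth_within (S \<times> T) (\<lambda>(x, y). f x * g y)"
    and "\<And>bs x y. set bs \<subseteq> Basis \<Longrightarrow> x \<in> S \<Longrightarrow> y \<in> T \<Longrightarrow>
      iter_pd (S \<times> T) bs (\<lambda>(x, y). f x * g y) (x, y) =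
          iter_pd S (fst_part bs) f x * iter_pd T (snd_part bs) g y"
proof -
  let ?P = "\<lambda>bs p. iter_pd S (fst_part bs) f (fst p) * iter_pd T (snd_part bs) g (snd p)"
  have D: "\<exists>D. (?P bs has_derivative D) (at p within S \<times> T) \<and> (\<forall>b\<in>Basis. D b = ?P (b # bs) p)"
    if bs: "set bs \<subseteq> Basis" and p: "p \<in> S \<times> T" for bs p
  proof -
    obtain F where F: "(iter_pd S (fst_part bs) f has_derivative F) (at (fst p) within S)"
      "\<And>b. b \<in> Basis \<Longrightarrow> F b = iter_pd S (b # fst_part bs) f (fst p)"
      using iter_pd_has_derivative_ex[OF f part_Basis(1)[OF bs],
          of "fst p"] p by (auto simp: mem_Times_iff)
    obtain G where G: "(iter_pd T (snd_part bs) g has_derivative G) (at (snd p) within T)"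
      "\<And>b. b \<in> Basis \<Longrightarrow> G b = iter_pd T (b # snd_part bs) g (snd p)"
      using iter_pd_has_derivative_ex[OF g part_Basis(2)[OF bs],
          of "snd p"] p by (auto simp: mem_Times_iff)
    have F0: "F 0 = 0" "G 0 = 0"
      using has_derivative_linear[OF F(1)] has_derivative_linear[OF G(1)] by (simp_all add: linear_0)
    have "((\<lambda>p. iter_pd S (fst_part bs) f (fst p)) has_derivative (\<lambda>h. F (fst h))) (at p within S \<times> T)"
      by (rule has_derivative_in_compose[where g="iter_pd S (fst_part bs) f" and f=fst,
          simplified o_def])
        (auto intro!: derivative_eq_intros has_derivative_subset[OF F(1)] simp del: fst_image_times
            snd_image_times)
    moreover have "((\<lambda>p. iter_pd T (snd_part bs) g (snd p)) has_derivative (\<lambda>h. G (snd h))) (at p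
        within S \<times> T)"
      by (rule has_derivative_in_compose[where g="iter_pd T (snd_part bs) g" and f=snd,
          simplified o_def])
        (auto intro!: derivative_eq_intros has_derivative_subset[OF G(1)] simp del: fst_image_times
            snd_image_times)
    ultimately have "(?P bs has_derivative (\<lambda>h. iter_pd S (fst_part bs) f (fst p) * G (snd h) +
        F (fst h) * iter_pd T (snd_part bs) g (snd p))) (at p within S \<times> T)"
      by (rule has_derivative_mult)
    then show ?thesis
      by (intro exI conjI, assumption) (auto elim!: Basis_prod_cases simp: F0 F(2) G(2))
  qed
  show "smooth_within (S \<times> T) (\<lambda>(x, y). f x * g y)"
    and "\<And>bs x y. set bs \<subseteq> Basis \<Longrightarrow> x \<in> S \<Longrightarrow> y \<in> T \<Longrightarrow>
      iter_pd (S \<times> T) bs (\<lambda>(x, y). f x * g y) (x, y) =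
          iter_pd S (fst_part bs) f x * iter_pd T (snd_part bs) g y"
    using iter_pd_eqI[OF segment_set_Times[OF S T], of ?P "\<lambda>(x, y). f x * g y", OF _ D] by auto
qed

lemma iter_pd_slice:
  fixes f :: "'a::euclidean_space \<times> 'b::euclidean_space \<Rightarrow> complex"
  assumes S: "segment_set S" and f: "smooth_within (S \<times> T) f" and y: "y \<in> T"
  shows "smooth_within S (\<lambda>x. f (x, y))"
    and "\<And>bs x. set bs \<subseteq> Basis \<Longrightarrow> x \<in> S \<Longrightarrow>
      iter_pd S bs (\<lambda>x. f (x, y)) x = iter_pd (S \<times> T) (map (\<lambda>b. (b, 0)) bs) f (x, y)"
proof -
  let ?P = "\<lambda>bs x. iter_pd (S \<times> T) (map (\<lambda>b. (b, 0)) bs) f (x, y)"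
  have D: "\<exists>D. (?P bs has_derivative D) (at x within S) \<and> (\<forall>b\<in>Basis. D b = ?P (b # bs) x)"
    if bs: "set bs \<subseteq> Basis" and x: "x \<in> S" for bs x
  proof -
    have "set (map (\<lambda>b. (b, 0::'b)) bs) \<subseteq> Basis" using bs by (auto simp: Basis_prod_def)
    from iter_pd_has_derivative_ex[OF f this, of "(x, y)"] x y
    obtain D where D: "(iter_pd (S \<times> T) (map (\<lambda>b. (b, 0)) bs) f has_derivative D) (at (x,
        y) within S \<times> T)"
      "\<And>b. b \<in> Basis \<Longrightarrow> D b = iter_pd (S \<times> T) (b # map (\<lambda>b. (b, 0)) bs) f (x, y)" by blast
    have "(?P bs has_derivative (\<lambda>h. D (h, 0))) (at x within S)"
      by (rule has_derivative_in_compose[where g="iter_pd (S \<times> T) (map (\<lambda>b. (b,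
          0)) bs) f" and f="\<lambda>x. (x, y)", simplified o_def])
        (use y in \<open>auto intro!: derivative_eq_intros has_derivative_subset[OF D(1)]\<close>)
    then show ?thesis
      by (intro exI conjI, assumption) (auto simp: D(2) Basis_prod_def)
  qed
  show "smooth_within S (\<lambda>x. f (x, y))"
    and "\<And>bs x. set bs \<subseteq> Basis \<Longrightarrow> x \<in> S \<Longrightarrow>
      iter_pd S bs (\<lambda>x. f (x, y)) x = iter_pd (S \<times> T) (map (\<lambda>b. (b, 0)) bs) f (x, y)"
    using iter_pd_eqI[OF S, of ?P "\<lambda>x. f (x, y)", OF _ D] by auto
qed

lemma iter_pd_real:
  fixes F :: "nat \<Rightarrow> real \<Rightarrow> complex"
  assumes F: "\<And>n t. (F n has_vector_derivative F (Suc n) t) (at t)"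
  shows "smooth_within UNIV (F 0)"
    and "\<And>bs t. set bs \<subseteq> Basis \<Longrightarrow> iter_pd UNIV bs (F 0) t = F (length bs) t"
proof -
  have D: "\<exists>D. (F (length bs) has_derivative D) (at t within UNIV) \<and> (\<forall>b\<in>Basis. D b =
      F (length (b # bs)) t)" for bs :: "real list" and t
    by (intro exI[of _ "\<lambda>h. h *\<^sub>R F (Suc (length bs)) t"] conjI) (use F in \<open>auto simp:
        has_vector_derivative_def\<close>)
  show "smooth_within UNIV (F 0)"
    and "\<And>bs t. set bs \<subseteq> Basis \<Longrightarrow> iter_pd UNIV bs (F 0) t = F (length bs) t"
    using iter_pd_eqI[OF segment_set_UNIV, of "\<lambda>bs. F (length bs)" "F 0", OF _ D] by auto
qed

section \<open>Cylinders over K: exchanging time and space derivatives\<close>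

lemma iter_pd_cylinder_dt:
  fixes f :: "'a::euclidean_space \<times> real \<Rightarrow> complex"
  assumes f: "smooth_within (K \<times> UNIV) f" and bs: "set bs \<subseteq> Basis" and y: "y \<in> K"
  shows "((\<lambda>t. iter_pd (K \<times> UNIV) bs f (y, t)) has_vector_derivative
    iter_pd (K \<times> UNIV) ((0, 1) # bs) f (y, t)) (at t)"
proof -
  let ?S = "K \<times> (UNIV :: real set)"
  obtain D where D: "(iter_pd ?S bs f has_derivative D) (at (y, t) within ?S)"
    "\<And>b. b \<in> Basis \<Longrightarrow> D b = iter_pd ?S (b # bs) f (y, t)"
    using iter_pd_has_derivative_ex[OF f bs, of "(y, t)"] y by auto
  have "((\<lambda>t. iter_pd ?S bs f (y, t)) has_derivative (\<lambda>h. D (0, h))) (at t)"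
    by (rule has_derivative_in_compose[where g="iter_pd ?S bs f" and f="\<lambda>t. (y, t)", simplified o_def])
      (use y in \<open>auto intro!: derivative_eq_intros has_derivative_subset[OF D(1)]\<close>)
  moreover have "D (0, h) = h *\<^sub>R iter_pd ?S ((0, 1) # bs) f (y, t)" for h
  proof -
    have "D (h *\<^sub>R (0, 1)) = h *\<^sub>R D (0, 1)"
      using has_derivative_linear[OF D(1)] by (rule linear_cmul)
    with D(2)[of "(0, 1)"] show ?thesis by (simp add: Basis_prod_def)
  qed
  ultimately show ?thesis by (simp add: has_vector_derivative_def)
qed

lemma iter_pd_cylinder_dy:
  fixes f :: "'a::euclidean_space \<times> real \<Rightarrow> complex"
  assumes f: "smooth_within (K \<times> UNIV) f" and bs: "set bs \<subseteq> Basis" and b: "b \<in> Basis"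
    and I: "\<And>d. d \<in> I \<Longrightarrow> y + (\<sigma> * d) *\<^sub>R b \<in> K" and d: "d \<in> I"
  shows "((\<lambda>d. iter_pd (K \<times> UNIV) bs f (y + (\<sigma> * d) *\<^sub>R b, t)) has_vector_derivative
    \<sigma> *\<^sub>R iter_pd (K \<times> UNIV) ((b, 0) # bs) f (y + (\<sigma> * d) *\<^sub>R b, t)) (at d within I)"
proof -
  let ?S = "K \<times> (UNIV :: real set)" and ?y = "\<lambda>d. y + (\<sigma> * d) *\<^sub>R b"
  obtain D where D: "(iter_pd ?S bs f has_derivative D) (at (?y d, t) within ?S)"
    "\<And>b. b \<in> Basis \<Longrightarrow> D b = iter_pd ?S (b # bs) f (?y d, t)"
    using iter_pd_has_derivative_ex[OF f bs, of "(?y d, t)"] I[OF d] by auto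
  have "((\<lambda>d. iter_pd ?S bs f (?y d, t)) has_derivative (\<lambda>h. D ((\<sigma> * h) *\<^sub>R b, 0))) (at d within I)"
    by (rule has_derivative_in_compose[where g="iter_pd ?S bs f" and f="\<lambda>d. (?y d, t)",
        simplified o_def])
      (use I in \<open>auto intro!: derivative_eq_intros has_derivative_subset[OF D(1)]\<close>)
  moreover have "D ((\<sigma> * h) *\<^sub>R b, 0) = h *\<^sub>R (\<sigma> *\<^sub>R iter_pd ?S ((b, 0) # bs) f (?y d, t))" for h
  proof -
    have "D ((\<sigma> * h) *\<^sub>R (b, 0)) = (\<sigma> * h) *\<^sub>R D (b, 0)"
      using has_derivative_linear[OF D(1)] by (rule linear_cmul)
    with D(2)[of "(b, 0)"] b show ?thesis by (simp add: Basis_prod_def mult.commute)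
  qed
  ultimately show ?thesis by (simp add: has_vector_derivative_def)
qed

text \<open>Symmetry is wanted up to the boundary of K, where y has no neighbourhood in K. Only time
  is unrestricted: so f is written as a time integral of its time derivative, this integral is
  differentiated in y along a segment in K, and the result is differentiated in the upper
  limit.\<close>

lemma iter_pd_commute_dt_dy:
  fixes f :: "'a::euclidean_space \<times> real \<Rightarrow> complex"
  assumes K: "segment_set K" and f: "smooth_within (K \<times> UNIV) f" and b: "b \<in> Basis" and y: "y \<in> K"
  shows "iter_pd (K \<times> UNIV) [(b, 0), (0, 1)] f (y, t) = iter_pd (K \<times> UNIV) [(0, 1), (b, 0)] f (y, t)"
proof -
  let ?S = "K \<times> (UNIV :: real set)"
  define A where "A = iter_pd ?S [(0, 1)] f"
  define B where "B = iter_pd ?S [(b, 0)] f"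
  define H where "H = iter_pd ?S [(b, 0), (0, 1)] f"
  have B1: "(0, 1) \<in> (Basis :: ('a \<times> real) set)" "(b, 0) \<in> (Basis :: ('a \<times> real) set)"
    using b by (auto simp: Basis_prod_def)
  have contA: "continuous_on ?S A" and contH: "continuous_on ?S H"
    unfolding A_def H_def by (rule iter_pd_continuous_on[OF f]; use B1 in simp)+
  obtain e \<sigma> where e: "e > 0" "\<bar>\<sigma>\<bar> = 1" "\<And>d. 0 \<le> d \<Longrightarrow> d \<le> e \<Longrightarrow> y + (\<sigma> * d) *\<^sub>R b \<in> K"
    using segment_setD[OF K y b] by metis
  let ?y = "\<lambda>d. y + (\<sigma> * d) *\<^sub>R b" and ?I = "{0..e}"
  have yK: "d \<in> ?I \<Longrightarrow> ?y d \<in> K" for d using e by simp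
  \<comment> \<open>The base time t - 1 makes t interior to {t - 1..t + 1}, where the final
    comparison takes place.\<close>
  have FTC: "f (z, T) - f (z, t - 1) = integral {t - 1..T} (\<lambda>s. A (z, s))" if "z \<in> K" "t - 1 \<le> T" for z T
  proof -
    have "((\<lambda>s. A (z, s)) has_integral f (z, T) - f (z, t - 1)) {t - 1..T}"
      using iter_pd_cylinder_dt[OF f _ that(1), of "[]"] that(2)
      by (intro fundamental_theorem_of_calculus) (auto simp: A_def intro:
          has_vector_derivative_at_within)
    then show ?thesis by (simp add: integral_unique)
  qed
  \<comment> \<open>Two values of the one-sided derivative at d = 0 of the increment of f between
    the times t - 1 and T: under the integral sign, and term by term.\<close>
  have key: "B (y, T) - B (y, t - 1) = integral {t - 1..T} (\<lambda>s. H (y, s))" if T: "t - 1 \<le> T" for T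
  proof -
    have "((\<lambda>d. integral (cbox (t - 1) T) (\<lambda>s. A (?y d, s))) has_vector_derivative
        integral (cbox (t - 1) T) (\<lambda>s. \<sigma> *\<^sub>R H (?y 0, s))) (at 0 within ?I)"
    proof (rule leibniz_rule_vector_derivative)
      fix d s assume d: "d \<in> ?I"
      then show "((\<lambda>d. A (?y d, s)) has_vector_derivative \<sigma> *\<^sub>R H (?y d, s)) (at d within ?I)"
        using iter_pd_cylinder_dy[OF f _ b yK d, of "[(0, 1)]" s] B1 by (simp add: A_def H_def)
    next
      fix d assume "d \<in> ?I"
      then show "(\<lambda>s. A (?y d, s)) integrable_on cbox (t - 1) T"
        using yK by (intro integrable_continuous continuous_on_compose2[OF contA] continuous_intros) auto
    next
      show "continuous_on (?I \<times> cbox (t - 1) T) (\<lambda>(d, s). \<sigma> *\<^sub>R H (?y d, s))"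
        unfolding case_prod_unfold
        using yK by (intro continuous_intros continuous_on_compose2[OF contH]) auto
    qed (use e in auto)
    then have 1: "((\<lambda>d. f (?y d, T) - f (?y d, t - 1)) has_vector_derivative
        \<sigma> *\<^sub>R integral {t - 1..T} (\<lambda>s. H (y, s))) (at 0 within ?I)"
      by (subst (asm) integral_cmul) (rule has_vector_derivative_transform[rotated 2]; use FTC yK T
          e in auto)
    have 2: "((\<lambda>d. f (?y d, T) - f (?y d, t - 1)) has_vector_derivative
        \<sigma> *\<^sub>R B (?y 0, T) - \<sigma> *\<^sub>R B (?y 0, t - 1)) (at 0 within ?I)"
    proof (rule has_vector_derivative_diff)
      have "0 \<in> ?I" using e by simp
      from iter_pd_cylinder_dy[OF f _ b yK this, of "[]"]
      show "((\<lambda>d. f (?y d, T)) has_vector_derivative \<sigma> *\<^sub>R B (?y 0, T)) (at 0 within ?I)"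
        and "((\<lambda>d. f (?y d, t - 1)) has_vector_derivative \<sigma> *\<^sub>R B (?y 0, t - 1)) (at 0 within ?I)"
        by (simp_all add: B_def)
    qed
    have "\<sigma> *\<^sub>R integral {t - 1..T} (\<lambda>s. H (y, s)) = \<sigma> *\<^sub>R B (?y 0, T) - \<sigma> *\<^sub>R B (?y 0, t - 1)"
      by (rule vector_derivative_unique_within_closed_interval[of 0 e 0, OF e(1)])
        (use 1 2 e in auto)
    then have "\<sigma> *\<^sub>R (integral {t - 1..T} (\<lambda>s. H (y, s)) - (B (y, T) - B (y, t - 1))) = 0"
      by (simp add: algebra_simps)
    with e(2) show ?thesis by auto
  qed
  have "((\<lambda>T. integral {t - 1..T} (\<lambda>s. H (y, s))) has_vector_derivative H (y,
      t)) (at t within {t - 1..t + 1})"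
    by (rule integral_has_vector_derivative)
      (use y in \<open>auto intro!: continuous_on_compose2[OF contH] continuous_intros\<close>)
  then have "((\<lambda>T. B (y, T) - B (y, t - 1)) has_vector_derivative H (y, t)) (at t within {t - 1..t + 1})"
    by (rule has_vector_derivative_transform[rotated 2]) (use key in auto)
  moreover have "((\<lambda>T. B (y, T) - B (y, t - 1)) has_vector_derivative
      iter_pd ?S [(0, 1), (b, 0)] f (y, t) - 0) (at t within {t - 1..t + 1})"
    using iter_pd_cylinder_dt[OF f _ y, of "[(b, 0)]" t] B1
    by (intro has_vector_derivative_diff has_vector_derivative_const)
      (auto simp: B_def intro: has_vector_derivative_at_within)
  ultimately show ?thesis
    using vector_derivative_unique_within_closed_interval[of "t - 1" "t + 1" t]
    by (auto simp: H_def)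
qed

lemma iter_pd_move_dy:
  fixes f :: "'a::euclidean_space \<times> real \<Rightarrow> complex"
  assumes K: "segment_set K" and f: "smooth_within (K \<times> UNIV) f" and b: "b \<in> Basis" and p: "p \<in> K \<times> UNIV"
  shows "iter_pd (K \<times> UNIV) ((b, 0) # replicate n (0, 1)) f p = iter_pd (K \<times> UNIV) (replicate n (0,
      1) @ [(b, 0)]) f p"
  using p
proof (induction n arbitrary: p)
  case (Suc n)
  let ?S = "K \<times> (UNIV :: real set)" and ?T = "replicate n (0 :: 'a, 1 :: real)"
  have S: "segment_set ?S" by (rule segment_set_Times[OF K segment_set_UNIV])
  have B: "set ?T \<subseteq> Basis" "(b, 0 :: real) \<in> Basis" "(0 :: 'a, 1 :: real) \<in> Basis"
    using b by (auto simp: Basis_prod_def)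
  have sm: "smooth_within ?S (iter_pd ?S ((b, 0) # ?T) f)"
    by (rule smooth_within_iter_pd[OF f]) (use B in auto)
  have "iter_pd ?S ((b, 0) # (0, 1) # ?T) f p = iter_pd ?S [(b, 0), (0, 1)] (iter_pd ?S ?T f) p"
    by simp
  also have "\<dots> = iter_pd ?S [(0, 1), (b, 0)] (iter_pd ?S ?T f) p"
    using iter_pd_commute_dt_dy[OF K smooth_within_iter_pd[OF f B(1)] b,
        of "fst p" "snd p"] Suc.prems by auto
  also have "\<dots> = iter_pd ?S [(0, 1)] (iter_pd ?S ((b, 0) # ?T) f) p" by simp
  also have "\<dots> = iter_pd ?S [(0, 1)] (iter_pd ?S (?T @ [(b, 0)]) f) p"
    by (rule iter_pd_cong(2)[OF S sm, symmetric]) (use Suc B in auto)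
  finally show ?case by simp
qed simp

text \<open>Only derivatives in \<open>t\<close> have to be commuted with the others: the order of the
  derivatives in \<open>y\<close> is kept.\<close>

lemma iter_pd_sort:
  fixes f :: "'a::euclidean_space \<times> real \<Rightarrow> complex"
  assumes K: "segment_set K" and f: "smooth_within (K \<times> UNIV) f" and p: "p \<in> K \<times> UNIV" and "set bs
      \<subseteq> Basis"
  shows "iter_pd (K \<times> UNIV) bs f p =
    iter_pd (K \<times> UNIV) (replicate (length (snd_part bs)) (0, 1) @ map (\<lambda>b. (b, 0)) (fst_part bs)) f p"
  using p \<open>set bs \<subseteq> Basis\<close>
proof (induction bs arbitrary: p)
  case (Cons b bs)
  let ?S = "K \<times> (UNIV :: real set)"
  let ?c = "replicate (length (snd_part bs)) (0, 1) @ map (\<lambda>b. (b, 0)) (fst_part bs)"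
  have S: "segment_set ?S" by (rule segment_set_Times[OF K segment_set_UNIV])
  have bs: "set bs \<subseteq> Basis" and b: "b \<in> Basis" using Cons.prems by auto
  have y: "set (map (\<lambda>b. (b, 0::real)) (fst_part bs)) \<subseteq> Basis"
    using part_Basis(1)[OF bs] by (auto simp: Basis_prod_def)
  have eq: "iter_pd ?S (b # bs) f p = iter_pd ?S (b # ?c) f p"
  proof -
    \<comment> \<open>The induction hypothesis holds on the cylinder only, which is enough below one
      further derivative within it.\<close>
    have "iter_pd ?S [b] (iter_pd ?S ?c f) p = iter_pd ?S [b] (iter_pd ?S bs f) p"
      by (rule iter_pd_cong(2)[OF S smooth_within_iter_pd[OF f bs]]) (use Cons b bs in auto)
    then show ?thesis by simp
  qed
  from b show ?case
  proof (cases rule: Basis_prod_cases)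
    case (1 b1)
    have "iter_pd ?S (b # ?c) f p =
        iter_pd ?S ((b1, 0) # replicate (length (snd_part bs)) (0, 1)) (iter_pd ?S (map (\<lambda>b. (b,
            0)) (fst_part bs)) f) p"
      using 1 by (simp add: iter_pd_append)
    also have "\<dots> = iter_pd ?S (replicate (length (snd_part bs)) (0, 1) @ [(b1,
        0)]) (iter_pd ?S (map (\<lambda>b. (b, 0)) (fst_part bs)) f) p"
      by (rule iter_pd_move_dy[OF K smooth_within_iter_pd[OF f y] 1(2) Cons.prems(1)])
    also have "\<dots> = iter_pd ?S (replicate (length (snd_part bs)) (0, 1) @ map (\<lambda>b. (b,
        0)) (fst_part (b # bs))) f p"
      using 1 by (simp add: iter_pd_append)
    finally show ?thesis using 1 eq by simp
  next
    case (2 b2)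
    then show ?thesis using eq by simp
  qed
qed simp

text \<open>Disposes of the regions where a cutoff makes an error vanish identically, so that
  product estimates are needed only elsewhere.\<close>

lemma iter_pd_eq_0:
  assumes S: "segment_set S" and U: "open U" and f: "\<And>x. x \<in> S \<inter> U \<Longrightarrow> f x = 0"
    and "x \<in> S \<inter> U" "set bs \<subseteq> Basis"
  shows "iter_pd S bs f x = 0"
  using assms(4,5)
proof (induction bs arbitrary: x)
  case (Cons b bs)
  obtain e where e: "e > 0" "ball x e \<subseteq> U" using U Cons.prems by (meson IntD2 open_contains_ball)
  have "(iter_pd S bs f has_derivative (\<lambda>_. 0)) (at x within S)"
    by (rule has_derivative_transform_within[where f="\<lambda>_. 0" and d=e])
      (use e Cons in \<open>auto simp: subset_iff dist_commute\<close>)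
  from frechet_derivative_segment_set[OF S _ this] Cons.prems show ?case by simp
qed (use f in auto)

section \<open>Schwartz functions and the Laplace kernel\<close>

lemma schwartz_iff:
  "f \<in> schwartz S \<longleftrightarrow> smooth_within S f \<and> (\<forall>m N. \<exists>C. \<forall>bs x. set bs \<subseteq> Basis \<longrightarrow> length bs \<le> m \<longrightarrow> x \<in> S \<longrightarrow>
      (1 + norm x) ^ N * norm (iter_pd S bs f x) \<le> C)"
proof -
  have "bdd_above (schwartz_values S m N f) \<longleftrightarrow> (\<exists>C. \<forall>bs x. set bs \<subseteq> Basis \<longrightarrow> length bs \<le> m \<longrightarrow> x \<in> S \<longrightarrow>
      (1 + norm x) ^ N * norm (iter_pd S bs f x) \<le> C)" for m N
    unfolding schwartz_values_def bdd_above_def by blast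
  then show ?thesis by (simp add: schwartz_def)
qed

lemma schwartzI:
  assumes "smooth_within S f"
    and "\<And>m N. \<exists>C. \<forall>bs x. set bs \<subseteq> Basis \<longrightarrow> length bs \<le> m \<longrightarrow> x \<in> S \<longrightarrow>
        (1 + norm x) ^ N * norm (iter_pd S bs f x) \<le> C"
  shows "f \<in> schwartz S"
  using assms by (simp add: schwartz_iff)

lemma schwartz_smooth: "f \<in> schwartz S \<Longrightarrow> smooth_within S f"
  by (simp add: schwartz_iff)

lemma schwartz_bound:
  assumes "f \<in> schwartz S"
  obtains C where "C \<ge> 0" "\<And>bs x. set bs \<subseteq> Basis \<Longrightarrow> length bs \<le> m \<Longrightarrow> x \<in> S \<Longrightarrow>
      (1 + norm x) ^ N * norm (iter_pd S bs f x) \<le> C"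
proof -
  obtain C where "\<forall>bs x. set bs \<subseteq> Basis \<longrightarrow> length bs \<le> m \<longrightarrow> x \<in> S \<longrightarrow>
      (1 + norm x) ^ N * norm (iter_pd S bs f x) \<le> C"
    using assms unfolding schwartz_iff by blast
  then show thesis by (intro that[of "max C 0"]) (auto simp: le_max_iff_disj)
qed

lemma schwartz_lincomb:
  fixes S :: "'a::euclidean_space set"
  assumes S: "segment_set S" and f: "f \<in> schwartz S" and g: "g \<in> schwartz S"
  shows "(\<lambda>x. c * f x + d * g x) \<in> schwartz S"
proof (rule schwartzI)
  note l = iter_pd_lincomb[OF S schwartz_smooth[OF f] schwartz_smooth[OF g]]
  show "smooth_within S (\<lambda>x. c * f x + d * g x)" by (rule l(1))
  fix m N
  obtain A where A: "A \<ge> 0" "\<And>bs x. set bs \<subseteq> Basis \<Longrightarrow> length bs \<le> m \<Longrightarrow> x \<in> S \<Longrightarrow>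
      (1 + norm x) ^ N * norm (iter_pd S bs f x) \<le> A"
    using schwartz_bound[OF f] by metis
  obtain B where B: "B \<ge> 0" "\<And>bs x. set bs \<subseteq> Basis \<Longrightarrow> length bs \<le> m \<Longrightarrow> x \<in> S \<Longrightarrow>
      (1 + norm x) ^ N * norm (iter_pd S bs g x) \<le> B"
    using schwartz_bound[OF g] by metis
  show "\<exists>C. \<forall>bs x. set bs \<subseteq> Basis \<longrightarrow> length bs \<le> m \<longrightarrow> x \<in> S \<longrightarrow>
      (1 + norm x) ^ N * norm (iter_pd S bs (\<lambda>x. c * f x + d * g x) x) \<le> C"
  proof (intro exI allI impI)
    fix bs :: "'a list" and x assume bs: "set bs \<subseteq> Basis" "length bs \<le> m" "x \<in> S"
    have "norm (iter_pd S bs (\<lambda>x. c * f x + d * g x) x) \<le>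
        norm c * norm (iter_pd S bs f x) + norm d * norm (iter_pd S bs g x)"
      unfolding l(2)[OF bs(1,3)] by (rule order_trans[OF norm_triangle_ineq]) (simp add: norm_mult)
    then have "(1 + norm x) ^ N * norm (iter_pd S bs (\<lambda>x. c * f x + d * g x) x) \<le>
        (1 + norm x) ^ N * (norm c * norm (iter_pd S bs f x) + norm d * norm (iter_pd S bs g x))"
      by (intro mult_left_mono) auto
    also have "\<dots> = norm c * ((1 + norm x) ^ N * norm (iter_pd S bs f x)) + norm d * ((1 + norm x) ^
        N * norm (iter_pd S bs g x))"
      by (simp add: algebra_simps)
    also have "\<dots> \<le> norm c * A + norm d * B"
      by (intro add_mono mult_left_mono A(2) B(2) bs) auto
    finally show "(1 + norm x) ^ N * norm (iter_pd S bs (\<lambda>x. c * f x + d * g x) x) \<le>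
        norm c * A + norm d * B" .
  qed
qed

lemma schwartz_zero:
  assumes "segment_set S" shows "(\<lambda>_. 0) \<in> schwartz S"
  using iter_pd_const[OF assms, where c=0] by (intro schwartzI) (auto intro!: exI[of _ 0])

lemma schwartz_cmult: "segment_set S \<Longrightarrow> f \<in> schwartz S \<Longrightarrow> (\<lambda>x. c * f x) \<in> schwartz S"
  using schwartz_lincomb[of S f "\<lambda>_. 0" c 0] schwartz_zero[of S] by simp

lemma schwartz_add: "segment_set S \<Longrightarrow> f \<in> schwartz S \<Longrightarrow> g \<in> schwartz S \<Longrightarrow> (\<lambda>x. f x + g x) \<in> schwartz S"
  using schwartz_lincomb[of S f g 1 1] by simp

lemma schwartz_diff: "segment_set S \<Longrightarrow> f \<in> schwartz S \<Longrightarrow> g \<in> schwartz S \<Longrightarrow> (\<lambda>x. f x - g x) \<in> schwartz S"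
  using schwartz_lincomb[of S f g 1 "-1"] by simp

lemma schwartz_sum:
  assumes "segment_set S" "finite I" "\<And>i. i \<in> I \<Longrightarrow> f i \<in> schwartz S"
  shows "(\<lambda>x. \<Sum>i\<in>I. f i x) \<in> schwartz S"
  using assms(2,3) by (induction rule: finite_induct) (auto intro: schwartz_zero schwartz_add assms(1))

lemma schwartz_iter_pd:
  assumes "f \<in> schwartz S" "set bs \<subseteq> Basis"
  shows "iter_pd S bs f \<in> schwartz S"
proof (rule schwartzI)
  show "smooth_within S (iter_pd S bs f)" by (rule smooth_within_iter_pd[OF schwartz_smooth[OF
      assms(1)] assms(2)])
  fix m N
  obtain C where "\<And>as x. set as \<subseteq> Basis \<Longrightarrow> length as \<le> m + length bs \<Longrightarrow> x \<in> S \<Longrightarrow>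
      (1 + norm x) ^ N * norm (iter_pd S as f x) \<le> C"
    using schwartz_bound[OF assms(1)] by metis
  from this[of "_ @ bs"] assms(2)
  show "\<exists>C. \<forall>as x. set as \<subseteq> Basis \<longrightarrow> length as \<le> m \<longrightarrow> x \<in> S \<longrightarrow>
      (1 + norm x) ^ N * norm (iter_pd S as (iter_pd S bs f) x) \<le> C"
    by (intro exI[of _ C]) (auto simp: iter_pd_append)
qed

lemma schwartz_slice:
  fixes f :: "'a::euclidean_space \<times> 'b::euclidean_space \<Rightarrow> complex"
  assumes S: "segment_set S" and f: "f \<in> schwartz (S \<times> T)" and y: "y \<in> T"
  shows "(\<lambda>x. f (x, y)) \<in> schwartz S"
proof (rule schwartzI)
  note sl = iter_pd_slice[OF S schwartz_smooth[OF f] y]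
  show "smooth_within S (\<lambda>x. f (x, y))" by (rule sl(1))
  fix m N
  obtain C where C: "\<And>bs x. set bs \<subseteq> Basis \<Longrightarrow> length bs \<le> m \<Longrightarrow> x \<in> S \<times> T \<Longrightarrow>
      (1 + norm x) ^ N * norm (iter_pd (S \<times> T) bs f x) \<le> C"
    using schwartz_bound[OF f] by metis
  show "\<exists>C. \<forall>bs x. set bs \<subseteq> Basis \<longrightarrow> length bs \<le> m \<longrightarrow> x \<in> S \<longrightarrow>
      (1 + norm x) ^ N * norm (iter_pd S bs (\<lambda>x. f (x, y)) x) \<le> C"
  proof (intro exI allI impI)
    fix bs :: "'a list" and x assume bs: "set bs \<subseteq> Basis" "length bs \<le> m" "x \<in> S"
    have "norm x \<le> norm (x, y)" using norm_fst_le[of x y] by simp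
    then have "(1 + norm x) ^ N * norm (iter_pd S bs (\<lambda>x. f (x, y)) x) \<le>
        (1 + norm (x, y)) ^ N * norm (iter_pd (S \<times> T) (map (\<lambda>b. (b, 0)) bs) f (x, y))"
      unfolding sl(2)[OF bs(1,3)] by (intro mult_right_mono power_mono) auto
    also have "\<dots> \<le> C" by (rule C) (use bs y in \<open>auto simp: Basis_prod_def\<close>)
    finally show "(1 + norm x) ^ N * norm (iter_pd S bs (\<lambda>x. f (x, y)) x) \<le> C" .
  qed
qed

lemma weight_Pair_le:
  fixes x :: "'a::euclidean_space" and y :: "'b::euclidean_space"
  shows "(1 + norm (x, y)) ^ N \<le> (1 + norm x) ^ N * (1 + norm y) ^ N"
proof -
  have "1 + norm (x, y) \<le> (1 + norm x) * (1 + norm y)"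
  proof -
    have "(1 + norm x) * (1 + norm y) = 1 + norm x + norm y + norm x * norm y"
      by (simp add: algebra_simps)
    moreover have "0 \<le> norm x * norm y" by simp
    ultimately show ?thesis using norm_Pair_le[of x y] by linarith
  qed
  then show ?thesis unfolding power_mult_distrib[symmetric] by (intro power_mono) auto
qed

lemma schwartz_tensor:
  fixes f :: "'a::euclidean_space \<Rightarrow> complex" and g :: "'b::euclidean_space \<Rightarrow> complex"
  assumes S: "segment_set S" and T: "segment_set T" and f: "f \<in> schwartz S" and g: "g \<in> schwartz T"
  shows "(\<lambda>(x, y). f x * g y) \<in> schwartz (S \<times> T)"
proof (rule schwartzI)
  note t = iter_pd_tensor[OF S T schwartz_smooth[OF f] schwartz_smooth[OF g]]
  show "smooth_within (S \<times> T) (\<lambda>(x, y). f x * g y)" by (rule t(1))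
  fix m N
  obtain A where A: "A \<ge> 0" "\<And>bs x. set bs \<subseteq> Basis \<Longrightarrow> length bs \<le> m \<Longrightarrow> x \<in> S \<Longrightarrow>
      (1 + norm x) ^ N * norm (iter_pd S bs f x) \<le> A"
    using schwartz_bound[OF f] by metis
  obtain B where B: "B \<ge> 0" "\<And>bs x. set bs \<subseteq> Basis \<Longrightarrow> length bs \<le> m \<Longrightarrow> x \<in> T \<Longrightarrow>
      (1 + norm x) ^ N * norm (iter_pd T bs g x) \<le> B"
    using schwartz_bound[OF g] by metis
  have "(1 + norm (x, y)) ^ N * norm (iter_pd (S \<times> T) bs (\<lambda>(x, y). f x * g y) (x, y)) \<le> A * B"
    if bs: "set bs \<subseteq> Basis" "length bs \<le> m" "x \<in> S" "y \<in> T" for bs x y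
  proof -
    note p = part_Basis[OF bs(1)]
    have "(1 + norm (x, y)) ^ N * norm (iter_pd (S \<times> T) bs (\<lambda>(x, y). f x * g y) (x, y)) \<le>
        ((1 + norm x) ^ N * (1 + norm y) ^ N) * norm (iter_pd (S \<times> T) bs (\<lambda>(x, y). f x * g y) (x, y))"
      by (intro mult_right_mono weight_Pair_le) auto
    also have "\<dots> = ((1 + norm x) ^ N * norm (iter_pd S (fst_part bs) f x)) * ((1 + norm y) ^ N *
        norm (iter_pd T (snd_part bs) g y))"
      unfolding t(2)[OF bs(1,3,4)] by (simp add: norm_mult)
    also have "\<dots> \<le> A * B"
      by (intro mult_mono A B) (use bs p in auto)
    finally show ?thesis .
  qed
  then show "\<exists>C. \<forall>bs x. set bs \<subseteq> Basis \<longrightarrow> length bs \<le> m \<longrightarrow> x \<in> S \<times> T \<longrightarrow>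
      (1 + norm x) ^ N * norm (iter_pd (S \<times> T) bs (\<lambda>(x, y). f x * g y) x) \<le> C"
    by (intro exI[of _ "A * B"]) auto
qed

text \<open>The multipliers of Schwartz space used below. Cutoffs in time do not decay in both
  directions, so they are not Schwartz functions, but bounds on all their derivatives are enough for
  products.\<close>

definition smooth_bounded :: "(real \<Rightarrow> complex) \<Rightarrow> bool" where
  "smooth_bounded a \<longleftrightarrow> smooth_within UNIV a \<and>
     (\<forall>m. \<exists>B. \<forall>bs t. set bs \<subseteq> Basis \<longrightarrow> length bs \<le> m \<longrightarrow> norm (iter_pd UNIV bs a t) \<le> B)"

lemma smooth_bounded_bound:
  assumes "smooth_bounded a"
  obtains B where "B \<ge> 0" "\<And>bs t. set bs \<subseteq> Basis \<Longrightarrow> length bs \<le> m \<Longrightarrow> norm (iter_pd UNIV bs a t) \<le> B"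
proof -
  obtain C where "\<forall>bs t. set bs \<subseteq> Basis \<longrightarrow> length bs \<le> m \<longrightarrow> norm (iter_pd UNIV bs a t) \<le> C"
    using assms unfolding smooth_bounded_def by blast
  then show thesis by (intro that[of "max C 0"]) (auto simp: le_max_iff_disj)
qed

lemma iter_pd_snd:
  fixes a :: "real \<Rightarrow> complex"
  assumes K: "segment_set K" and a: "smooth_within UNIV a"
  shows "smooth_within (K \<times> UNIV) (\<lambda>p. a (snd p))"
    and "\<And>bs y t. set bs \<subseteq> Basis \<Longrightarrow> y \<in> K \<Longrightarrow>
      norm (iter_pd (K \<times> UNIV) bs (\<lambda>p. a (snd p)) (y, t)) \<le> norm (iter_pd UNIV (snd_part bs) a t)"
proof -
  have eq: "(\<lambda>p. a (snd p)) = (\<lambda>(y, t). 1 * a t)" by auto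
  note t = iter_pd_tensor[OF K segment_set_UNIV iter_pd_const(1)[OF K, where c=1] a]
  show "smooth_within (K \<times> UNIV) (\<lambda>p. a (snd p))" unfolding eq by (rule t(1))
  fix bs :: "('a \<times> real) list" and y t assume bs: "set bs \<subseteq> Basis" and y: "y \<in> K"
  have "iter_pd K (fst_part bs) (\<lambda>_. 1) y = (if fst_part bs = [] then 1 else 0)"
    by (rule iter_pd_const(2)[OF K part_Basis(1)[OF bs] y])
  then show "norm (iter_pd (K \<times> UNIV) bs (\<lambda>p. a (snd p)) (y, t)) \<le> norm (iter_pd UNIV (snd_part bs) a t)"
    unfolding eq t(2)[OF bs y UNIV_I] by (simp add: norm_mult)
qed

lemma schwartz_mult_snd:
  fixes f :: "'a::euclidean_space \<times> real \<Rightarrow> complex"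
  assumes K: "segment_set K" and a: "smooth_bounded a" and f: "f \<in> schwartz (K \<times> UNIV)"
  shows "(\<lambda>p. a (snd p) * f p) \<in> schwartz (K \<times> UNIV)"
proof (rule schwartzI)
  let ?S = "K \<times> (UNIV :: real set)"
  have S: "segment_set ?S" by (rule segment_set_Times[OF K segment_set_UNIV])
  note s = iter_pd_snd[OF K, of a] a[unfolded smooth_bounded_def]
  then have sa: "smooth_within ?S (\<lambda>p. a (snd p))" by blast
  show "smooth_within ?S (\<lambda>p. a (snd p) * f p)"
    by (rule iter_pd_mult(1)[OF S sa schwartz_smooth[OF f]])
  fix m N
  obtain C where C: "C \<ge> 0" "\<And>bs x. set bs \<subseteq> Basis \<Longrightarrow> length bs \<le> m \<Longrightarrow> x \<in> ?S \<Longrightarrow>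
      (1 + norm x) ^ N * norm (iter_pd ?S bs f x) \<le> C"
    using schwartz_bound[OF f] by metis
  obtain B where B: "B \<ge> 0" "\<And>bs t. set bs \<subseteq> Basis \<Longrightarrow> length bs \<le> m \<Longrightarrow> norm (iter_pd UNIV bs a t) \<le> B"
    using smooth_bounded_bound[OF a] by metis
  show "\<exists>C. \<forall>bs x. set bs \<subseteq> Basis \<longrightarrow> length bs \<le> m \<longrightarrow> x \<in> ?S \<longrightarrow>
      (1 + norm x) ^ N * norm (iter_pd ?S bs (\<lambda>p. a (snd p) * f p) x) \<le> C"
  proof (intro exI allI impI)
    fix bs :: "('a \<times> real) list" and x assume bs: "set bs \<subseteq> Basis" "length bs \<le> m" "x \<in> ?S"
    obtain y t where x: "x = (y, t)" "y \<in> K" using bs(3) by auto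
    have W: "0 < (1 + norm x) ^ N" by (simp add: add_pos_nonneg)
    have "norm (iter_pd ?S bs (\<lambda>p. a (snd p) * f p) x) \<le> 2 ^ m * (B * (C / (1 + norm x) ^ N))"
    proof (rule norm_iter_pd_mult_le[OF S sa schwartz_smooth[OF f] bs])
      fix as assume as: "set as \<subseteq> (Basis :: ('a \<times> real) set)" "length as \<le> m"
      show "norm (iter_pd ?S as f x) \<le> C / (1 + norm x) ^ N"
        using C(2)[OF as bs(3)] W by (simp add: field_simps)
      have "norm (iter_pd ?S as (\<lambda>p. a (snd p)) (y, t)) \<le> norm (iter_pd UNIV (snd_part as) a t)"
        using s as x by blast
      also have "\<dots> \<le> B" by (rule B(2)) (use part_Basis[OF as(1)] as(2) in auto)
      finally show "norm (iter_pd ?S as (\<lambda>p. a (snd p)) x) \<le> B" using x by simp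
    qed
    then show "(1 + norm x) ^ N * norm (iter_pd ?S bs (\<lambda>p. a (snd p) * f p) x) \<le> 2 ^ m * (B * C)"
      using W by (simp add: field_simps)
  qed
qed

text \<open>A supremum of reals is meaningful only for a nonempty set that is bounded above: the
  first comes from S \<noteq> {}, the second from the bound C.\<close>

lemma schwartz_seminorm_le:
  assumes "S \<noteq> {}" and "\<And>bs x. set bs \<subseteq> Basis \<Longrightarrow> length bs \<le> m \<Longrightarrow> x \<in> S \<Longrightarrow>
      (1 + norm x) ^ N * norm (iter_pd S bs f x) \<le> C"
  shows "0 \<le> schwartz_seminorm S m N f" "schwartz_seminorm S m N f \<le> C"
proof -
  obtain x where x: "x \<in> S" using assms(1) by blast
  have mem: "(1 + norm x) ^ N * norm (iter_pd S [] f x) \<in> schwartz_values S m N f"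
    unfolding schwartz_values_def using x by (intro CollectI exI[of _ "[]"] exI[of _ x]) simp
  have le: "r \<le> C" if "r \<in> schwartz_values S m N f" for r
    using that assms(2) unfolding schwartz_values_def by blast
  show "schwartz_seminorm S m N f \<le> C"
    unfolding schwartz_seminorm_def using mem le by (intro cSup_least) auto
  have "(1 + norm x) ^ N * norm (iter_pd S [] f x) \<le> schwartz_seminorm S m N f"
    unfolding schwartz_seminorm_def using mem le by (intro cSup_upper bdd_aboveI) auto
  then show "0 \<le> schwartz_seminorm S m N f" by (rule order_trans[rotated]) simp
qed

text \<open>2 t + 2 carries [- 3/2, - 1/2] onto [- 1, 1]. The transition thus lies strictly to the
  left of the support t \<ge> 0 and strictly to the right of - 2, from where on the exponential sums
  approximate.\<close>

definition cutoff :: "nat \<Rightarrow> real \<Rightarrow> real" where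
  "cutoff n t = 2 ^ n * smooth_step n (2 * t + 2)"

lemma cutoff_deriv: "(cutoff n has_real_derivative cutoff (Suc n) t) (at t)"
proof -
  have "((\<lambda>t. smooth_step n (2 * t + 2)) has_real_derivative smooth_step (Suc n) (2 * t + 2) * 2) (at t)"
    by (rule DERIV_chain2[OF smooth_step_deriv]) (auto intro!: derivative_eq_intros)
  from DERIV_cmult[OF this, of "2 ^ n"] show ?thesis by (simp add: cutoff_def[abs_def] mult_ac)
qed

lemma cutoff_eq_0: "t \<le> - 3 / 2 \<Longrightarrow> cutoff n t = 0"
  by (cases n) (auto simp: cutoff_def smooth_step_0 smooth_step_Suc_eq_0)

lemma cutoff_eq_1: "- 1 / 2 \<le> t \<Longrightarrow> cutoff 0 t = 1"
  by (simp add: cutoff_def smooth_step_1)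

lemma cutoff_bounded: "\<exists>B. \<forall>t. \<bar>cutoff n t\<bar> \<le> B"
proof -
  obtain B where "\<forall>t. \<bar>smooth_step n t\<bar> \<le> B" using smooth_step_bounded by blast
  then have "\<bar>cutoff n t\<bar> \<le> 2 ^ n * B" for t by (simp add: cutoff_def abs_mult)
  then show ?thesis by blast
qed

lemma cutoff_bounded_upto:
  obtains B where "B \<ge> 0" "\<And>n t. n \<le> m \<Longrightarrow> \<bar>cutoff n t\<bar> \<le> B"
proof -
  obtain b where b: "\<And>n t. \<bar>cutoff n t\<bar> \<le> b n" using cutoff_bounded by metis
  have "0 \<le> b n" for n using b[of n 0] by simp
  moreover have "\<bar>cutoff n t\<bar> \<le> (\<Sum>i\<le>m. b i)" if "n \<le> m" for n t
    using b[of n t] member_le_sum[of n "{..m}" b] \<open>\<And>n. 0 \<le> b n\<close> that by fastforce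
  ultimately show thesis by (intro that[of "\<Sum>i\<le>m. b i"]) (auto intro: sum_nonneg)
qed

lemma iter_pd_cutoff:
  shows "smooth_within UNIV (\<lambda>t. complex_of_real (cutoff 0 (c * t + d)))"
    and "\<And>bs t. set bs \<subseteq> Basis \<Longrightarrow> iter_pd UNIV bs (\<lambda>t. complex_of_real (cutoff 0 (c * t + d))) t =
      of_real (c ^ length bs * cutoff (length bs) (c * t + d))"
proof -
  let ?F = "\<lambda>n t. complex_of_real (c ^ n * cutoff n (c * t + d))"
  have D: "(?F n has_vector_derivative ?F (Suc n) t) (at t)" for n t
  proof -
    have "((\<lambda>t. cutoff n (c * t + d)) has_real_derivative cutoff (Suc n) (c * t + d) * c) (at t)"
      by (rule DERIV_chain2[OF cutoff_deriv]) (auto intro!: derivative_eq_intros)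
    from DERIV_cmult[OF this, of "c ^ n"]
    show ?thesis by (intro has_vector_derivative_of_real) (simp add:
        has_real_derivative_iff_has_vector_derivative mult_ac)
  qed
  from iter_pd_real[of ?F, OF D]
  show "smooth_within UNIV (\<lambda>t. complex_of_real (cutoff 0 (c * t + d)))"
    and "\<And>bs t. set bs \<subseteq> Basis \<Longrightarrow> iter_pd UNIV bs (\<lambda>t. complex_of_real (cutoff 0 (c * t + d))) t =
      of_real (c ^ length bs * cutoff (length bs) (c * t + d))"
    by (simp_all)
qed

lemma power_times_exp_bounded:
  fixes c :: real
  assumes c: "c > 0"
  obtains B where "B \<ge> 0" "\<And>t. t \<ge> -2 \<Longrightarrow> (1 + \<bar>t\<bar>) ^ N * exp (- c * t) \<le> B"
proof (cases N)
  case 0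
  have "exp (- c * t) \<le> exp (2 * c)" if "t \<ge> -2" for t
    using that c mult_left_mono[of "-2" t c] by simp
  with 0 that[of "exp (2 * c)"] show thesis by simp
next
  case (Suc M)
  then have N: "real N > 0" by simp
  \<comment> \<open>Chosen so that 1 + |t| is at most k (1 + c |t| / N), hence at most k exp (c |t|
    / N). After taking the Nth power, |t| - t \<le> 4 for t \<ge> - 2 gives the constant exp (4
    c).\<close>
  define k where "k = 1 + N / c"
  have k: "k \<ge> 1" "k > 0" using N c by (auto simp: k_def add_pos_nonneg)
  have "(1 + \<bar>t\<bar>) ^ N * exp (- c * t) \<le> k ^ N * exp (4 * c)" if t: "t \<ge> -2" for t
  proof -
    let ?x = "c * \<bar>t\<bar> / N"
    have "1 + \<bar>t\<bar> \<le> k * (1 + ?x)" using N c by (simp add: k_def field_simps)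
    also have "\<dots> \<le> k * exp ?x" using k exp_ge_add_one_self[of ?x] by (intro mult_left_mono) auto
    finally have "(1 + \<bar>t\<bar>) ^ N \<le> (k * exp ?x) ^ N" by (intro power_mono) auto
    also have "\<dots> = k ^ N * exp (c * \<bar>t\<bar>)"
      using N by (simp add: power_mult_distrib exp_of_nat_mult[symmetric])
    finally have "(1 + \<bar>t\<bar>) ^ N * exp (- c * t) \<le> k ^ N * exp (c * \<bar>t\<bar>) * exp (- c * t)"
      by (intro mult_right_mono) auto
    also have "\<dots> = k ^ N * exp (c * (\<bar>t\<bar> - t))" by (simp add: exp_add[symmetric] algebra_simps)
    also have "\<dots> \<le> k ^ N * exp (4 * c)"
      using t k c mult_left_mono[of "\<bar>t\<bar> - t" 4 c] by (intro mult_left_mono) auto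
    finally show ?thesis .
  qed
  with k show thesis by (intro that[of "k ^ N * exp (4 * c)"]) auto
qed

lemma iter_pd_exp:
  fixes z :: complex
  shows "smooth_within UNIV (\<lambda>t::real. exp (z * of_real t))"
    and "\<And>bs t. set bs \<subseteq> Basis \<Longrightarrow> iter_pd UNIV bs (\<lambda>t::real. exp (z * of_real t)) t =
        z ^ length bs * exp (z * of_real t)"
proof -
  let ?F = "\<lambda>n t::real. z ^ n * exp (z * of_real t)"
  have D: "(?F n has_vector_derivative ?F (Suc n) t) (at t)" for n t
    by (rule has_vector_derivative_real_field) (auto intro!: derivative_eq_intros simp: mult_ac)
  from iter_pd_real[of ?F, OF D]
  show "smooth_within UNIV (\<lambda>t::real. exp (z * of_real t))"
    and "\<And>bs t. set bs \<subseteq> Basis \<Longrightarrow> iter_pd UNIV bs (\<lambda>t::real. exp (z * of_real t)) t =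
        z ^ length bs * exp (z * of_real t)"
    by simp_all
qed

lemma schwartz_cutoff_exp:
  assumes z: "Re z < 0"
  shows "(\<lambda>t::real. of_real (cutoff 0 t) * exp (z * of_real t)) \<in> schwartz UNIV"
proof (rule schwartzI)
  note sm = iter_pd_cutoff[where c=1 and d=0,
      unfolded mult_1_left add_0_right power_one] iter_pd_exp[where z=z]
  show "smooth_within UNIV (\<lambda>t::real. of_real (cutoff 0 t) * exp (z * of_real t))"
    by (rule iter_pd_mult(1)[OF segment_set_UNIV sm(1,3)])
  fix m N
  obtain B where B: "B \<ge> 0" "\<And>t. t \<ge> -2 \<Longrightarrow> (1 + \<bar>t\<bar>) ^ N * exp (- (- Re z) * t) \<le> B"
    using power_times_exp_bounded[of "- Re z" N] z by auto
  obtain C where C: "C \<ge> 0" "\<And>n t. n \<le> m \<Longrightarrow> \<bar>cutoff n t\<bar> \<le> C"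
    using cutoff_bounded_upto by metis
  define Z where "Z = max 1 (norm z) ^ m"
  have Z: "norm z ^ n \<le> Z" if "n \<le> m" for n
  proof -
    have "norm z ^ n \<le> max 1 (norm z) ^ n" by (intro power_mono) auto
    also have "\<dots> \<le> Z" unfolding Z_def using that by (intro power_increasing) auto
    finally show ?thesis .
  qed
  have Z0: "Z \<ge> 0" by (simp add: Z_def)
  show "\<exists>C. \<forall>bs t. set bs \<subseteq> Basis \<longrightarrow> length bs \<le> m \<longrightarrow> t \<in> UNIV \<longrightarrow>
      (1 + norm t) ^ N * norm (iter_pd UNIV bs (\<lambda>t::real. of_real (cutoff 0 t) * exp (z * of_real
          t)) t) \<le> C"
  proof (intro exI allI impI)
    fix bs :: "real list" and t :: real assume bs: "set bs \<subseteq> Basis" "length bs \<le> m"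
    show "(1 + norm t) ^ N * norm (iter_pd UNIV bs (\<lambda>t. of_real (cutoff 0 t) * exp (z * of_real t))
        t) \<le> 2 ^ m * (C * (Z * B))"
    proof (cases "t < - 3 / 2")
      case True
      have "iter_pd UNIV bs (\<lambda>t. of_real (cutoff 0 t) * exp (z * of_real t)) t = 0"
        by (rule iter_pd_eq_0[OF segment_set_UNIV,
            of "{..<- 3 / 2}"]) (use True bs in \<open>auto simp: cutoff_eq_0\<close>)
      then show ?thesis using C B Z0 by simp
    next
      case False
      have "norm (iter_pd UNIV bs (\<lambda>t. of_real (cutoff 0 t) * exp (z * of_real t)) t) \<le>
          2 ^ m * (C * (Z * exp (Re z * t)))"
      proof (rule norm_iter_pd_mult_le[OF segment_set_UNIV sm(1,3) bs UNIV_I])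
        fix as :: "real list" assume as: "set as \<subseteq> Basis" "length as \<le> m"
        show "norm (iter_pd UNIV as (\<lambda>t. complex_of_real (cutoff 0 t)) t) \<le> C"
          using C(2)[OF as(2)] sm(2)[OF as(1)] by simp
        show "norm (iter_pd UNIV as (\<lambda>t. exp (z * complex_of_real t)) t) \<le> Z * exp (Re z * t)"
          using Z[OF as(2)] sm(4)[OF as(1)] by (simp add: norm_mult norm_power)
      qed
      then have "(1 + norm t) ^ N * norm (iter_pd UNIV bs (\<lambda>t. of_real (cutoff 0 t) * exp (z *
          of_real t)) t) \<le>
          (1 + norm t) ^ N * (2 ^ m * (C * (Z * exp (Re z * t))))"
        by (intro mult_left_mono) auto
      also have "\<dots> = 2 ^ m * (C * (Z * ((1 + \<bar>t\<bar>) ^ N * exp (- (- Re z) * t))))" by simp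
      also have "\<dots> \<le> 2 ^ m * (C * (Z * B))"
        using False C(1) Z0 by (intro mult_left_mono B(2)) auto
      finally show ?thesis .
    qed
  qed
qed

text \<open>The choice in \<open>FL_kernel_def\<close> has a witness, the cutoff times the
  exponential. Later arguments know the kernel only through these two properties.\<close>

lemma FL_kernel:
  assumes "\<omega> \<in> upper_half"
  shows "FL_kernel \<omega> \<in> schwartz UNIV" "\<exists>\<delta>>0. \<forall>t\<ge>-\<delta>. FL_kernel \<omega> t = exp (\<i> * \<omega> * of_real t)"
proof -
  have "(\<lambda>t. of_real (cutoff 0 t) * exp (\<i> * \<omega> * of_real t)) \<in> schwartz UNIV"
    by (rule schwartz_cutoff_exp) (use assms in \<open>simp add: upper_half_def\<close>)
  moreover have "\<exists>\<delta>>0. \<forall>t\<ge>-\<delta>. of_real (cutoff 0 t) * exp (\<i> * \<omega> * of_real t) = exp (\<i> * \<omega> * of_real t)"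
    by (intro exI[of _ "1/2"]) (auto simp: cutoff_eq_1)
  ultimately have "\<exists>e. e \<in> schwartz UNIV \<and> (\<exists>\<delta>>0. \<forall>t\<ge>-\<delta>. e t = exp (\<i> * \<omega> * of_real t))" by blast
  from someI_ex[OF this]
  show "FL_kernel \<omega> \<in> schwartz UNIV" "\<exists>\<delta>>0. \<forall>t\<ge>-\<delta>. FL_kernel \<omega> t = exp (\<i> * \<omega> * of_real t)"
    unfolding FL_kernel_def by blast+
qed

section \<open>Density of exponential sums in time\<close>

lemma sum_Bernstein_variance:
  assumes "n > 0"
  shows "(\<Sum>k\<le>n. (x - k / n)\<^sup>2 * Bernstein n k x) = x * (1 - x) / n"
proof -
  have "(\<Sum>k\<le>n. (x - k / n)\<^sup>2 * Bernstein n k x) =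
      (\<Sum>k\<le>n. x\<^sup>2 * Bernstein n k x + (1 / n\<^sup>2 - 2 * x / n) * (real k * Bernstein n k x)
        + 1 / n\<^sup>2 * (real k * (real k - 1) * Bernstein n k x))"
    by (rule sum.cong) (use assms in \<open>simp_all add: field_simps power2_eq_square\<close>)
  also have "\<dots> = x\<^sup>2 + (1 / n\<^sup>2 - 2 * x / n) * (n * x) + 1 / n\<^sup>2 * (real n * (real n - 1) * x\<^sup>2)"
    by (simp only: sum.distrib sum_distrib_left[symmetric] sum_Bernstein sum_k_Bernstein
        sum_kk_Bernstein mult_1_right)
  also have "\<dots> = x * (1 - x) / n"
    using assms by (simp add: field_simps power2_eq_square)
  finally show ?thesis .
qed

text \<open>The Bernstein weights have mean x and variance x (1 - x) / n, as in Chebyshev's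
  inequality. The explicit rate matters: it depends on the function only through L, so one n serves
  all parameters y and all derivatives in y.\<close>

lemma Bernstein_lipschitz_approx:
  fixes G :: "real \<Rightarrow> complex"
  assumes lip: "\<And>x y. x \<in> {0..1} \<Longrightarrow> y \<in> {0..1} \<Longrightarrow> norm (G x - G y) \<le> L * \<bar>x - y\<bar>"
    and n: "n > 0" and x: "x \<in> {0..1}"
  shows "norm (G x - (\<Sum>k\<le>n. G (k / n) * of_real (Bernstein n k x))) \<le> L / sqrt n"
proof -
  have L: "L \<ge> 0" using lip[of 0 1] order_trans[OF norm_ge_zero] by fastforce
  have B: "0 \<le> Bernstein n k x" for k using x by (auto intro: Bernstein_nonneg)
  define r where "r = sqrt (real n)"
  have r: "r > 0" "r\<^sup>2 = n" using n by (auto simp: r_def)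
  \<comment> \<open>Bounds the mean of |x - k/n| by its mean square; with r = sqrt n both terms
    become of order 1 / sqrt n.\<close>
  have amgm: "\<bar>z\<bar> \<le> 1 / (2 * r) + r / 2 * z\<^sup>2" for z
  proof -
    have "0 \<le> (r * \<bar>z\<bar> - 1)\<^sup>2" by simp
    then have "2 * r * \<bar>z\<bar> \<le> 1 + r\<^sup>2 * z\<^sup>2" by (simp add: power2_eq_square algebra_simps)
    with r(1) show ?thesis by (simp add: field_simps power2_eq_square)
  qed
  have "G x - (\<Sum>k\<le>n. G (k / n) * of_real (Bernstein n k x)) =
      (\<Sum>k\<le>n. (G x - G (k / n)) * of_real (Bernstein n k x))"
    by (simp add: left_diff_distrib sum_subtractf sum_distrib_left[symmetric]
        of_real_sum[symmetric] del: of_real_sum)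
  also have "norm \<dots> \<le> (\<Sum>k\<le>n. norm ((G x - G (k / n)) * of_real (Bernstein n k x)))"
    by (rule norm_sum)
  also have "\<dots> \<le> (\<Sum>k\<le>n. L * (1 / (2 * r) * Bernstein n k x + r / 2 * ((x - k / n)\<^sup>2 * Bernstein n k x)))"
  proof (rule sum_mono)
    fix k assume k: "k \<in> {..n}"
    have "norm (G x - G (k / n)) \<le> L * \<bar>x - k / n\<bar>" using x k n by (intro lip) auto
    also have "\<dots> \<le> L * (1 / (2 * r) + r / 2 * (x - k / n)\<^sup>2)" by (intro mult_left_mono amgm L)
    finally have "norm (G x - G (k / n)) * Bernstein n k x \<le>
        L * (1 / (2 * r) + r / 2 * (x - k / n)\<^sup>2) * Bernstein n k x"
      by (intro mult_right_mono B)
    also have "norm (G x - G (k / n)) * Bernstein n k x =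
        norm ((G x - G (k / n)) * of_real (Bernstein n k x))"
      using B[of k] by (simp only: norm_mult norm_of_real abs_of_nonneg)
    finally show "norm ((G x - G (k / n)) * of_real (Bernstein n k x)) \<le>
        L * (1 / (2 * r) * Bernstein n k x + r / 2 * ((x - k / n)\<^sup>2 * Bernstein n k x))"
      by (simp add: algebra_simps)
  qed
  also have "\<dots> = L * (1 / (2 * r) + r / 2 * (x * (1 - x) / n))"
    by (simp only: sum.distrib sum_distrib_left[symmetric] sum_Bernstein sum_Bernstein_variance[OF
        n]) simp
  also have "\<dots> \<le> L * (1 / r)"
  proof (intro mult_left_mono L)
    have "x * (1 - x) \<le> 1" using x by (auto intro: mult_le_one)
    then have "r / 2 * (x * (1 - x) / n) \<le> r / 2 * (1 / n)"
      using r by (intro mult_left_mono divide_right_mono) auto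
    also have "\<dots> = 1 / (2 * r)" using r n by (simp add: field_simps power2_eq_square)
    finally have "r / 2 * (x * (1 - x) / n) \<le> 1 / (2 * r)" .
    moreover have "1 / (2 * r) + 1 / (2 * r) = 1 / r" by (simp add: field_simps)
    ultimately show "1 / (2 * r) + r / 2 * (x * (1 - x) / n) \<le> 1 / r" by linarith
  qed
  finally show ?thesis by (simp add: r_def)
qed

text \<open>The factor x removes the constant term. Under x = exp (- t - 2) the power x^j is a
  multiple of exp (- j t), and only j \<ge> 1 belongs to a frequency \<open>\<i> * j\<close> in the
  upper half-plane.\<close>

lemma Bernstein_times_id_expansion:
  assumes "k \<le> n"
  obtains r where "\<And>x. x * Bernstein n k x = (\<Sum>j\<in>{1..Suc n}. r j * x ^ j)"
proof -
  define p where "p = smult (real (n choose k)) (monom 1 (Suc k) * [:1, -1:] ^ (n - k))"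
  have p: "poly p x = x * Bernstein n k x" for x
    by (simp add: p_def Bernstein_def poly_monom poly_power algebra_simps)
  have "degree p \<le> degree (monom (1::real) (Suc k) * [:1, -1:] ^ (n - k))"
    unfolding p_def by (rule degree_smult_le)
  also have "\<dots> \<le> degree (monom (1::real) (Suc k)) + degree ([:1, -1::real:] ^ (n - k))"
    by (rule degree_mult_le)
  also have "\<dots> \<le> Suc k + 1 * (n - k)"
    using degree_power_le[of "[:1, -1::real:]" "n - k"] degree_monom_le[of "1::real" "Suc k"] by
        (intro add_mono) auto
  finally have deg: "degree p \<le> Suc n" using assms by simp
  have "coeff p 0 = poly p 0" by (simp add: poly_0_coeff_0)
  then have c0: "coeff p 0 = 0" by (simp add: p)
  have "x * Bernstein n k x = (\<Sum>j\<in>{1..Suc n}. coeff p j * x ^ j)" for x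
  proof -
    have "poly p x = (\<Sum>j\<le>Suc n. coeff p j * x ^ j)"
      unfolding poly_altdef by (rule sum.mono_neutral_left) (use deg in \<open>auto simp: coeff_eq_0\<close>)
    also have "\<dots> = (\<Sum>j\<in>{1..Suc n}. coeff p j * x ^ j)"
      by (rule sum.mono_neutral_right) (auto simp: c0 not_less_eq_eq)
    finally show ?thesis by (simp add: p)
  qed
  then show thesis by (rule that)
qed

text \<open>Since exp (- s) integrates to exp (- t) over [t, \<infinity>), integrating from infinity
  reproduces the bound with the same c, however many times it is repeated.\<close>

lemma vanishing_at_infinity_derivative_bound:
  fixes e :: "nat \<Rightarrow> real \<Rightarrow> complex"
  assumes d: "\<And>i t. (e i has_vector_derivative e (Suc i) t) (at t)"
    and lim: "\<And>i. (e i \<longlongrightarrow> 0) at_top"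
    and m: "\<And>t. t \<ge> a \<Longrightarrow> norm (e m t) \<le> c * exp (- t)"
    and "i \<le> m" "t \<ge> a"
  shows "norm (e i t) \<le> c * exp (- t)"
  using assms(4,5)
proof (induction i arbitrary: t rule: inc_induct)
  case base
  then show ?case by (rule m)
next
  case (step i)
  have c: "c \<ge> 0"
    using order_trans[OF norm_ge_zero m[of a]] by (simp add: zero_le_mult_iff)
  have "norm (e i T - e i t) \<le> c * exp (- t)" if T: "T > t" for T
  proof -
    have "norm (e i T - e i t) \<le> - c * exp (- T) - (- c * exp (- t))"
    proof (rule differentiable_bound_general[OF T])
      show "continuous_on {t..T} (e i)"
        using d by (intro continuous_at_imp_continuous_on) (auto intro: has_vector_derivative_continuous)
      show "continuous_on {t..T} (\<lambda>t. - c * exp (- t))" by (intro continuous_intros)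
      show "(e i has_vector_derivative e (Suc i) s) (at s)" for s by (rule d)
      show "((\<lambda>t. - c * exp (- t)) has_vector_derivative c * exp (- s)) (at s)" for s
        by (auto intro!: derivative_eq_intros simp:
            has_real_derivative_iff_has_vector_derivative[symmetric])
      show "norm (e (Suc i) s) \<le> c * exp (- s)" if "t < s" for s
        using step.IH[of s] step.prems that by simp
    qed
    also have "\<dots> \<le> c * exp (- t)" using c by simp
    finally show ?thesis .
  qed
  then have "\<forall>\<^sub>F T in at_top. norm (e i T - e i t) \<le> c * exp (- t)"
    by (intro eventually_mono[OF eventually_gt_at_top[of t]])
  moreover have "((\<lambda>T. norm (e i T - e i t)) \<longlongrightarrow> norm (0 - e i t)) at_top"
    by (intro tendsto_intros lim)
  ultimately have "norm (0 - e i t) \<le> c * exp (- t)"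
    using tendsto_upperbound trivial_limit_at_top_linorder by blast
  then show ?case by simp
qed

text \<open>x = exp (- 2 - t) maps t \<ge> - 2 onto (0, 1]. As H vanishes for t \<ge> R, G vanishes
  for x up to x0 = exp (- 2 - R), and the division by x is harmless: G' = - (H' + H) / x^2 is at
  most 2 C / x0^2, the constant of the statement.\<close>

lemma lipschitz_in_exp_variable:
  fixes H H' :: "real \<Rightarrow> complex"
  assumes d: "\<And>t. (H has_vector_derivative H' t) (at t)"
    and b: "\<And>t. norm (H t) \<le> C" "\<And>t. norm (H' t) \<le> C"
    and z: "\<And>t. t \<ge> R \<Longrightarrow> H t = 0" "\<And>t. t \<ge> R \<Longrightarrow> H' t = 0"
    and x: "x \<in> {0..1}" and y: "y \<in> {0..1}"
  defines "G \<equiv> \<lambda>x. if x \<le> 0 then 0 else H (- 2 - ln x) / of_real x"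
  shows "norm (G x - G y) \<le> 2 * C * exp (2 * (R + 2)) * \<bar>x - y\<bar>"
proof -
  define L where "L = 2 * C * exp (2 * (R + 2))"
  have C: "C \<ge> 0" using order_trans[OF norm_ge_zero b(1)] .
  have L: "L \<ge> 0" using C by (simp add: L_def)
  define x0 where "x0 = exp (- 2 - R)"
  have x0: "x0 > 0" "1 / x0\<^sup>2 = exp (2 * (R + 2))"
    by (auto simp: x0_def exp_minus[symmetric] exp_of_nat_mult[symmetric] divide_inverse)
  have t: "- 2 - ln x \<ge> R" if "0 < x" "x \<le> x0" for x
  proof -
    have "ln x \<le> ln x0" using that by simp
    then show ?thesis by (simp add: x0_def)
  qed
  have G0: "G x = 0" if "x \<le> x0" for x using t[of x] z that by (auto simp: G_def)
  define G' where "G' x = - (H' (- 2 - ln x) + H (- 2 - ln x)) / of_real (x\<^sup>2)" for x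
  have dG: "(G has_vector_derivative G' x) (at x)" if "x > 0" for x
  proof -
    have 1: "((\<lambda>x. H (- 2 - ln x)) has_vector_derivative (- 1 / x) *\<^sub>R H' (- 2 - ln x)) (at x)"
    proof -
      have "((\<lambda>x. - 2 - ln x) has_vector_derivative - 1 / x) (at x)"
        using that by (auto simp: has_real_derivative_iff_has_vector_derivative[symmetric] intro!:
            derivative_eq_intros)
      from vector_diff_chain_at[OF this d] show ?thesis by (simp add: o_def)
    qed
    have 2: "((\<lambda>x. of_real (1 / x)) has_vector_derivative complex_of_real (- 1 / x\<^sup>2)) (at x)"
      using that by (intro has_vector_derivative_of_real)
        (auto simp: has_real_derivative_iff_has_vector_derivative[symmetric] power2_eq_square
            intro!: derivative_eq_intros)
    have "((\<lambda>x. H (- 2 - ln x) * of_real (1 / x)) has_vector_derivative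
        (H (- 2 - ln x) * complex_of_real (- 1 / x\<^sup>2) + ((- 1 / x) *\<^sub>R H' (- 2 - ln x)) * of_real
            (1 / x))) (at x)"
      by (rule has_vector_derivative_mult[OF 1 2])
    moreover have "(H (- 2 - ln x) * complex_of_real (- 1 / x\<^sup>2) + ((- 1 / x) *\<^sub>R H' (- 2 - ln x))
        * of_real (1 / x)) = G' x"
      using that by (simp add: G'_def field_simps power2_eq_square scaleR_conv_of_real)
    ultimately have "((\<lambda>x. H (- 2 - ln x) * of_real (1 / x)) has_vector_derivative G' x) (at x)" by simp
    then show ?thesis
      by (rule has_vector_derivative_transform_within_open[of _ _ _ "{0<..}"])
        (use that in \<open>auto simp: G_def divide_inverse\<close>)
  qed
  have G'b: "norm (G' x) \<le> L" if "x > 0" for x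
  proof (cases "x \<le> x0")
    case True
    then show ?thesis using t[of x] z that L by (simp add: G'_def)
  next
    case False
    then have "1 / x\<^sup>2 \<le> 1 / x0\<^sup>2" using x0 by (intro divide_left_mono power_mono) auto
    moreover have "norm (H' (- 2 - ln x) + H (- 2 - ln x)) \<le> C + C"
      by (intro order_trans[OF norm_triangle_ineq] add_mono b)
    ultimately have "norm (H' (- 2 - ln x) + H (- 2 - ln x)) * (1 / x\<^sup>2) \<le> (C + C) * (1 / x0\<^sup>2)"
      using C by (intro mult_mono) auto
    moreover have "norm (G' x) = norm (H' (- 2 - ln x) + H (- 2 - ln x)) * (1 / x\<^sup>2)"
      by (simp add: G'_def norm_divide norm_mult norm_minus_commute divide_inverse norm_power
          norm_inverse
          del: minus_add_distrib)
    ultimately show ?thesis using x0 by (simp add: L_def)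
  qed
  have pos: "norm (G y - G x) \<le> L * \<bar>y - x\<bar>" if xy: "0 < x" "x \<le> y" for x y
  proof (cases "x = y")
    case False
    then have "x < y" using xy by simp
    have "\<exists>z\<in>{x<..<y}. norm (G y - G x) \<le> norm ((y - x) *\<^sub>R G' z)"
    proof (rule mvt_general[OF \<open>x < y\<close>])
      show "continuous_on {x..y} G"
        using has_vector_derivative_continuous[OF dG] xy by (intro continuous_at_imp_continuous_on) auto
      show "(G has_derivative (\<lambda>h. h *\<^sub>R G' z)) (at z)" if "x < z" for z
        using dG[of z] that xy by (simp add: has_vector_derivative_def)
    qed
    then obtain z where z: "x < z" "norm (G y - G x) \<le> norm ((y - x) *\<^sub>R G' z)" by auto
    note z(2)
    also have "norm ((y - x) *\<^sub>R G' z) = \<bar>y - x\<bar> * norm (G' z)" by simp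
    also have "\<dots> \<le> \<bar>y - x\<bar> * L" using z xy by (intro mult_left_mono G'b) auto
    finally show ?thesis by (simp add: mult.commute)
  qed simp
  \<comment> \<open>The mean value argument needs a positive left end; from x = 0 it starts at x0,
    where G is still 0.\<close>
  have ord: "norm (G y - G x) \<le> L * \<bar>y - x\<bar>" if xy: "0 \<le> x" "x \<le> y" for x y
  proof (cases "x = 0")
    case True
    show ?thesis
    proof (cases "y \<le> x0")
      case True
      then show ?thesis using G0[of x] G0[of y] xy L by simp
    next
      case False
      then have "norm (G y - G x0) \<le> L * \<bar>y - x0\<bar>" using x0 by (intro pos) auto
      also have "\<dots> \<le> L * \<bar>y - x\<bar>" using True False x0 L by (intro mult_left_mono) auto
      finally show ?thesis using G0[of x] G0[of x0] True x0 by simp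
    qed
  next
    case False
    then show ?thesis using pos xy by simp
  qed
  show ?thesis
    using ord[of x y] ord[of y x] x y unfolding L_def[symmetric]
    by (cases "x \<le> y") (auto simp: norm_minus_commute abs_minus_commute)
qed

lemma map_dy_Basis: "set bs \<subseteq> Basis \<Longrightarrow> set (map (\<lambda>b. (b, 0 :: 'b::euclidean_space)) bs) \<subseteq> Basis"
  by (auto simp: Basis_prod_def)

lemma replicate_dt_Basis: "set (replicate n (0 :: 'a::euclidean_space, 1 :: real)) \<subseteq> Basis"
  by (auto simp: Basis_prod_def)

lemma parts_replicate_dt:
  "fst_part (map (\<lambda>b. (b, 0 :: real)) ys @ replicate n (0, 1)) = ys"
  "length (snd_part (map (\<lambda>b. (b, 0 :: real)) ys @ replicate n (0, 1))) = n"
  by (auto simp: fst_part_def snd_part_def o_def)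

text \<open>The Bernstein rate concerns values, not derivatives, so it is spent on the highest
  derivative in t. That derivative is divided by x before the approximation and multiplied by x
  afterwards: this leaves a factor exp (- t) in the error, which pays for the weight in t and makes
  the error integrable up to infinity. The weight in y sits in the Lipschitz constant.\<close>

lemma exp_sum_approx:
  fixes F :: "'a::euclidean_space \<times> real \<Rightarrow> complex"
  assumes K: "segment_set K" and F: "F \<in> schwartz (K \<times> UNIV)"
    and F0: "\<And>y t. y \<in> K \<Longrightarrow> t \<ge> R \<Longrightarrow> F (y, t) = 0" and \<eta>: "\<eta> > 0"
  shows "\<exists>J c. (\<forall>j\<in>{1..J}. c j \<in> schwartz K) \<and>
    (\<forall>bs y t. set bs \<subseteq> Basis \<longrightarrow> length bs \<le> m \<longrightarrow> y \<in> K \<longrightarrow> t \<ge> -2 \<longrightarrow>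
      (1 + norm (y, t)) ^ N * norm (iter_pd (K \<times> UNIV) bs F (y, t) -
        (\<Sum>j\<in>{1..J}. iter_pd K (fst_part bs) (c j) y * of_real ((- real j) ^ length (snd_part bs) *
            exp (- real j * t)))) \<le> \<eta>)"
proof -
  let ?S = "K \<times> (UNIV :: real set)"
  let ?dy = "map (\<lambda>b. (b, 0 :: real))" and ?dt = "\<lambda>n. replicate n (0 :: 'a, 1 :: real)"
  have S: "segment_set ?S" by (rule segment_set_Times[OF K segment_set_UNIV])
  have tv: "(0 :: 'a, 1 :: real) \<in> Basis" by (auto simp: Basis_prod_def)
  have DT: "set (?dt n) \<subseteq> Basis" for n by (rule replicate_dt_Basis)
  note sm = schwartz_smooth[OF F]
  \<comment> \<open>F vanishes on the open set t > R, hence so do its derivatives; t \<ge> R + 1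
    lies inside it.\<close>
  define R' where "R' = R + 1"
  have van: "iter_pd ?S bs F (y, t) = 0" if "set bs \<subseteq> Basis" "y \<in> K" "t \<ge> R'" for bs y t
    by (rule iter_pd_eq_0[OF S, of "UNIV \<times> {R<..}"])
      (use that F0 in \<open>auto simp: R'_def intro!: open_Times\<close>)
  define H where "H ys y t = iter_pd ?S (?dy ys @ ?dt m) F (y, t)" for ys y t
  define H' where "H' ys y t = iter_pd ?S ((0, 1) # ?dy ys @ ?dt m) F (y, t)" for ys y t
  \<comment> \<open>At most m derivatives in y, m in t, and one more in t for the Lipschitz
    constant.\<close>
  obtain C where C: "C \<ge> 0" "\<And>bs x. set bs \<subseteq> Basis \<Longrightarrow> length bs \<le> 2 * m + 1 \<Longrightarrow> x \<in> ?S \<Longrightarrow>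
      (1 + norm x) ^ N * norm (iter_pd ?S bs F x) \<le> C"
    using schwartz_bound[OF F] by metis
  obtain B where B: "B \<ge> 0" "\<And>t::real. t \<ge> -2 \<Longrightarrow> (1 + \<bar>t\<bar>) ^ N * exp (- 1 * t) \<le> B"
    using power_times_exp_bounded[OF zero_less_one, of N] by metis
  define L where "L = 2 * C * exp (2 * (R' + 2))"
  have L: "L \<ge> 0" using C by (simp add: L_def)
  \<comment> \<open>The factors of the final error: exp (- 2) from x = exp (- 2) exp (- t), L / sqrt
    n from the Bernstein rate, and B for the weight in t against exp (- t).\<close>
  obtain n :: nat where n: "n > 0" "exp (-2) * L * B / sqrt n \<le> \<eta>"
  proof -
    obtain n :: nat where n: "real n > (exp (-2) * L * B / \<eta>)\<^sup>2" using reals_Archimedean2 by blast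
    moreover have "0 \<le> (exp (-2) * L * B / \<eta>)\<^sup>2" by simp
    ultimately have "real n > 0" by (rule le_less_trans[rotated])
    then have "n > 0" by simp
    have "exp (-2) * L * B / \<eta> \<le> sqrt n" using n by (intro real_le_rsqrt) auto
    then have "exp (-2) * L * B / sqrt n \<le> \<eta>" using \<eta> \<open>n > 0\<close> by (simp add: field_simps)
    with \<open>n > 0\<close> show thesis by (rule that)
  qed
  define r where "r k = (SOME r. \<forall>x. x * Bernstein n k x = (\<Sum>j\<in>{1..Suc n}. r j * x ^ j))" for k
  have r: "x * Bernstein n k x = (\<Sum>j\<in>{1..Suc n}. r k j * x ^ j)" if "k \<le> n" for k x
  proof -
    have "\<exists>r. \<forall>x. x * Bernstein n k x = (\<Sum>j\<in>{1..Suc n}. r j * x ^ j)"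
      by (rule Bernstein_times_id_expansion[OF that]) blast
    from someI_ex[OF this] show ?thesis unfolding r_def by blast
  qed
  \<comment> \<open>The time that x = exp (- t - 2) sends to the node k / n.\<close>
  define \<tau> where "\<tau> k = - 2 - ln (real k / n)" for k :: nat
  \<comment> \<open>n / k is the division by x at the node k / n, and exp (- 2 j) turns exp (- j t)
    into x^j.\<close>
  define a where "a k j = n / k * r k j * exp (- 2 * real j)" for k j :: nat
  \<comment> \<open>The power of - 1 / j undoes m differentiations of exp (- j t). The node k = 0 is
    absent because G is 0 there. Each summand is a time slice of a derivative of F, so the
    coefficient is a Schwartz function of y.\<close>
  define c where "c j y = (\<Sum>k\<in>{1..n}. of_real ((- 1 / real j) ^ m * a k j) * iter_pd ?S (?dt m) F
      (y, \<tau> k))" for j y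
  have slice: "(\<lambda>y. iter_pd ?S (?dt m) F (y, s)) \<in> schwartz K" for s
    by (rule schwartz_slice[OF K schwartz_iter_pd[OF F replicate_dt_Basis] UNIV_I])
  have c: "c j \<in> schwartz K" for j
    unfolding c_def by (intro schwartz_sum[OF K] schwartz_cmult[OF K] slice) auto
  have dc: "iter_pd K ys (c j) y = (\<Sum>k\<in>{1..n}. of_real ((- 1 / real j) ^ m * a k j) * H ys y (\<tau> k))"
    if ys: "set ys \<subseteq> Basis" and y: "y \<in> K" for ys j y
  proof -
    note sl = schwartz_smooth[OF slice]
    have "iter_pd K ys (c j) y = (\<Sum>k\<in>{1..n}. iter_pd K ys (\<lambda>y. of_real ((- 1 / real j) ^ m * a k j)
        * iter_pd ?S (?dt m) F (y, \<tau> k)) y)"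
      unfolding c_def using iter_pd_sum[OF K,
          of "{1..n}" "\<lambda>k y. of_real ((- 1 / real j) ^ m * a k j) * iter_pd ?S (?dt m) F (y, \<tau> k)"]
        schwartz_smooth[OF schwartz_cmult[OF K slice]] ys y by blast
    also have "\<dots> = (\<Sum>k\<in>{1..n}. of_real ((- 1 / real j) ^ m * a k j) * H ys y (\<tau> k))"
    proof (rule sum.cong[OF refl])
      fix k
      have "iter_pd K ys (\<lambda>y. iter_pd ?S (?dt m) F (y, \<tau> k)) y = H ys y (\<tau> k)"
        unfolding H_def iter_pd_append
        by (rule iter_pd_slice(2)[OF K smooth_within_iter_pd[OF sm replicate_dt_Basis] UNIV_I ys y])
      then show "iter_pd K ys (\<lambda>y. of_real ((- 1 / real j) ^ m * a k j) * iter_pd ?S (?dt m) F (y,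
          \<tau> k)) y =
          of_real ((- 1 / real j) ^ m * a k j) * H ys y (\<tau> k)"
        using iter_pd_lincomb(2)[OF K sl sl ys y, where d=0] by simp
    qed
    finally show ?thesis .
  qed
  \<comment> \<open>Proved for i = m by the Bernstein rate at fixed y and carried down to smaller i
    from infinity, where F is eventually 0 and every exponential has j \<ge> 1.\<close>
  have est: "norm (iter_pd ?S (?dt i @ ?dy ys) F (y, t) -
      (\<Sum>j\<in>{1..Suc n}. iter_pd K ys (c j) y * of_real ((- real j) ^ i * exp (- real j * t))))
      \<le> exp (-2) * (L / (1 + norm y) ^ N) / sqrt n * exp (- t)"
    if ys: "set ys \<subseteq> Basis" "length ys \<le> m" and y: "y \<in> K" and i: "i \<le> m" and t: "t \<ge> -2" for ys y i t
  proof -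
    define e where "e i t = iter_pd ?S (?dt i @ ?dy ys) F (y, t) -
      (\<Sum>j\<in>{1..Suc n}. iter_pd K ys (c j) y * of_real ((- real j) ^ i * exp (- real j * t)))" for i t
    have W: "(1 + norm y) ^ N > 0" by (simp add: add_pos_nonneg)
    have bd: "norm (iter_pd ?S bs F (y, s)) \<le> C / (1 + norm y) ^ N"
      if "set bs \<subseteq> Basis" "length bs \<le> 2 * m + 1" for bs s
    proof -
      have "(1 + norm y) ^ N * norm (iter_pd ?S bs F (y, s)) \<le> (1 + norm (y,
          s)) ^ N * norm (iter_pd ?S bs F (y, s))"
        using norm_fst_le[of y s] by (intro mult_right_mono power_mono) auto
      also have "\<dots> \<le> C" using that y by (intro C) auto
      finally show ?thesis using W by (simp add: field_simps)
    qed
    have e_m: "norm (e m t) \<le> exp (-2) * (L / (1 + norm y) ^ N) / sqrt n * exp (- t)" if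
        t: "t \<ge> -2" for t
    proof -
      define x where "x = exp (- t - 2)"
      have x: "x > 0" "x \<le> 1" "- 2 - ln x = t" "x = exp (-2) * exp (- t)"
        using t by (auto simp: x_def exp_add[symmetric])
      have xj: "exp (- 2 * real j) * exp (- real j * t) = x ^ j" for j
        by (simp add: x_def exp_of_nat_mult[symmetric] exp_add[symmetric] algebra_simps)
      define G where "G x = (if x \<le> 0 then 0 else H ys y (- 2 - ln x) / complex_of_real x)" for x
      have "norm (G x - (\<Sum>k\<le>n. G (k / n) * of_real (Bernstein n k x))) \<le> (L / (1 + norm y) ^ N) / sqrt n"
      proof (rule Bernstein_lipschitz_approx[OF _ n(1)])
        show "x \<in> {0..1}" using x by simp
        fix z w :: real assume z: "z \<in> {0..1}" "w \<in> {0..1}"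
        have "norm (G z - G w) \<le> 2 * (C / (1 + norm y) ^ N) * exp (2 * (R' + 2)) * \<bar>z - w\<bar>"
          unfolding G_def
        proof (rule lipschitz_in_exp_variable[OF _ _ _ _ _ z])
          show "(H ys y has_vector_derivative H' ys y s) (at s)" for s
            unfolding H_def[abs_def] H'_def using ys map_dy_Basis[OF ys(1)] DT
            by (intro iter_pd_cylinder_dt[OF sm _ y]) (auto simp: tv)
          show "norm (H ys y s) \<le> C / (1 + norm y) ^ N" "norm (H' ys y s) \<le> C / (1 + norm y) ^ N" for s
            unfolding H_def H'_def using ys map_dy_Basis[OF ys(1)] DT[of m] tv
            by (intro bd; auto)+
          show "H ys y s = 0" "H' ys y s = 0" if "s \<ge> R'" for s
            unfolding H_def H'_def using ys map_dy_Basis[OF ys(1)] DT[of m] tv that y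
            by (intro van; auto)+
        qed
        also have "2 * (C / (1 + norm y) ^ N) * exp (2 * (R' + 2)) =
            L / (1 + norm y) ^ N" by (simp add: L_def)
        finally show "norm (G z - G w) \<le> L / (1 + norm y) ^ N * \<bar>z - w\<bar>" .
      qed
      then have "x * norm (G x - (\<Sum>k\<le>n. G (k / n) * of_real (Bernstein n k x))) \<le>
          x * ((L / (1 + norm y) ^ N) / sqrt n)"
        using x by (intro mult_left_mono) auto
      also have "x * norm (G x - (\<Sum>k\<le>n. G (k / n) * of_real (Bernstein n k x))) =
          norm (of_real x * (G x - (\<Sum>k\<le>n. G (k / n) * of_real (Bernstein n k x))))"
        using x by (simp only: norm_mult norm_of_real abs_of_pos)
      \<comment> \<open>Written out, x times the Bernstein polynomial of G is the mth time
        derivative of the exponential sum; interchanging the sums over j and k shows it.\<close>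
      also have "of_real x * (G x - (\<Sum>k\<le>n. G (k / n) * of_real (Bernstein n k x))) = e m t"
      proof -
        have "of_real x * G x = H ys y t" using x(1,3) by (simp add: G_def)
        also have "\<dots> = iter_pd ?S (?dt m @ ?dy ys) F (y, t)"
          unfolding H_def using iter_pd_sort[OF K sm, of "(y, t)" "?dy ys @ ?dt m"] y
            map_dy_Basis[OF ys(1)] DT[of m] parts_replicate_dt[of ys m]
          by auto
        finally have 1: "of_real x * G x = iter_pd ?S (?dt m @ ?dy ys) F (y, t)" .
        have "(\<Sum>j\<in>{1..Suc n}. iter_pd K ys (c j) y * of_real ((- real j) ^ m * exp (- real j * t))) =
            (\<Sum>j\<in>{1..Suc n}. \<Sum>k\<in>{1..n}. of_real (n / k * (r k j * x ^ j)) * H ys y (\<tau> k))"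
        proof (rule sum.cong[OF refl])
          fix j assume j: "j \<in> {1..Suc n}"
          have "(- 1 / real j) ^ m * a k j * ((- real j) ^ m * exp (- real j * t)) =
              n / k * (r k j * x ^ j)" for k
          proof -
            have "(- 1 / real j) ^ m * (- real j) ^ m = 1"
              using j unfolding power_mult_distrib[symmetric] by simp
            then have "(- 1 / real j) ^ m * a k j * ((- real j) ^ m * exp (- real j * t)) =
                a k j * exp (- real j * t)"
              by (simp add: mult_ac)
            then show ?thesis by (simp add: a_def xj[symmetric])
          qed
          then have *: "complex_of_real ((- 1 / real j) ^ m * a k j) * of_real ((- real j) ^ m *
              exp (- real j * t)) = of_real (n / k * (r k j * x ^ j))" for k
            unfolding of_real_mult[symmetric] by simp
          show "iter_pd K ys (c j) y * of_real ((- real j) ^ m * exp (- real j * t)) =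
              (\<Sum>k\<in>{1..n}. of_real (n / k * (r k j * x ^ j)) * H ys y (\<tau> k))"
            unfolding dc[OF ys(1) y] sum_distrib_right *[symmetric]
            by (rule sum.cong[OF refl]) (simp only: mult.assoc mult.left_commute mult.commute)
        qed
        also have "\<dots> = (\<Sum>k\<in>{1..n}. \<Sum>j\<in>{1..Suc n}. of_real (n / k * (r k j * x ^ j)) * H ys y (\<tau> k))"
          by (rule sum.swap)
        also have "\<dots> = (\<Sum>k\<in>{1..n}. of_real x * (G (k / n) * of_real (Bernstein n k x)))"
        proof (rule sum.cong[OF refl])
          fix k assume k: "k \<in> {1..n}"
          have "(\<Sum>j\<in>{1..Suc n}. complex_of_real (n / k * (r k j * x ^ j)) * H ys y (\<tau> k)) =
              of_real (n / k * (\<Sum>j\<in>{1..Suc n}. r k j * x ^ j)) * H ys y (\<tau> k)"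
            unfolding sum_distrib_left of_real_sum sum_distrib_right ..
          also have "(\<Sum>j\<in>{1..Suc n}. r k j * x ^ j) = x * Bernstein n k x" using r k by simp
          also have "of_real (n / k * (x * Bernstein n k x)) * H ys y (\<tau> k) =
              of_real x * (G (k / n) * of_real (Bernstein n k x))"
            using k n by (simp add: G_def \<tau>_def field_simps)
          finally show "(\<Sum>j\<in>{1..Suc n}. complex_of_real (n / k * (r k j * x ^ j)) * H ys y (\<tau> k)) =
              of_real x * (G (k / n) * of_real (Bernstein n k x))" .
        qed
        also have "\<dots> = (\<Sum>k\<le>n. of_real x * (G (k / n) * of_real (Bernstein n k x)))"
          by (rule sum.mono_neutral_left) (auto simp: G_def)
        finally have 2: "(\<Sum>j\<in>{1..Suc n}. iter_pd K ys (c j) y * of_real ((- real j) ^ m * exp (-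
            real j * t))) =
            of_real x * (\<Sum>k\<le>n. G (k / n) * of_real (Bernstein n k x))"
          by (simp only: sum_distrib_left)
        show ?thesis unfolding e_def 2 1[symmetric] by (simp only: right_diff_distrib)
      qed
      finally show ?thesis using x(4) by (simp add: mult_ac)
    qed
    have "norm (e i t) \<le> exp (-2) * (L / (1 + norm y) ^ N) / sqrt n * exp (- t)"
    proof (rule vanishing_at_infinity_derivative_bound[where e=e and m=m and a="-2"])
      show "norm (e m t) \<le> exp (-2) * (L / (1 + norm y) ^ N) / sqrt n * exp (- t)" if "t \<ge> -2" for t
        using that by (rule e_m)
      show "i \<le> m" "t \<ge> -2" using i t .
      show "(e i has_vector_derivative e (Suc i) t) (at t)" for i t
        unfolding e_def[abs_def]
      proof (intro has_vector_derivative_diff has_vector_derivative_sum)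
        show "((\<lambda>t. iter_pd ?S (?dt i @ ?dy ys) F (y, t)) has_vector_derivative
            iter_pd ?S (?dt (Suc i) @ ?dy ys) F (y, t)) (at t)"
          using iter_pd_cylinder_dt[OF sm _ y,
              of "?dt i @ ?dy ys"] map_dy_Basis[OF ys(1)] DT[of i] by simp
        fix j :: nat
        show "((\<lambda>t. iter_pd K ys (c j) y * of_real ((- real j) ^ i * exp (- real j * t)))
            has_vector_derivative
            iter_pd K ys (c j) y * of_real ((- real j) ^ Suc i * exp (- real j * t))) (at t)"
          by (intro has_vector_derivative_mult_right has_vector_derivative_of_real)
            (auto intro!: derivative_eq_intros simp:
                has_real_derivative_iff_has_vector_derivative[symmetric])
      qed
      show "(e i \<longlongrightarrow> 0) at_top" for i
      proof -
        have "((\<lambda>t. iter_pd ?S (?dt i @ ?dy ys) F (y, t)) \<longlongrightarrow> 0) at_top"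
        proof (rule tendsto_eventually)
          show "\<forall>\<^sub>F t in at_top. iter_pd ?S (?dt i @ ?dy ys) F (y, t) = 0"
            using eventually_ge_at_top[of R']
            by eventually_elim (rule van; use map_dy_Basis[OF ys(1)] DT[of i] y in auto)
        qed
        moreover have "((\<lambda>t. \<Sum>j\<in>{1..Suc n}. iter_pd K ys (c j) y * of_real ((- real j) ^ i * exp (-
            real j * t))) \<longlongrightarrow>
            (\<Sum>j\<in>{1..Suc n}. iter_pd K ys (c j) y * of_real ((- real j) ^ i * 0))) at_top"
        proof (intro tendsto_intros)
          fix j assume "j \<in> {1..Suc n}"
          then show "((\<lambda>t. exp (- real j * t)) \<longlongrightarrow> 0) at_top"
            by (intro filterlim_compose[OF exp_at_bot] filterlim_tendsto_neg_mult_at_bot[OF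
                tendsto_const _ filterlim_ident]) auto
        qed
        ultimately have "(e i \<longlongrightarrow> 0 - (\<Sum>j\<in>{1..Suc n}. iter_pd K ys (c j) y * of_real ((- real j) ^ i
            * 0))) at_top"
          unfolding e_def[abs_def] by (rule tendsto_diff)
        then show ?thesis by simp
      qed
    qed
    then show ?thesis by (simp only: e_def)
  qed
  show ?thesis
  proof (rule exI[of _ "Suc n"], rule exI[of _ c], intro conjI ballI allI impI c)
    fix bs :: "('a \<times> real) list" and y and t :: real
    assume bs: "set bs \<subseteq> Basis" "length bs \<le> m" and y: "y \<in> K" and t: "t \<ge> -2"
    note p = part_Basis[OF bs(1)]
    let ?E = "norm (iter_pd ?S bs F (y, t) - (\<Sum>j\<in>{1..Suc n}. iter_pd K (fst_part bs) (c j) y *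
        of_real ((- real j) ^ length (snd_part bs) * exp (- real j * t))))"
    have "?E \<le> exp (-2) * (L / (1 + norm y) ^ N) / sqrt n * exp (- t)"
    proof -
      have eq: "iter_pd ?S bs F (y, t) = iter_pd ?S (?dt (length (snd_part bs)) @ ?dy (fst_part
          bs)) F (y, t)"
        by (rule iter_pd_sort[OF K sm _ bs(1)]) (use y in simp)
      show ?thesis unfolding eq by (rule est) (use y t p bs in auto)
    qed
    then have "(1 + norm (y, t)) ^ N * ?E \<le>
        ((1 + norm y) ^ N * (1 + \<bar>t\<bar>) ^ N) * (exp (-2) * (L / (1 + norm y) ^ N) / sqrt n * exp (- t))"
      using weight_Pair_le[of y t N] by (intro mult_mono) (auto simp: L)
    also have "\<dots> = exp (-2) * L / sqrt n * ((1 + \<bar>t\<bar>) ^ N * exp (- 1 * t))"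
    proof -
      have "w * q * (exp (-2) * (L / w) / sqrt n * exp (- t)) =
          exp (-2) * L / sqrt n * (q * exp (- 1 * t))"
        if "w \<noteq> 0" for w q :: real
        using that n(1) by (simp add: field_simps)
      moreover have "(1 + norm y) ^ N \<noteq> 0" using add_pos_nonneg[of 1 "norm y"] by auto
      ultimately show ?thesis by blast
    qed
    also have "\<dots> \<le> exp (-2) * L / sqrt n * B"
      using L by (intro mult_left_mono B(2) t) auto
    also have "\<dots> \<le> \<eta>" using n(2) by (simp add: field_simps)
    finally show "(1 + norm (y, t)) ^ N * ?E \<le> \<eta>" .
  qed
qed

lemma smooth_bounded_cutoff:
  assumes "\<bar>c\<bar> \<le> 1"
  shows "smooth_bounded (\<lambda>t. complex_of_real (cutoff 0 (c * t + d)))"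
  unfolding smooth_bounded_def
proof (intro conjI allI)
  show "smooth_within UNIV (\<lambda>t. complex_of_real (cutoff 0 (c * t + d)))" by (rule iter_pd_cutoff(1))
  fix m
  obtain B where B: "B \<ge> 0" "\<And>n t. n \<le> m \<Longrightarrow> \<bar>cutoff n t\<bar> \<le> B" using cutoff_bounded_upto by metis
  show "\<exists>B. \<forall>bs t. set bs \<subseteq> Basis \<longrightarrow> length bs \<le> m \<longrightarrow>
      norm (iter_pd UNIV bs (\<lambda>t. complex_of_real (cutoff 0 (c * t + d))) t) \<le> B"
  proof (intro exI allI impI)
    fix bs :: "real list" and t :: real
    assume bs: "set bs \<subseteq> Basis" "length bs \<le> m"
    have "\<bar>c\<bar> ^ length bs \<le> 1" using assms by (intro power_le_one) auto
    then have "\<bar>c\<bar> ^ length bs * \<bar>cutoff (length bs) (c * t + d)\<bar> \<le> 1 * B"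
      using B bs by (intro mult_mono) auto
    then show "norm (iter_pd UNIV bs (\<lambda>t. complex_of_real (cutoff 0 (c * t + d))) t) \<le> B"
      unfolding iter_pd_cutoff(2)[OF bs(1)] norm_of_real by (simp add: abs_mult power_abs)
  qed
qed

section \<open>Tempered distributions supported in nonnegative time\<close>

context
  fixes S :: "'a::euclidean_space set" and u :: "('a \<Rightarrow> complex) \<Rightarrow> complex"
  assumes S: "segment_set S" and u: "u \<in> tempered_dist S"
begin

lemma tempered_dist_add: "f \<in> schwartz S \<Longrightarrow> g \<in> schwartz S \<Longrightarrow> u (\<lambda>x. f x + g x) = u f + u g"
  using u by (simp add: tempered_dist_def)

lemma tempered_dist_cmult: "f \<in> schwartz S \<Longrightarrow> u (\<lambda>x. c * f x) = c * u f"
  using u by (simp add: tempered_dist_def)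

lemma tempered_dist_sum:
  assumes "finite I" "\<And>i. i \<in> I \<Longrightarrow> f i \<in> schwartz S"
  shows "u (\<lambda>x. \<Sum>i\<in>I. f i x) = (\<Sum>i\<in>I. u (f i))"
  using assms
proof (induction rule: finite_induct)
  case empty
  then show ?case using tempered_dist_cmult[OF schwartz_zero[OF S], of 0] by simp
next
  case (insert i I)
  then show ?case by (simp add: tempered_dist_add schwartz_sum[OF S])
qed

lemma tempered_dist_tendsto:
  assumes "\<And>n. fs n \<in> schwartz S" "f \<in> schwartz S"
    and "\<And>m N. (\<lambda>n. schwartz_seminorm S m N (\<lambda>x. fs n x - f x)) \<longlonglongrightarrow> 0"
  shows "(\<lambda>n. u (fs n)) \<longlonglongrightarrow> u f"
  using u assms unfolding tempered_dist_def by blast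

end

text \<open>\<open>dist_supported\<close> looks at the closure of the set where a test function is
  nonzero. The margin \<delta> keeps this closure within t \<le> - \<delta>, away from t \<ge>
  0.\<close>

lemma tempered_dist_eq_if_eq_near_support:
  fixes u :: "('a::euclidean_space \<times> real \<Rightarrow> complex) \<Rightarrow> complex"
  assumes K: "segment_set K" and u: "u \<in> tempered_dist (K \<times> UNIV)"
    and supp: "dist_supported (K \<times> UNIV) (K \<times> {0..}) u"
    and f: "f \<in> schwartz (K \<times> UNIV)" and g: "g \<in> schwartz (K \<times> UNIV)"
    and \<delta>: "\<delta> > 0" and fg: "\<And>y t. y \<in> K \<Longrightarrow> t \<ge> - \<delta> \<Longrightarrow> f (y, t) = g (y, t)"
  shows "u f = u g"
proof -
  let ?S = "K \<times> (UNIV :: real set)"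
  have S: "segment_set ?S" by (rule segment_set_Times[OF K segment_set_UNIV])
  have d: "(\<lambda>x. f x - g x) \<in> schwartz ?S" by (rule schwartz_diff[OF S f g])
  have sub: "closure {x \<in> ?S. f x - g x \<noteq> 0} \<subseteq> {x. snd x \<le> - \<delta>}"
  proof (rule closure_minimal)
    show "{x \<in> ?S. f x - g x \<noteq> 0} \<subseteq> {x. snd x \<le> - \<delta>}"
    proof
      fix x assume x: "x \<in> {x \<in> ?S. f x - g x \<noteq> 0}"
      then have "\<not> - \<delta> \<le> snd x" using fg[of "fst x" "snd x"] by (auto simp: mem_Times_iff)
      then show "x \<in> {x. snd x \<le> - \<delta>}" by simp
    qed
    show "closed {x :: 'a \<times> real. snd x \<le> - \<delta>}"
      by (intro closed_Collect_le continuous_intros)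
  qed
  have "x \<notin> K \<times> {0..}" if "x \<in> {x. snd x \<le> - \<delta>}" for x
  proof
    assume "x \<in> K \<times> {0..}"
    then have "0 \<le> snd x" by (simp add: mem_Times_iff)
    with that \<delta> show False by simp
  qed
  then have "{x. snd x \<le> - \<delta>} \<inter> K \<times> {0..} = {}" by (intro equals0I) (elim IntE, metis)
  then have "closure {x \<in> ?S. f x - g x \<noteq> 0} \<inter> K \<times> {0..} = {}"
    using Int_mono[OF sub order_refl, of "K \<times> {0..}"] by (simp only: subset_empty)
  then have "u (\<lambda>x. f x - g x) = 0"
    by (rule supp[unfolded dist_supported_def, THEN bspec, OF d, THEN mp])
  moreover have "u (\<lambda>x. g x + (f x - g x)) = u g + u (\<lambda>x. f x - g x)"
    by (rule tempered_dist_add[OF S u g d])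
  ultimately show ?thesis by simp
qed

text \<open>Identifies the expression estimated in \<open>exp_sum_approx\<close>, in which the
  derivatives of the sum are written out, with the derivatives of the error itself.\<close>

lemma smooth_within_exp_sum:
  fixes F :: "'a::euclidean_space \<times> real \<Rightarrow> complex"
  assumes K: "segment_set K" and F: "smooth_within (K \<times> UNIV) F" and c: "\<And>j. j \<in> {1..J} \<Longrightarrow>
      smooth_within K (c j)"
  defines "D \<equiv> \<lambda>(y, t). F (y, t) - (\<Sum>j\<in>{1..J::nat}. c j y * exp (- of_nat j * of_real t))"
  shows "smooth_within (K \<times> UNIV) D"
    and "\<And>bs y t. set bs \<subseteq> Basis \<Longrightarrow> y \<in> K \<Longrightarrow> iter_pd (K \<times> UNIV) bs D (y, t) =
        iter_pd (K \<times> UNIV) bs F (y, t) -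
        (\<Sum>j\<in>{1..J}. iter_pd K (fst_part bs) (c j) y * of_real ((- real j) ^ length (snd_part bs) *
            exp (- real j * t)))"
proof -
  let ?S = "K \<times> (UNIV :: real set)"
  have S: "segment_set ?S" by (rule segment_set_Times[OF K segment_set_UNIV])
  let ?T = "\<lambda>j p. (case p of (y, t) \<Rightarrow> c j y * exp (- of_nat j * of_real t))"
  note T = iter_pd_tensor[OF K segment_set_UNIV c iter_pd_exp(1)]
  note sum = iter_pd_sum[OF S, of "{1..J}" ?T, OF _ T(1)]
  have D: "D = (\<lambda>p. 1 * F p + (-1) * (\<Sum>j\<in>{1..J}. ?T j p))" by (auto simp: D_def fun_eq_iff)
  show "smooth_within ?S D"
    unfolding D by (rule iter_pd_lincomb(1)[OF S F]) (use sum in auto)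
  fix bs :: "('a \<times> real) list" and y t assume bs: "set bs \<subseteq> Basis" and y: "y \<in> K"
  have "iter_pd ?S bs D (y, t) = 1 * iter_pd ?S bs F (y,
      t) + (-1) * iter_pd ?S bs (\<lambda>p. \<Sum>j\<in>{1..J}. ?T j p) (y, t)"
    unfolding D by (rule iter_pd_lincomb(2)[OF S F]) (use sum bs y in auto)
  also have "iter_pd ?S bs (\<lambda>p. \<Sum>j\<in>{1..J}. ?T j p) (y, t) = (\<Sum>j\<in>{1..J}. iter_pd ?S bs (?T j) (y, t))"
    using sum bs y by auto
  also have "\<dots> = (\<Sum>j\<in>{1..J}. iter_pd K (fst_part bs) (c j) y * of_real ((- real j) ^ length
      (snd_part bs) * exp (- real j * t)))"
  proof (rule sum.cong[OF refl])
    fix j assume j: "j \<in> {1..J}"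
    show "iter_pd ?S bs (?T j) (y, t) = iter_pd K (fst_part bs) (c j) y * of_real ((- real j) ^
        length (snd_part bs) * exp (- real j * t))"
      unfolding T(2)[OF j bs y UNIV_I] iter_pd_exp(2)[OF part_Basis(2)[OF bs]]
      by (simp add: exp_of_real[symmetric])
  qed
  finally show "iter_pd ?S bs D (y, t) = iter_pd ?S bs F (y, t) -
        (\<Sum>j\<in>{1..J}. iter_pd K (fst_part bs) (c j) y * of_real ((- real j) ^ length (snd_part bs) *
            exp (- real j * t)))"
    by simp
qed

context
  fixes K :: "'a::euclidean_space set" and u v :: "('a \<times> real \<Rightarrow> complex) \<Rightarrow> complex"
  assumes K: "segment_set K" and ne: "K \<noteq> {}"
    and u: "u \<in> tempered_dist (K \<times> UNIV)" and v: "v \<in> tempered_dist (K \<times> UNIV)"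
    and supp_u: "dist_supported (K \<times> UNIV) (K \<times> {0..}) u"
    and supp_v: "dist_supported (K \<times> UNIV) (K \<times> {0..}) v"
    and eq: "\<And>\<psi> s. \<psi> \<in> schwartz K \<Longrightarrow> s > 0 \<Longrightarrow>
      u (\<lambda>(y, t). \<psi> y * FL_kernel (\<i> * of_real s) t) = v (\<lambda>(y, t). \<psi> y * FL_kernel (\<i> * of_real s) t)"
begin

text \<open>Trades the unspecified kernel for an explicit one: both equal exp (- s t) for t \<ge> -
  min \<delta> (1/2), hence near the supports of u and v.\<close>

lemma tempered_eq_on_exp:
  assumes \<psi>: "\<psi> \<in> schwartz K" and s: "s > 0"
  defines "e \<equiv> \<lambda>(y, t). \<psi> y * (of_real (cutoff 0 t) * exp (- of_real s * of_real t))"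
  shows "e \<in> schwartz (K \<times> UNIV)" and "u e = v e"
proof -
  have up: "\<i> * of_real s \<in> upper_half" using s by (simp add: upper_half_def)
  note k = FL_kernel[OF up]
  obtain \<delta> where \<delta>: "\<delta> > 0" "\<And>t. t \<ge> - \<delta> \<Longrightarrow> FL_kernel (\<i> * of_real s) t =
      exp (\<i> * (\<i> * of_real s) * of_real t)"
    using k(2) by blast
  show e: "e \<in> schwartz (K \<times> UNIV)"
    unfolding e_def by (intro schwartz_tensor K segment_set_UNIV \<psi> schwartz_cutoff_exp) (use s in simp)
  have e': "(\<lambda>(y, t). \<psi> y * FL_kernel (\<i> * of_real s) t) \<in> schwartz (K \<times> UNIV)"
    by (intro schwartz_tensor K segment_set_UNIV \<psi> k(1))
  have same: "e (y, t) = (\<lambda>(y, t). \<psi> y * FL_kernel (\<i> * of_real s) t) (y, t)" if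
      "t \<ge> - min \<delta> (1 / 2)" for y t
    using that \<delta>(2)[of t] by (auto simp: e_def cutoff_eq_1 mult.assoc[symmetric])
  have "u e = u (\<lambda>(y, t). \<psi> y * FL_kernel (\<i> * of_real s) t)"
    by (rule tempered_dist_eq_if_eq_near_support[OF K u supp_u e e',
        of "min \<delta> (1 / 2)"]) (use \<delta> same in auto)
  also have "\<dots> = v (\<lambda>(y, t). \<psi> y * FL_kernel (\<i> * of_real s) t)" by (rule eq[OF \<psi> s])
  also have "\<dots> = v e"
    by (rule tempered_dist_eq_if_eq_near_support[OF K v supp_v e e', of "min \<delta> (1 / 2)",
        symmetric]) (use \<delta> same in auto)
  finally show "u e = v e" .
qed

text \<open>The nth sum approximates n derivatives with weight exponent n up to 1 / (n + 1), so this
  single sequence converges in every seminorm. The cutoff makes the exponentials, which grow as t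
  tends to - \<infinity>, Schwartz functions; near the supports of u and v it is 1.\<close>

lemma tempered_eq_on_time_compact:
  assumes F: "F \<in> schwartz (K \<times> UNIV)" and F0: "\<And>y t. y \<in> K \<Longrightarrow> t \<ge> R \<Longrightarrow> F (y, t) = 0"
  shows "u F = v F"
proof -
  let ?S = "K \<times> (UNIV :: real set)"
  have S: "segment_set ?S" by (rule segment_set_Times[OF K segment_set_UNIV])
  define P where "P n J c \<longleftrightarrow> (\<forall>j\<in>{1..J}. c j \<in> schwartz K) \<and>
    (\<forall>bs y t. set bs \<subseteq> Basis \<longrightarrow> length bs \<le> n \<longrightarrow> y \<in> K \<longrightarrow> t \<ge> -2 \<longrightarrow>
      (1 + norm (y, t)) ^ n * norm (iter_pd ?S bs F (y, t) -
        (\<Sum>j\<in>{1..J}. iter_pd K (fst_part bs) (c j) y * of_real ((- real j) ^ length (snd_part bs) *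
            exp (- real j * t)))) \<le> 1 / real (Suc n))"
    for n J and c :: "nat \<Rightarrow> 'a \<Rightarrow> complex"
  have "\<exists>J c. P n J c" for n
    unfolding P_def by (rule exp_sum_approx[OF K F F0]) auto
  then obtain J c where P: "\<And>n. P n (J n) (c n)" by metis
  have c: "c n j \<in> schwartz K" if "j \<in> {1..J n}" for n j
    using P[of n] that unfolding P_def by blast
  have approx: "(1 + norm (y, t)) ^ n * norm (iter_pd ?S bs F (y, t) -
        (\<Sum>j\<in>{1..J n}. iter_pd K (fst_part bs) (c n j) y * of_real ((- real j) ^ length (snd_part
            bs) * exp (- real j * t)))) \<le> 1 / real (Suc n)"
    if "set bs \<subseteq> Basis" "length bs \<le> n" "y \<in> K" "t \<ge> -2" for n bs y t
    using P[of n] that unfolding P_def by blast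
  let ?cut = "\<lambda>t. complex_of_real (cutoff 0 t)"
  have sb: "smooth_bounded ?cut" using smooth_bounded_cutoff[of 1 0] by simp
  then have smc: "smooth_within UNIV ?cut" by (simp add: smooth_bounded_def)
  define F1 where "F1 p = ?cut (snd p) * F p" for p
  define D where "D n = (\<lambda>(y, t). F (y, t) - (\<Sum>j\<in>{1..J n}. c n j y * exp (- of_nat j * of_real
      t)))" for n
  define g where "g n = (\<lambda>p. \<Sum>j\<in>{1..J n}. (\<lambda>(y,
      t). c n j y * (?cut t * exp (- of_real (real j) * of_real t))) p)" for n
  have F1: "F1 \<in> schwartz ?S" unfolding F1_def by (rule schwartz_mult_snd[OF K sb F])
  have g: "g n \<in> schwartz ?S" for n
    unfolding g_def by (intro schwartz_sum[OF S] tempered_eq_on_exp(1) c) auto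
  have ug: "u (g n) = v (g n)" for n
  proof -
    have "u (g n) = (\<Sum>j\<in>{1..J n}. u (\<lambda>(y, t). c n j y * (?cut t * exp (- of_real (real j) * of_real
        t))))"
      unfolding g_def by (intro tempered_dist_sum[OF S u] tempered_eq_on_exp(1) c) auto
    also have "\<dots> = (\<Sum>j\<in>{1..J n}. v (\<lambda>(y, t). c n j y * (?cut t * exp (- of_real (real j) * of_real t))))"
      by (intro sum.cong refl tempered_eq_on_exp(2) c) auto
    also have "\<dots> = v (g n)"
      unfolding g_def by (intro tempered_dist_sum[OF S v, symmetric] tempered_eq_on_exp(1) c) auto
    finally show ?thesis .
  qed
  have gD: "(\<lambda>x. g n x - F1 x) = (\<lambda>p. (- ?cut (snd p)) * D n p)" for n
    by (auto simp: g_def F1_def D_def fun_eq_iff sum_distrib_left algebra_simps)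
  have smD: "smooth_within ?S (D n)" for n
    unfolding D_def by (rule smooth_within_exp_sum(1)[OF K schwartz_smooth[OF F] schwartz_smooth[OF c]])
  have iterD: "iter_pd ?S bs (D n) (y, t) = iter_pd ?S bs F (y, t) -
        (\<Sum>j\<in>{1..J n}. iter_pd K (fst_part bs) (c n j) y * of_real ((- real j) ^ length (snd_part
            bs) * exp (- real j * t)))"
    if "set bs \<subseteq> Basis" "y \<in> K" for n bs y t
    unfolding D_def by (rule smooth_within_exp_sum(2)[OF K schwartz_smooth[OF F] schwartz_smooth[OF
        c] that])
  have conv: "(\<lambda>n. schwartz_seminorm ?S m N (\<lambda>x. g n x - F1 x)) \<longlonglongrightarrow> 0" for m N
  proof -
    obtain B where B: "B \<ge> 0" "\<And>bs t. set bs \<subseteq> Basis \<Longrightarrow> length bs \<le> m \<Longrightarrow> norm (iter_pd UNIV bs ?cut t) \<le> B"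
      using smooth_bounded_bound[OF sb] by metis
    have bound: "(1 + norm x) ^ N * norm (iter_pd ?S bs (\<lambda>x. g n x - F1 x) x) \<le>
        2 ^ m * B * (1 / real (Suc n))"
      if n: "n \<ge> max m N" and bs: "set bs \<subseteq> Basis" "length bs \<le> m" and x: "x \<in> ?S" for n bs x
    proof -
      obtain y t where [simp]: "x = (y, t)" and y: "y \<in> K" using x by auto
      show ?thesis
      \<comment> \<open>To the left the cutoff is identically 0; to the right t \<ge> - 2 holds, as
        the approximation demands.\<close>
      proof (cases "t < - 3 / 2")
        case True
        have "iter_pd ?S bs (\<lambda>x. g n x - F1 x) x = 0"
          unfolding gD
          by (rule iter_pd_eq_0[OF S, of "UNIV \<times> {..<- 3 / 2}"])
            (use True bs y in \<open>auto simp: cutoff_eq_0 intro!: open_Times\<close>)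
        then show ?thesis using B by simp
      next
        case False
        have W: "(1 + norm x) ^ N > 0" by (simp add: add_pos_nonneg)
        have cs: "smooth_within ?S (\<lambda>p. ?cut (snd p))" by (rule iter_pd_snd(1)[OF K smc])
        have ms: "smooth_within ?S (\<lambda>p. - ?cut (snd p))"
          using iter_pd_lincomb(1)[OF S cs cs, of "-1" 0] by simp
        have "norm (iter_pd ?S bs (\<lambda>p. (- ?cut (snd p)) * D n p) x) \<le>
            2 ^ m * (B * (1 / real (Suc n) / (1 + norm x) ^ N))"
        proof (rule norm_iter_pd_mult_le[OF S ms _ bs x])
          show "smooth_within ?S (D n)" by (rule smD)
          fix as assume as: "set as \<subseteq> (Basis :: ('a \<times> real) set)" "length as \<le> m"
          have "iter_pd ?S as (\<lambda>p. - ?cut (snd p)) x = - iter_pd ?S as (\<lambda>p. ?cut (snd p)) x"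
            using iter_pd_lincomb(2)[OF S cs cs as(1) x, where c="-1" and d=0] by simp
          then have "norm (iter_pd ?S as (\<lambda>p. - ?cut (snd p)) x) \<le>
              norm (iter_pd UNIV (snd_part as) ?cut t)"
            using iter_pd_snd(2)[OF K smc as(1) y, of t] by simp
          also have "\<dots> \<le> B" using part_Basis[OF as(1)] as(2) by (intro B(2)) auto
          finally show "norm (iter_pd ?S as (\<lambda>p. - ?cut (snd p)) x) \<le> B" .
          have "(1 + norm x) ^ N * norm (iter_pd ?S as (D n) x) \<le>
              (1 + norm x) ^ n * norm (iter_pd ?S as (D n) x)"
            using n by (intro mult_right_mono power_increasing) auto
          also have "\<dots> \<le> 1 / real (Suc n)"
            using approx[of as n y t] iterD[of as y n t] as y n False by simp
          finally show "norm (iter_pd ?S as (D n) x) \<le> 1 / real (Suc n) / (1 + norm x) ^ N"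
            using W by (simp only: pos_le_divide_eq) (simp only: mult.commute)
        qed
        then have "(1 + norm x) ^ N * norm (iter_pd ?S bs (\<lambda>x. g n x - F1 x) x) \<le>
            (1 + norm x) ^ N * (2 ^ m * (B * (1 / real (Suc n) / (1 + norm x) ^ N)))"
          unfolding gD using W by (intro mult_left_mono) auto
        also have "\<dots> = 2 ^ m * B * (1 / real (Suc n))"
        proof -
          have "w * (2 ^ m * (B * (q / w))) = 2 ^ m * B * q" if "w > 0" for w q :: real
            using that by simp
          from this[OF W] show ?thesis .
        qed
        finally show ?thesis .
      qed
    qed
    have lim: "(\<lambda>n. 2 ^ m * B * (1 / real (Suc n))) \<longlonglongrightarrow> 0"
      using tendsto_mult_right_zero[OF LIMSEQ_Suc[OF lim_1_over_n]] by simp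
    show ?thesis
    proof (rule tendsto_sandwich[OF _ _ tendsto_const lim])
      have Sne: "?S \<noteq> {}" using ne by auto
      show "\<forall>\<^sub>F n in sequentially. 0 \<le> schwartz_seminorm ?S m N (\<lambda>x. g n x - F1 x)"
        using eventually_ge_at_top[of "max m N"]
        by eventually_elim (rule schwartz_seminorm_le(1)[OF Sne bound])
      show "\<forall>\<^sub>F n in sequentially. schwartz_seminorm ?S m N (\<lambda>x. g n x - F1 x) \<le>
          2 ^ m * B * (1 / real (Suc n))"
        using eventually_ge_at_top[of "max m N"]
        by eventually_elim (rule schwartz_seminorm_le(2)[OF Sne bound])
    qed
  qed
  have "(\<lambda>n. u (g n)) \<longlonglongrightarrow> u F1" by (rule tempered_dist_tendsto[OF S u g F1 conv])
  moreover have "(\<lambda>n. u (g n)) \<longlonglongrightarrow> v F1" unfolding ug by (rule tempered_dist_tendsto[OF S v g F1 conv])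
  ultimately have "u F1 = v F1" by (rule LIMSEQ_unique)
  moreover have "u F = u F1" "v F = v F1"
    by (rule tempered_dist_eq_if_eq_near_support[OF K u supp_u F F1,
        of "1/2"] tempered_dist_eq_if_eq_near_support[OF K v supp_v F F1, of "1/2"];
        simp add: F1_def cutoff_eq_1)+
  ultimately show ?thesis by simp
qed

text \<open>Removes the vanishing for large t. Truncation near time n changes f only where 1 + |x|
  \<ge> n + 1, so one spare power of the weight makes the error tend to 0 in each seminorm.\<close>

theorem tempered_dist_eqI: "u = v"
proof -
  let ?S = "K \<times> (UNIV :: real set)"
  have S: "segment_set ?S" by (rule segment_set_Times[OF K segment_set_UNIV])
  have "u f = v f" if f: "f \<in> schwartz ?S" for f
  proof -
    \<comment> \<open>Equal to 1 for t \<le> n + 1/2 and to 0 for t \<ge> n + 3/2; the slope - 1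
      keeps the bounds on derivatives independent of n.\<close>
    define a where "a n t = complex_of_real (cutoff 0 (- 1 * t + real n))" for n t
    define g where "g n p = a n (snd p) * f p" for n p
    have sb: "smooth_bounded (a n)" for n unfolding a_def by (rule smooth_bounded_cutoff) simp
    have sma: "smooth_within UNIV (a n)" for n using sb by (simp add: smooth_bounded_def)
    have g: "g n \<in> schwartz ?S" for n unfolding g_def by (rule schwartz_mult_snd[OF K sb f])
    have ug: "u (g n) = v (g n)" for n
      by (rule tempered_eq_on_time_compact[OF g,
          of "real n + 3 / 2"]) (simp add: g_def a_def cutoff_eq_0)
    define b where "b n p = 1 * a n (snd p) + (- 1) * 1" for n and p :: "'a \<times> real"
    have smb: "smooth_within ?S (b n)" for n
      unfolding b_def by (rule iter_pd_lincomb(1)[OF S iter_pd_snd(1)[OF K sma] iter_pd_const(1)[OF S]])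
    have gb: "(\<lambda>x. g n x - f x) = (\<lambda>x. b n x * f x)" for n by (auto simp: g_def b_def algebra_simps)
    have conv: "(\<lambda>n. schwartz_seminorm ?S m N (\<lambda>x. g n x - f x)) \<longlonglongrightarrow> 0" for m N
    proof -
      obtain B where B: "B \<ge> 0" "\<And>k t. k \<le> m \<Longrightarrow> \<bar>cutoff k t\<bar> \<le> B" using cutoff_bounded_upto by metis
      \<comment> \<open>\<open>Suc N\<close> is the spare power of the weight.\<close>
      obtain C where C: "C \<ge> 0" "\<And>bs x. set bs \<subseteq> Basis \<Longrightarrow> length bs \<le> m \<Longrightarrow> x \<in> ?S \<Longrightarrow>
          (1 + norm x) ^ Suc N * norm (iter_pd ?S bs f x) \<le> C"
        using schwartz_bound[OF f] by metis
      have bound: "(1 + norm x) ^ N * norm (iter_pd ?S bs (\<lambda>x. g n x - f x) x) \<le>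
          2 ^ m * ((B + 1) * C) * (1 / real (Suc n))"
        if bs: "set bs \<subseteq> Basis" "length bs \<le> m" and x: "x \<in> ?S" for n bs x
      proof -
        obtain y t where [simp]: "x = (y, t)" and y: "y \<in> K" using x by auto
        show ?thesis
        proof (cases "t < real n")
          case True
          have "iter_pd ?S bs (\<lambda>x. g n x - f x) x = 0"
            unfolding gb
            by (rule iter_pd_eq_0[OF S, of "UNIV \<times> {..<real n}"])
              (use True bs y in \<open>auto simp: b_def a_def cutoff_eq_1 intro!: open_Times\<close>)
          then show ?thesis using B C by simp
        next
          case False
          define W where "W = 1 + norm x"
          have W: "W > 0" "W \<ge> real (Suc n)"
            using False norm_snd_le[of t y] by (auto simp: W_def add_pos_nonneg)
          have "norm (iter_pd ?S bs (\<lambda>x. b n x * f x) x) \<le> 2 ^ m * ((B + 1) * (C / W ^ Suc N))"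
          proof (rule norm_iter_pd_mult_le[OF S smb schwartz_smooth[OF f] bs x])
            fix as assume as: "set as \<subseteq> (Basis :: ('a \<times> real) set)" "length as \<le> m"
            show "norm (iter_pd ?S as f x) \<le> C / W ^ Suc N"
              using C(2)[OF as x] W by (simp only: W_def[symmetric] pos_le_divide_eq
                  zero_less_power mult.commute)
            have "iter_pd ?S as (b n) x = 1 * iter_pd ?S as (\<lambda>p. a n (snd p)) x + (- 1) * iter_pd
                ?S as (\<lambda>_. 1) x"
              unfolding b_def by (rule iter_pd_lincomb(2)[OF S iter_pd_snd(1)[OF K sma]
                  iter_pd_const(1)[OF S] as(1) x])
            then have "norm (iter_pd ?S as (b n) x) \<le>
                norm (iter_pd ?S as (\<lambda>p. a n (snd p)) x) + norm (iter_pd ?S as (\<lambda>_. 1) x)"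
              using norm_triangle_ineq4[of "iter_pd ?S as (\<lambda>p. a n (snd p)) x" "iter_pd ?S as (\<lambda>_.
                  1) x"] by simp
            also have "\<dots> \<le> B + 1"
            proof (rule add_mono)
              have "norm (iter_pd ?S as (\<lambda>p. a n (snd p)) (y, t)) \<le>
                  norm (iter_pd UNIV (snd_part as) (a n) t)"
                by (rule iter_pd_snd(2)[OF K sma as(1) y])
              also have "\<dots> \<le> B"
                unfolding a_def iter_pd_cutoff(2)[OF part_Basis(2)[OF as(1)]]
                using B(2)[of "length (snd_part as)"] part_Basis[OF as(1)] as(2) by (simp add:
                    norm_mult norm_power)
              finally show "norm (iter_pd ?S as (\<lambda>p. a n (snd p)) x) \<le> B" by simp
              show "norm (iter_pd ?S as (\<lambda>_. 1) x) \<le> 1"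
                unfolding iter_pd_const(2)[OF S as(1) x] by simp
            qed
            finally show "norm (iter_pd ?S as (b n) x) \<le> B + 1" .
          qed
          then have "W ^ N * norm (iter_pd ?S bs (\<lambda>x. g n x - f x) x) \<le>
              W ^ N * (2 ^ m * ((B + 1) * (C / W ^ Suc N)))"
            unfolding gb using W by (intro mult_left_mono) auto
          also have "\<dots> = 2 ^ m * ((B + 1) * C) * (1 / W)" using W by (simp add: field_simps)
          also have "\<dots> \<le> 2 ^ m * ((B + 1) * C) * (1 / real (Suc n))"
            using W B C by (intro mult_left_mono divide_left_mono) auto
          finally show ?thesis unfolding W_def .
        qed
      qed
      have lim: "(\<lambda>n. 2 ^ m * ((B + 1) * C) * (1 / real (Suc n))) \<longlonglongrightarrow> 0"
        using tendsto_mult_right_zero[OF LIMSEQ_Suc[OF lim_1_over_n]] by simp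
      have Sne: "?S \<noteq> {}" using ne by auto
      show ?thesis
        by (rule tendsto_sandwich[OF always_eventually always_eventually tendsto_const lim])
          (use schwartz_seminorm_le[OF Sne bound] in auto)
    qed
    have "(\<lambda>n. u (g n)) \<longlonglongrightarrow> u f" by (rule tempered_dist_tendsto[OF S u g f conv])
    moreover have "(\<lambda>n. u (g n)) \<longlonglongrightarrow> v f" unfolding ug by (rule tempered_dist_tendsto[OF S v g f conv])
    ultimately show ?thesis by (rule LIMSEQ_unique)
  qed
  then show ?thesis
    using u v by (intro extensionalityI[of u "schwartz ?S" v]) (auto simp: tempered_dist_def)
qed

end

section \<open>Geometry of the wedge and mollifiers\<close>

text \<open>Because \<phi> < pi, the wedge is the intersection of two half-planes; in polar form the
  second inequality says that \<rho> sin (\<phi> - \<theta>) is nonnegative. The complement is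
  therefore a union of two open half-planes.\<close>

lemma wedge_eq:
  assumes "0 < \<phi>" "\<phi> < pi"
  shows "wedge \<phi> = {y. 0 \<le> snd y \<and> 0 \<le> fst y * sin \<phi> - snd y * cos \<phi>}"
proof (intro set_eqI iffI)
  fix y assume "y \<in> wedge \<phi>"
  then obtain \<rho> \<theta> where y: "y = (\<rho> * cos \<theta>, \<rho> * sin \<theta>)" "0 \<le> \<rho>" "0 \<le> \<theta>" "\<theta> \<le> \<phi>"
    by (auto simp: wedge_def)
  have "0 \<le> \<rho> * sin \<theta>" "0 \<le> \<rho> * sin (\<phi> - \<theta>)"
    using y assms by (intro mult_nonneg_nonneg sin_ge_zero; simp)+
  then show "y \<in> {y. 0 \<le> snd y \<and> 0 \<le> fst y * sin \<phi> - snd y * cos \<phi>}"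
    using y(1) by (simp add: sin_diff algebra_simps)
next
  fix y assume *: "y \<in> {y. 0 \<le> snd y \<and> 0 \<le> fst y * sin \<phi> - snd y * cos \<phi>}"
  obtain y1 y2 where y: "y = (y1, y2)" by (cases y)
  define \<rho> where "\<rho> = sqrt (y1\<^sup>2 + y2\<^sup>2)"
  show "y \<in> wedge \<phi>"
  proof (cases "\<rho> = 0")
    case True
    then have "y1 = 0" "y2 = 0" by (auto simp: \<rho>_def sum_power2_eq_zero_iff)
    then show ?thesis using y assms by (auto simp: wedge_def intro!: exI[of _ 0])
  next
    case False
    moreover have "\<rho> \<ge> 0" by (simp add: \<rho>_def)
    ultimately have "\<rho> > 0" by linarith
    moreover have "\<rho>\<^sup>2 = y1\<^sup>2 + y2\<^sup>2" by (simp add: \<rho>_def)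
    ultimately have \<rho>: "\<rho> > 0" "\<rho>\<^sup>2 = y1\<^sup>2 + y2\<^sup>2" .
    have "\<bar>y1\<bar> \<le> \<rho>" unfolding \<rho>_def by (rule real_le_rsqrt) simp
    then have c: "- 1 \<le> y1 / \<rho>" "y1 / \<rho> \<le> 1" using \<rho>(1) by (auto simp: field_simps abs_le_iff)
    define \<theta> where "\<theta> = arccos (y1 / \<rho>)"
    have \<theta>: "0 \<le> \<theta>" "\<theta> \<le> pi" "cos \<theta> = y1 / \<rho>"
      using arccos[OF c] by (auto simp: \<theta>_def)
    have "sin \<theta> = sqrt (1 - (y1 / \<rho>)\<^sup>2)" unfolding \<theta>_def by (rule sin_arccos[OF c])
    also have "1 - (y1 / \<rho>)\<^sup>2 = (y2 / \<rho>)\<^sup>2"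
    proof -
      have "(y1 / \<rho>)\<^sup>2 + (y2 / \<rho>)\<^sup>2 = 1"
        unfolding power_divide add_divide_distrib[symmetric] \<rho>(2)[symmetric] using \<rho>(1) by simp
      then show ?thesis by simp
    qed
    also have "sqrt \<dots> = y2 / \<rho>" using * y \<rho> by simp
    finally have y': "y1 = \<rho> * cos \<theta>" "y2 = \<rho> * sin \<theta>" using \<theta> \<rho> by auto
    have "\<theta> \<le> \<phi>"
    proof (rule ccontr)
      assume "\<not> \<theta> \<le> \<phi>"
      then have "sin (\<theta> - \<phi>) > 0" using \<theta> assms by (intro sin_gt_zero) auto
      then have "\<rho> * sin (\<theta> - \<phi>) > 0" using \<rho> by simp
      moreover have "0 \<le> - (\<rho> * sin (\<theta> - \<phi>))" using * y y' by (simp add: sin_diff algebra_simps)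
      ultimately show False by simp
    qed
    moreover have "y = (\<rho> * cos \<theta>, \<rho> * sin \<theta>)" unfolding y y'[symmetric] ..
    ultimately show ?thesis using \<theta>(1) \<rho>(1) unfolding wedge_def
      by (intro CollectI exI[of "\<lambda>r. \<exists>\<theta>. y = (r * cos \<theta>, r * sin \<theta>) \<and> 0 \<le> r \<and> 0 \<le> \<theta> \<and> \<theta> \<le>
          \<phi>" \<rho>] exI[where x=\<theta>] conjI) auto
  qed
qed

lemma Q_eq:
  assumes "0 < \<phi>" "\<phi> < pi"
  shows "Q \<phi> = {y. 0 < - snd y \<or> 0 < snd y * cos \<phi> - fst y * sin \<phi>}"
  unfolding Q_def wedge_eq[OF assms] by auto

lemma open_Q:
  assumes "0 < \<phi>" "\<phi> < pi" shows "open (Q \<phi>)"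
  unfolding Q_eq[OF assms] by (intro open_Collect_disj open_Collect_less continuous_intros)

lemma closure_Q:
  assumes "0 < \<phi>" "\<phi> < pi"
  shows "closure (Q \<phi>) = {y. 0 \<le> - snd y \<or> 0 \<le> snd y * cos \<phi> - fst y * sin \<phi>}" (is "_ = ?K")
proof
  have "closed ?K" by (intro closed_Collect_disj closed_Collect_le continuous_intros)
  then show "closure (Q \<phi>) \<subseteq> ?K" by (intro closure_minimal) (auto simp: Q_eq[OF assms])
  show "?K \<subseteq> closure (Q \<phi>)"
  proof
    fix y assume *: "y \<in> ?K"
    \<comment> \<open>(0, - 1) and (- sin \<phi>, cos \<phi>) are the unit normals of the two
      half-planes; moving along either enters the open half-plane at once.\<close>
    have "\<exists>d. \<forall>t>0. y + t *\<^sub>R d \<in> Q \<phi>"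
    proof -
      show ?thesis
      proof (cases "0 \<le> - snd y")
        case True
        then show ?thesis by (intro exI[of _ "(0, - 1)"]) (auto simp: Q_eq[OF assms])
      next
        case False
        with * have b: "0 \<le> snd y * cos \<phi> - fst y * sin \<phi>" by simp
        have "0 < snd (y + t *\<^sub>R (- sin \<phi>, cos \<phi>)) * cos \<phi> - fst (y + t *\<^sub>R (- sin \<phi>,
            cos \<phi>)) * sin \<phi>" if "t > 0" for t
        proof -
          have "t * (cos \<phi> * cos \<phi>) + t * (sin \<phi> * sin \<phi>) = t"
            unfolding distrib_left[symmetric] sin_cos_squared_add3 by simp
          then show ?thesis using that b by (simp add: algebra_simps)
        qed
        then show ?thesis unfolding Q_eq[OF assms] by blast
      qed
    qed
    then obtain d where d: "\<And>t. t > 0 \<Longrightarrow> y + t *\<^sub>R d \<in> Q \<phi>" by blast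
    have "(\<lambda>n. y + (1 / real (Suc n)) *\<^sub>R d) \<longlonglongrightarrow> y + 0 *\<^sub>R d"
      by (intro tendsto_intros LIMSEQ_Suc[OF lim_1_over_n])
    then show "y \<in> closure (Q \<phi>)"
      unfolding closure_sequential using d by (intro exI[of _ "\<lambda>n. y + (1 / real (Suc n)) *\<^sub>R d"]) auto
  qed
qed

text \<open>From any point of a closed half-plane and along any line, at least one of the two
  half-lines stays inside; the sign \<sigma> picks it in whichever half-plane contains the
  point.\<close>

lemma segment_set_closure_Q:
  assumes "0 < \<phi>" "\<phi> < pi" shows "segment_set (closure (Q \<phi>))"
  unfolding segment_set_def
proof (intro ballI)
  fix x b :: "real \<times> real" assume x: "x \<in> closure (Q \<phi>)" and b: "b \<in> Basis"
  have sp: "sin \<phi> > 0" using assms by (rule sin_gt_zero)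
  have b: "b = (1, 0) \<or> b = (0, 1)" using b by (auto simp: Basis_prod_def)
  have "\<exists>\<sigma>. \<bar>\<sigma>\<bar> = 1 \<and> (\<forall>d\<in>{0..1}. x + (\<sigma> * d) *\<^sub>R b \<in> closure (Q \<phi>))"
  proof (cases "0 \<le> - snd x")
    case True
    then show ?thesis using b
      by (intro exI[of _ "- 1"]) (auto simp: closure_Q[OF assms])
  next
    case False
    then have bx: "0 \<le> snd x * cos \<phi> - fst x * sin \<phi>" using x by (simp add: closure_Q[OF assms])
    show ?thesis
    proof (cases "b = (1, 0)")
      case True
      show ?thesis
      proof (intro exI conjI ballI)
        show "\<bar>- 1 :: real\<bar> = 1" by simp
        fix d :: real assume "d \<in> {0..1}"
        then have "0 \<le> d * sin \<phi>" using sp by simp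
        then have "0 \<le> snd (x + (- 1 * d) *\<^sub>R b) * cos \<phi> - fst (x + (- 1 * d) *\<^sub>R b) * sin \<phi>"
          using bx True by (simp add: algebra_simps)
        then show "x + (- 1 * d) *\<^sub>R b \<in> closure (Q \<phi>)" unfolding closure_Q[OF assms] by blast
      qed
    next
      case False
      then have [simp]: "b = (0, 1)" using b by simp
      define \<sigma> :: real where "\<sigma> = (if cos \<phi> \<ge> 0 then 1 else - 1)"
      show ?thesis
      proof (intro exI conjI ballI)
        show "\<bar>\<sigma>\<bar> = 1" by (simp add: \<sigma>_def)
        fix d :: real assume "d \<in> {0..1}"
        then have "0 \<le> \<sigma> * d * cos \<phi>" by (auto simp: \<sigma>_def mult_nonneg_nonpos)
        then have "0 \<le> snd (x + (\<sigma> * d) *\<^sub>R b) * cos \<phi> - fst (x + (\<sigma> * d) *\<^sub>R b) * sin \<phi>"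
          using bx by (simp add: algebra_simps)
        then show "x + (\<sigma> * d) *\<^sub>R b \<in> closure (Q \<phi>)" unfolding closure_Q[OF assms] by blast
      qed
    qed
  qed
  then show "\<exists>e>0. \<exists>\<sigma>. \<bar>\<sigma>\<bar> = 1 \<and> (\<forall>d\<in>{0..e}. x + (\<sigma> * d) *\<^sub>R b \<in> closure (Q \<phi>))"
    by (intro exI[of _ 1]) auto
qed

text \<open>The jth derivative of the standard mollifier of width \<delta>:
  \<open>smooth_step (Suc 0)\<close> is the bump of mass 1, and each derivative contributes another
  1 / \<delta>.\<close>

definition mollifier :: "real \<Rightarrow> nat \<Rightarrow> real \<Rightarrow> real" where
  "mollifier \<delta> j t = smooth_step (Suc j) (t / \<delta>) / \<delta> ^ Suc j"

lemma mollifier_deriv: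
  assumes "\<delta> > 0" shows "(mollifier \<delta> j has_real_derivative mollifier \<delta> (Suc j) t) (at t)"
proof -
  have "((\<lambda>t. smooth_step (Suc j) (t / \<delta>)) has_real_derivative
      smooth_step (Suc (Suc j)) (t / \<delta>) * (1 / \<delta>)) (at t)"
    by (rule DERIV_chain2[OF smooth_step_deriv]) (use assms in \<open>auto intro!: derivative_eq_intros\<close>)
  from DERIV_cdivide[OF this, of "\<delta> ^ Suc j"] show ?thesis
    using assms by (simp add: mollifier_def[abs_def] field_simps)
qed

lemma continuous_mollifier: "\<delta> > 0 \<Longrightarrow> continuous_on A (mollifier \<delta> j)"
  using mollifier_deriv DERIV_isCont by (blast intro: continuous_at_imp_continuous_on)

lemma mollifier_eq_0: "\<delta> > 0 \<Longrightarrow> \<bar>t\<bar> \<ge> \<delta> \<Longrightarrow> mollifier \<delta> j t = 0"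
  by (simp add: mollifier_def smooth_step_Suc_eq_0)

lemma mollifier_nonneg: "\<delta> > 0 \<Longrightarrow> 0 \<le> mollifier \<delta> 0 t"
  using bump_nonneg bump_mass_pos by (simp add: mollifier_def smooth_step_Suc_0)

lemma mollifier_bounded: "\<exists>B. \<forall>t. \<bar>mollifier \<delta> j t\<bar> \<le> B"
proof -
  obtain B where "\<forall>t. \<bar>smooth_step (Suc j) t\<bar> \<le> B" using smooth_step_bounded by blast
  then have "\<bar>mollifier \<delta> j t\<bar> \<le> B / \<bar>\<delta> ^ Suc j\<bar>" for t
    unfolding mollifier_def abs_divide by (intro divide_right_mono) auto
  then show ?thesis by blast
qed

lemma has_integral_mollifier:
  assumes "\<delta> > 0" shows "has_bochner_integral lborel (\<lambda>t. mollifier \<delta> 0 (x - t)) 1"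
proof -
  have "has_bochner_integral lborel (\<lambda>t. mollifier \<delta> 0 (x - t) * indicator {x - \<delta>..x + \<delta>} t)
      (- smooth_step 0 ((x - (x + \<delta>)) / \<delta>) - - smooth_step 0 ((x - (x - \<delta>)) / \<delta>))"
  proof (rule has_bochner_integral_FTC_Icc_real)
    show "x - \<delta> \<le> x + \<delta>" using assms by simp
    show "((\<lambda>t. - smooth_step 0 ((x - t) / \<delta>)) has_real_derivative mollifier \<delta> 0 (x - t)) (at t)" for t
    proof -
      have "((\<lambda>t. smooth_step 0 ((x - t) / \<delta>)) has_real_derivative
          smooth_step (Suc 0) ((x - t) / \<delta>) * (- 1 / \<delta>)) (at t)"
        by (rule DERIV_chain2[OF smooth_step_deriv]) (use assms in \<open>auto intro!: derivative_eq_intros\<close>)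
      from DERIV_minus[OF this] show ?thesis by (simp add: mollifier_def)
    qed
    show "isCont (\<lambda>t. mollifier \<delta> 0 (x - t)) t" for t
      using continuous_on_compose2[OF continuous_mollifier[OF assms, of UNIV 0], of UNIV "\<lambda>t. x - t"]
      by (auto simp: continuous_on_eq_continuous_at intro: continuous_intros)
  qed
  moreover have "(\<lambda>t. mollifier \<delta> 0 (x - t) * indicator {x - \<delta>..x + \<delta>} t) = (\<lambda>t. mollifier \<delta> 0 (x - t))"
  proof
    fix t show "mollifier \<delta> 0 (x - t) * indicator {x - \<delta>..x + \<delta>} t = mollifier \<delta> 0 (x - t)"
      using mollifier_eq_0[OF assms, of "x - t" 0] by (cases "\<delta> \<le> \<bar>x - t\<bar>") (auto simp: indicator_def)
  qed
  ultimately show ?thesis using assms by (simp add: smooth_step_0 smooth_step_1)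
qed

text \<open>The mixed partial derivative of orders i and j of the product mollifier in the
  plane.\<close>

definition mollifier2 :: "real \<Rightarrow> nat \<Rightarrow> nat \<Rightarrow> real \<times> real \<Rightarrow> real" where
  "mollifier2 \<delta> i j z = mollifier \<delta> i (fst z) * mollifier \<delta> j (snd z)"

lemma continuous_mollifier2:
  assumes "\<delta> > 0" shows "continuous_on A (mollifier2 \<delta> i j)"
  unfolding mollifier2_def[abs_def]
  by (intro continuous_intros continuous_on_compose2[OF continuous_mollifier[OF assms, of UNIV]]) auto

lemma mollifier2_measurable [measurable]: "\<delta> > 0 \<Longrightarrow> mollifier2 \<delta> i j \<in> borel_measurable borel"
  by (intro borel_measurable_continuous_onI continuous_mollifier2)

lemma mollifier2_eq_0: "\<delta> > 0 \<Longrightarrow> norm z \<ge> 2 * \<delta> \<Longrightarrow> mollifier2 \<delta> i j z = 0"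
  using norm_Pair_le[of "fst z" "snd z"] mollifier_eq_0[of \<delta> "fst z" i] mollifier_eq_0[of \<delta> "snd z" j]
  by (cases "\<bar>fst z\<bar> \<ge> \<delta>") (auto simp: mollifier2_def)

lemma mollifier2_nonneg: "\<delta> > 0 \<Longrightarrow> 0 \<le> mollifier2 \<delta> 0 0 z"
  by (simp add: mollifier2_def mollifier_nonneg)

lemma mollifier2_bounded: "\<exists>B. \<forall>z. \<bar>mollifier2 \<delta> i j z\<bar> \<le> B"
proof -
  obtain A B where AB: "\<forall>t. \<bar>mollifier \<delta> i t\<bar> \<le> A" "\<forall>t. \<bar>mollifier \<delta> j t\<bar> \<le> B"
    using mollifier_bounded by metis
  have "0 \<le> A" using AB(1)[rule_format, of 0] by linarith
  have "\<bar>mollifier2 \<delta> i j z\<bar> \<le> A * B" for z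
    unfolding mollifier2_def abs_mult using AB \<open>0 \<le> A\<close> by (intro mult_mono) auto
  then show ?thesis by blast
qed

lemma has_bochner_integral_lborel_product:
  fixes f g :: "real \<Rightarrow> real"
  assumes "has_bochner_integral lborel f a" "has_bochner_integral lborel g b"
  shows "has_bochner_integral lborel (\<lambda>z. f (fst z) * g (snd z)) (a * b)"
proof -
  have f: "integrable lborel f" "integral\<^sup>L lborel f =
      a" and g: "integrable lborel g" "integral\<^sup>L lborel g = b"
    using assms by (simp_all add: has_bochner_integral_iff)
  have [measurable]: "f \<in> borel_measurable borel" "g \<in> borel_measurable borel"
    using f(1) g(1) by auto
  have int: "integrable (lborel \<Otimes>\<^sub>M lborel) (\<lambda>z. f (fst z) * g (snd z))"
    by (rule lborel_pair.Fubini_integrable) (use f g in \<open>auto simp: abs_mult\<close>)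
  have "integral\<^sup>L (lborel \<Otimes>\<^sub>M lborel) (\<lambda>z. f (fst z) * g (snd z)) =
      (\<integral>x. (\<integral>y. f x * g y \<partial>lborel) \<partial>lborel)"
    using lborel_pair.integral_fst'[OF int] by simp
  also have "\<dots> = a * b" using f g by simp
  finally show ?thesis using int by (simp add: has_bochner_integral_iff lborel_prod)
qed

lemma has_integral_mollifier2:
  assumes "\<delta> > 0" shows "has_bochner_integral lborel (\<lambda>y. mollifier2 \<delta> 0 0 (x - y)) 1"
  using has_bochner_integral_lborel_product[OF has_integral_mollifier[OF assms,
      of "fst x"] has_integral_mollifier[OF assms, of "snd x"]]
  by (simp add: mollifier2_def)

lemma mollifier2_test_function:
  assumes "\<delta> > 0"
  shows "smooth_within UNIV (\<lambda>y. complex_of_real (mollifier2 \<delta> 0 0 (x - y)))"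
    and "laplacian (\<lambda>y. complex_of_real (mollifier2 \<delta> 0 0 (x - y))) y =
        of_real (mollifier2 \<delta> 2 0 (x - y) + mollifier2 \<delta> 0 2 (x - y))"
proof -
  \<comment> \<open>As a function of the subtracted variable each derivative brings a sign; in the
    Laplacian the two signs cancel.\<close>
  let ?F = "\<lambda>c n t. complex_of_real ((- 1) ^ n * mollifier \<delta> n (c - t))"
  have D: "(?F c n has_vector_derivative ?F c (Suc n) t) (at t)" for c n t
  proof -
    have "((\<lambda>t. mollifier \<delta> n (c - t)) has_real_derivative mollifier \<delta> (Suc n) (c - t) * (- 1)) (at t)"
      by (rule DERIV_chain2[OF mollifier_deriv[OF assms]]) (auto intro!: derivative_eq_intros)
    from DERIV_cmult[OF this, of "(- 1) ^ n"] show ?thesis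
      by (intro has_vector_derivative_of_real) (simp add: has_real_derivative_iff_has_vector_derivative)
  qed
  have F1: "smooth_within UNIV (?F c 0)" for c by (rule iter_pd_real(1)[of "?F c", OF D])
  have F2: "iter_pd UNIV bs (?F c 0) t = ?F c (length bs) t" if "set bs \<subseteq> Basis" for c bs t
    by (rule iter_pd_real(2)[of "?F c", OF D that])
  have eq: "(\<lambda>y. complex_of_real (mollifier2 \<delta> 0 0 (x - y))) = (\<lambda>(y1,
      y2). ?F (fst x) 0 y1 * ?F (snd x) 0 y2)"
    by (auto simp: mollifier2_def fun_eq_iff)
  note T = iter_pd_tensor[OF segment_set_UNIV segment_set_UNIV F1[of "fst x"] F1[of "snd x"],
      folded eq, unfolded UNIV_Times_UNIV]
  show "smooth_within UNIV (\<lambda>y. complex_of_real (mollifier2 \<delta> 0 0 (x - y)))" by (rule T(1))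
  obtain y1 y2 where y: "y = (y1, y2)" by (cases y)
  have B: "(Basis :: (real \<times> real) set) = {(1, 0), (0, 1)}" by (auto simp: Basis_prod_def)
  show "laplacian (\<lambda>y. complex_of_real (mollifier2 \<delta> 0 0 (x - y))) y =
      of_real (mollifier2 \<delta> 2 0 (x - y) + mollifier2 \<delta> 0 2 (x - y))"
    unfolding laplacian_def B y
    using T(2)[of "[(1, 0), (1, 0)]" y1 y2] T(2)[of "[(0, 1), (0,
        1)]" y1 y2] F2[of "[1,1]" "fst x" y1] F2[of "[1,1]" "snd x" y2]
    by (simp add: B mollifier2_def del: iter_pd.simps(2)) (simp add: numeral_2_eq_2)
qed

section \<open>Integration by parts and convolution\<close>

lemma integrable_continuous_compact_support:
  fixes f :: "'a::euclidean_space \<Rightarrow> real"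
  assumes "continuous_on UNIV f" "compact C" "\<And>p. p \<notin> C \<Longrightarrow> f p = 0"
  shows "integrable lborel f"
proof -
  have "integrable lborel (\<lambda>x. indicator C x *\<^sub>R f x)"
    by (rule borel_integrable_compact[OF assms(2) continuous_on_subset[OF assms(1) subset_UNIV]])
  moreover have "(\<lambda>x. indicator C x *\<^sub>R f x) = f" using assms(3) by (auto simp: indicator_def fun_eq_iff)
  ultimately show ?thesis by simp
qed

lemma integral_real_derivative_eq_0:
  fixes F :: "real \<Rightarrow> real"
  assumes "\<And>x. (F has_real_derivative F' x) (at x)" "continuous_on UNIV F'"
    and "\<And>x. \<bar>x\<bar> > R \<Longrightarrow> F x = 0" "\<And>x. \<bar>x\<bar> > R \<Longrightarrow> F' x = 0"
  shows "(\<integral>x. F' x \<partial>lborel) = 0"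
proof -
  let ?r = "\<bar>R\<bar> + 1"
  have "(\<integral>x. F' x * indicator {- ?r..?r} x \<partial>lborel) = F ?r - F (- ?r)"
    by (rule integral_FTC_Icc_real) (use assms in \<open>auto simp: continuous_on_eq_continuous_at\<close>)
  moreover have "(\<lambda>x. F' x * indicator {- ?r..?r} x) = F'"
  proof
    fix x show "F' x * indicator {- ?r..?r} x = F' x"
      using assms(4)[of x] by (cases "\<bar>x\<bar> > R") (auto simp: indicator_def)
  qed
  ultimately show ?thesis using assms(3) by simp
qed

lemma integral_partial_fst_eq_0:
  fixes F F' :: "real \<times> real \<Rightarrow> real"
  assumes d: "\<And>x y. ((\<lambda>t. F (t, y)) has_real_derivative F' (x,
      y)) (at x)" and cont: "continuous_on UNIV F'"
    and C: "compact C" and z: "\<And>p. p \<notin> C \<Longrightarrow> F p = 0" "\<And>p. p \<notin> C \<Longrightarrow> F' p = 0"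
  shows "(\<integral>p. F' p \<partial>lborel) = 0"
proof -
  obtain R where R: "\<And>p. p \<in> C \<Longrightarrow> norm p \<le> R" using compact_imp_bounded[OF C] by (auto simp: bounded_iff)
  have out: "(x, y) \<notin> C" if "\<bar>x\<bar> > R" for x y using R[of "(x, y)"] norm_fst_le[of x y] that by force
  have "integrable lborel F'" by (rule integrable_continuous_compact_support[OF cont C z(2)])
  then have int: "integrable (lborel \<Otimes>\<^sub>M lborel) (case_prod (\<lambda>x y. F' (x,
      y)))" by (simp add: lborel_prod)
  have inner: "(\<integral>x. F' (x, y) \<partial>lborel) = 0" for y
    by (rule integral_real_derivative_eq_0[where F="\<lambda>x. F (x, y)" and R=R])
      (use d out z in \<open>auto intro!: continuous_on_compose2[OF cont] continuous_intros\<close>)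
  show ?thesis using lborel_pair.integral_snd[OF int] inner by (simp add: lborel_prod)
qed

lemma integral_partial_snd_eq_0:
  fixes F F' :: "real \<times> real \<Rightarrow> real"
  assumes d: "\<And>x y. ((\<lambda>t. F (x, t)) has_real_derivative F' (x,
      y)) (at y)" and cont: "continuous_on UNIV F'"
    and C: "compact C" and z: "\<And>p. p \<notin> C \<Longrightarrow> F p = 0" "\<And>p. p \<notin> C \<Longrightarrow> F' p = 0"
  shows "(\<integral>p. F' p \<partial>lborel) = 0"
proof -
  obtain R where R: "\<And>p. p \<in> C \<Longrightarrow> norm p \<le> R" using compact_imp_bounded[OF C] by (auto simp: bounded_iff)
  have out: "(x, y) \<notin> C" if "\<bar>y\<bar> > R" for x y using R[of "(x, y)"] norm_snd_le[of y x] that by force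
  have "integrable lborel F'" by (rule integrable_continuous_compact_support[OF cont C z(2)])
  then have int: "integrable (lborel \<Otimes>\<^sub>M lborel) (case_prod (\<lambda>x y. F' (x,
      y)))" by (simp add: lborel_prod)
  have inner: "(\<integral>y. F' (x, y) \<partial>lborel) = 0" for x
    by (rule integral_real_derivative_eq_0[where F="\<lambda>y. F (x, y)" and R=R])
      (use d out z in \<open>auto intro!: continuous_on_compose2[OF cont] continuous_intros\<close>)
  show ?thesis using lborel_pair.integral_fst[OF int] inner by (simp add: lborel_prod)
qed

text \<open>Fubini applies because a bounded kernel leaves |A x| |B y| as a majorant on the product
  space.\<close>

lemma integral_convolution_swap:
  fixes A B r :: "'a::euclidean_space \<Rightarrow> real"
  assumes A: "integrable lborel A" and B: "integrable lborel B"
    and r[measurable]: "r \<in> borel_measurable borel" and bd: "\<And>z. \<bar>r z\<bar> \<le> c"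
  shows "(\<integral>x. A x * (\<integral>y. B y * r (x - y) \<partial>lborel) \<partial>lborel) =
      (\<integral>y. B y * (\<integral>x. A x * r (x - y) \<partial>lborel) \<partial>lborel)"
proof -
  have [measurable]: "A \<in> borel_measurable borel" "B \<in> borel_measurable borel" using A B by auto
  have AB: "integrable (lborel \<Otimes>\<^sub>M lborel) (\<lambda>(x, y). A x * B y)"
  proof (rule lborel_pair.Fubini_integrable)
    show "integrable lborel (\<lambda>x. \<integral>y. norm (case (x, y) of (x, y) \<Rightarrow> A x * B y) \<partial>lborel)"
      using A by (simp add: abs_mult)
  qed (use B in auto)
  have "integrable (lborel \<Otimes>\<^sub>M lborel) (\<lambda>(x, y). A x * (B y * r (x - y)))"
  proof (rule Bochner_Integration.integrable_bound[OF integrable_mult_right[OF AB, of c]])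
    show "AE z in lborel \<Otimes>\<^sub>M lborel. norm (case z of (x, y) \<Rightarrow> A x * (B y * r (x - y))) \<le>
        norm (c * (case z of (x, y) \<Rightarrow> A x * B y))"
    proof (intro always_eventually allI)
      fix z :: "'a \<times> 'a" obtain x y where [simp]: "z = (x, y)" by (cases z)
      have "\<bar>A x * B y\<bar> * \<bar>r (x - y)\<bar> \<le> \<bar>A x * B y\<bar> * \<bar>c\<bar>"
        using bd[of "x - y"] by (intro mult_left_mono) auto
      then show "norm (case z of (x, y) \<Rightarrow> A x * (B y * r (x - y))) \<le> norm (c * (case z of (x,
          y) \<Rightarrow> A x * B y))"
        by (simp add: abs_mult mult_ac)
    qed
  qed simp
  from lborel_pair.Fubini_integral[OF this]
  have "(\<integral>x. (\<integral>y. A x * (B y * r (x - y)) \<partial>lborel) \<partial>lborel) =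
      (\<integral>y. (\<integral>x. A x * (B y * r (x - y)) \<partial>lborel) \<partial>lborel)" ..
  moreover have "(\<integral>y. A x * (B y * r (x - y)) \<partial>lborel) =
      A x * (\<integral>y. B y * r (x - y) \<partial>lborel)" for x by simp
  moreover have "(\<integral>x. A x * (B y * r (x - y)) \<partial>lborel) = B y * (\<integral>x. A x * r (x - y) \<partial>lborel)" for y
    by (subst mult.left_commute) simp
  ultimately show ?thesis by simp
qed

text \<open>Dominated convergence in x needs the limit only where A is nonzero. B may thus jump
  elsewhere, as it will when cut to a compact set by an indicator.\<close>

lemma mollifier2_approx_identity:
  fixes A B :: "real \<times> real \<Rightarrow> real"
  assumes A: "integrable lborel A" and B[measurable]: "B \<in> borel_measurable borel" and bd: "\<And>y. \<bar>B
      y\<bar> \<le> c"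
    and cont: "\<And>x. A x \<noteq> 0 \<Longrightarrow> isCont B x"
    and \<delta>: "\<And>n. \<delta> n > 0" "\<delta> \<longlonglongrightarrow> 0"
  shows "(\<lambda>n. \<integral>x. A x * (\<integral>y. B y * mollifier2 (\<delta> n) 0 0 (x - y) \<partial>lborel) \<partial>lborel) \<longlonglongrightarrow>
      (\<integral>x. A x * B x \<partial>lborel)"
proof -
  have [measurable]: "A \<in> borel_measurable borel" using A by auto
  have [measurable]: "mollifier2 (\<delta> n) 0 0 \<in> borel_measurable borel" for n using \<delta>(1) by measurable
  have R: "integrable lborel (\<lambda>y. mollifier2 (\<delta> n) 0 0 (x - y))" "(\<integral>y. mollifier2 (\<delta> n) 0 0 (x - y)
      \<partial>lborel) = 1" for n x
    using has_integral_mollifier2[OF \<delta>(1)[of n], of x] by (auto simp: has_bochner_integral_iff)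
  have iB: "integrable lborel (\<lambda>y. B y * mollifier2 (\<delta> n) 0 0 (x - y))" for n x
  proof (rule Bochner_Integration.integrable_bound[OF integrable_mult_right[OF R(1), of c]])
    show "AE y in lborel. norm (B y * mollifier2 (\<delta> n) 0 0 (x - y)) \<le>
        norm (c * mollifier2 (\<delta> n) 0 0 (x - y))"
      using bd by (auto simp: abs_mult intro!: always_eventually mult_right_mono order_trans[OF bd])
  qed simp
  show ?thesis
  proof (rule integral_dominated_convergence[where w="\<lambda>x. c * \<bar>A x\<bar>"])
    show "integrable lborel (\<lambda>x. c * \<bar>A x\<bar>)" using A by simp
    show "AE x in lborel. norm (A x * (\<integral>y. B y * mollifier2 (\<delta> n) 0 0 (x - y) \<partial>lborel)) \<le>
        c * \<bar>A x\<bar>" for n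
    proof (intro always_eventually allI)
      fix x
      have "\<bar>\<integral>y. B y * mollifier2 (\<delta> n) 0 0 (x - y) \<partial>lborel\<bar> \<le>
          (\<integral>y. c * mollifier2 (\<delta> n) 0 0 (x - y) \<partial>lborel)"
      proof (rule integral_abs_bound_integral[OF iB])
        fix y
        show "\<bar>B y * mollifier2 (\<delta> n) 0 0 (x - y)\<bar> \<le> c * mollifier2 (\<delta> n) 0 0 (x - y)"
          unfolding abs_mult abs_of_nonneg[OF mollifier2_nonneg[OF \<delta>(1)]]
          by (intro mult_right_mono bd mollifier2_nonneg \<delta>(1))
      qed (use R in auto)
      also have "\<dots> = c" using R by simp
      finally have "\<bar>A x\<bar> * \<bar>\<integral>y. B y * mollifier2 (\<delta> n) 0 0 (x - y) \<partial>lborel\<bar> \<le> \<bar>A x\<bar> * c"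
        by (intro mult_left_mono) auto
      then show "norm (A x * (\<integral>y. B y * mollifier2 (\<delta> n) 0 0 (x - y) \<partial>lborel)) \<le> c * \<bar>A x\<bar>"
        unfolding real_norm_def abs_mult by (simp only: mult.commute[of c])
    qed
    show "AE x in lborel. (\<lambda>n. A x * (\<integral>y. B y * mollifier2 (\<delta> n) 0 0 (x - y) \<partial>lborel)) \<longlonglongrightarrow> A x * B x"
    proof (intro always_eventually allI)
      fix x
      show "(\<lambda>n. A x * (\<integral>y. B y * mollifier2 (\<delta> n) 0 0 (x - y) \<partial>lborel)) \<longlonglongrightarrow> A x * B x"
      proof (cases "A x = 0")
        case False
        have "(\<lambda>n. \<integral>y. B y * mollifier2 (\<delta> n) 0 0 (x - y) \<partial>lborel) \<longlonglongrightarrow> B x"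
        proof (rule LIMSEQ_I)
          fix e :: real assume e: "e > 0"
          obtain d where d: "d > 0" "\<And>y. dist y x < d \<Longrightarrow> dist (B y) (B x) < e / 2"
            using cont[OF False] e unfolding continuous_at_eps_delta by (metis half_gt_zero)
          obtain N where N: "\<And>n. n \<ge> N \<Longrightarrow> \<delta> n < d / 2"
            using order_tendstoD(2)[OF \<delta>(2), of "d / 2"] d(1) by (auto simp: eventually_sequentially)
          have "norm ((\<integral>y. B y * mollifier2 (\<delta> n) 0 0 (x - y) \<partial>lborel) - B x) < e" if n: "n \<ge> N" for n
          proof -
            have "(\<integral>y. B y * mollifier2 (\<delta> n) 0 0 (x - y) \<partial>lborel) - B x =
                (\<integral>y. B y * mollifier2 (\<delta> n) 0 0 (x - y) - B x * mollifier2 (\<delta> n) 0 0 (x - y) \<partial>lborel)"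
              using iB R by simp
            also have "\<bar>\<dots>\<bar> \<le> (\<integral>y. (e / 2) * mollifier2 (\<delta> n) 0 0 (x - y) \<partial>lborel)"
            proof (rule integral_abs_bound_integral)
              fix y
              show "\<bar>B y * mollifier2 (\<delta> n) 0 0 (x - y) - B x * mollifier2 (\<delta> n) 0 0 (x - y)\<bar> \<le>
                  e / 2 * mollifier2 (\<delta> n) 0 0 (x - y)"
              proof (cases "norm (x - y) < d")
                case True
                then have "\<bar>B y - B x\<bar> \<le> e / 2" using d(2)[of y] by (simp add: dist_norm
                    norm_minus_commute)
                then show ?thesis
                  unfolding left_diff_distrib[symmetric] abs_mult abs_of_nonneg[OF
                      mollifier2_nonneg[OF \<delta>(1)]]
                  by (intro mult_right_mono mollifier2_nonneg \<delta>(1))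
              next
                case False
                then have "mollifier2 (\<delta> n) 0 0 (x - y) =
                    0" using N[OF n] by (intro mollifier2_eq_0 \<delta>) auto
                then show ?thesis by simp
              qed
            qed (use iB R in auto)
            also have "\<dots> = e / 2" using R by simp
            finally show ?thesis using e by simp
          qed
          then show "\<exists>N. \<forall>n\<ge>N. norm ((\<integral>y. B y * mollifier2 (\<delta> n) 0 0 (x - y) \<partial>lborel) - B x) < e"
              by blast
        qed
        then show ?thesis by (intro tendsto_intros)
      qed simp
    qed
  qed measurable
qed

lemma continuous_on_extend_by_0:
  assumes U: "open U" and C: "compact C" "C \<subseteq> U" and f: "continuous_on U f" and z: "\<And>p. p \<in> U \<Longrightarrow>
      p \<notin> C \<Longrightarrow> f p = (0::real)"
  shows "continuous_on UNIV (\<lambda>p::'a::euclidean_space. if p \<in> U then f p else 0)"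
proof -
  have "continuous_on U (\<lambda>p. if p \<in> U then f p else 0)"
    using f by (rule continuous_on_eq) simp
  moreover have "continuous_on (- C) (\<lambda>p. if p \<in> U then f p else 0)"
    by (rule continuous_on_eq[of _ "\<lambda>_. 0"]) (use z in auto)
  ultimately have "continuous_on (U \<union> - C) (\<lambda>p. if p \<in> U then f p else 0)"
    using U C by (intro continuous_on_open_Un) (auto intro: compact_imp_closed)
  moreover have "U \<union> - C = UNIV" using C by blast
  ultimately show ?thesis by simp
qed

section \<open>The energy identity\<close>

text \<open>Turns integrands known on U into functions on the whole plane, so that Fubini can be
  applied in full coordinate lines.\<close>

definition extend0 :: "'a set \<Rightarrow> ('a \<Rightarrow> real) \<Rightarrow> 'a \<Rightarrow> real" where
  "extend0 U f p = (if p \<in> U then f p else 0)"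

text \<open>U and the complement of C are open and cover the plane; on the second the extension is
  identically 0.\<close>

lemma extend0_partial_fst:
  fixes f f1 :: "real \<times> real \<Rightarrow> real"
  assumes U: "open U" and C: "compact C" "C \<subseteq> U"
    and d: "\<And>x y. (x, y) \<in> U \<Longrightarrow> ((\<lambda>t. f (t, y)) has_real_derivative f1 (x, y)) (at x)"
    and z: "\<And>p. p \<in> U \<Longrightarrow> p \<notin> C \<Longrightarrow> f p = 0" "\<And>p. p \<in> U \<Longrightarrow> p \<notin> C \<Longrightarrow> f1 p = 0"
  shows "((\<lambda>t. extend0 U f (t, y)) has_real_derivative extend0 U f1 (x, y)) (at x)"
proof (cases "(x, y) \<in> U")
  case True
  have "open ((\<lambda>t. (t, y)) -` U)" using U by (intro open_vimage continuous_intros)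
  then show ?thesis
    using has_field_derivative_transform_within_open[OF d[OF True], of "(\<lambda>t. (t,
        y)) -` U" "\<lambda>t. extend0 U f (t, y)"] True
    by (simp add: extend0_def)
next
  case False
  have op: "open ((\<lambda>t. (t, y)) -` (- C))" using C by (intro open_vimage continuous_intros) (simp
      add: compact_imp_closed)
  have "((\<lambda>_. 0) has_real_derivative 0) (at x)" by simp
  then have "((\<lambda>t. extend0 U f (t, y)) has_real_derivative 0) (at x)"
    by (rule has_field_derivative_transform_within_open[OF _ op])
      (use False z C in \<open>auto simp: extend0_def\<close>)
  then show ?thesis using False by (simp add: extend0_def)
qed

lemma extend0_partial_snd:
  fixes f f1 :: "real \<times> real \<Rightarrow> real"
  assumes U: "open U" and C: "compact C" "C \<subseteq> U"
    and d: "\<And>x y. (x, y) \<in> U \<Longrightarrow> ((\<lambda>t. f (x, t)) has_real_derivative f1 (x, y)) (at y)"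
    and z: "\<And>p. p \<in> U \<Longrightarrow> p \<notin> C \<Longrightarrow> f p = 0" "\<And>p. p \<in> U \<Longrightarrow> p \<notin> C \<Longrightarrow> f1 p = 0"
  shows "((\<lambda>t. extend0 U f (x, t)) has_real_derivative extend0 U f1 (x, y)) (at y)"
proof (cases "(x, y) \<in> U")
  case True
  have "open ((\<lambda>t. (x, t)) -` U)" using U by (intro open_vimage continuous_intros)
  then show ?thesis
    using has_field_derivative_transform_within_open[OF d[OF True], of "(\<lambda>t. (x,
        t)) -` U" "\<lambda>t. extend0 U f (x, t)"] True
    by (simp add: extend0_def)
next
  case False
  have op: "open ((\<lambda>t. (x, t)) -` (- C))" using C by (intro open_vimage continuous_intros) (simp
      add: compact_imp_closed)
  have "((\<lambda>_. 0) has_real_derivative 0) (at y)" by simp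
  then have "((\<lambda>t. extend0 U f (x, t)) has_real_derivative 0) (at y)"
    by (rule has_field_derivative_transform_within_open[OF _ op])
      (use False z C in \<open>auto simp: extend0_def\<close>)
  then show ?thesis using False by (simp add: extend0_def)
qed

lemma extend0_continuous:
  fixes f :: "'a::euclidean_space \<Rightarrow> real"
  assumes "open U" "compact C" "C \<subseteq> U" "continuous_on U f" "\<And>p. p \<in> U \<Longrightarrow> p \<notin> C \<Longrightarrow> f p = 0"
  shows "continuous_on UNIV (extend0 U f)"
  using continuous_on_extend_by_0[OF assms] by (simp add: extend0_def[abs_def])

lemma extend0_integrable:
  fixes f :: "'a::euclidean_space \<Rightarrow> real"
  assumes "open U" "compact C" "C \<subseteq> U" "continuous_on U f" "\<And>p. p \<in> U \<Longrightarrow> p \<notin> C \<Longrightarrow> f p = 0"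
  shows "integrable lborel (extend0 U f)"
  by (rule integrable_continuous_compact_support[OF extend0_continuous[OF assms] assms(2)])
    (use assms in \<open>auto simp: extend0_def\<close>)

lemma extend0_add: "extend0 U (\<lambda>p. f p + g p) = (\<lambda>p. extend0 U f p + extend0 U g p)"
  by (auto simp: extend0_def)

lemma mollifier2_partial:
  assumes "\<delta> > 0"
  shows "((\<lambda>t. mollifier2 \<delta> i j (x - (t, y2))) has_real_derivative
      - mollifier2 \<delta> (Suc i) j (x - (y1, y2))) (at y1)"
    and "((\<lambda>t. mollifier2 \<delta> i j (x - (y1, t))) has_real_derivative
        - mollifier2 \<delta> i (Suc j) (x - (y1, y2))) (at y2)"
    and "((\<lambda>t. mollifier2 \<delta> i j ((t, y2) - x)) has_real_derivative mollifier2 \<delta> (Suc i) j ((y1,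
        y2) - x)) (at y1)"
    and "((\<lambda>t. mollifier2 \<delta> i j ((y1, t) - x)) has_real_derivative mollifier2 \<delta> i (Suc j) ((y1,
        y2) - x)) (at y2)"
proof -
  have 1: "((\<lambda>t. mollifier \<delta> n (c - t)) has_real_derivative
      mollifier \<delta> (Suc n) (c - t) * (- 1)) (at t)" for n c t
    by (rule DERIV_chain2[OF mollifier_deriv[OF assms]]) (auto intro!: derivative_eq_intros)
  have 2: "((\<lambda>t. mollifier \<delta> n (t - c)) has_real_derivative
      mollifier \<delta> (Suc n) (t - c) * 1) (at t)" for n c t
    by (rule DERIV_chain2[OF mollifier_deriv[OF assms]]) (auto intro!: derivative_eq_intros)
  show "((\<lambda>t. mollifier2 \<delta> i j (x - (t, y2))) has_real_derivative
      - mollifier2 \<delta> (Suc i) j (x - (y1, y2))) (at y1)"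
    using DERIV_cmult_right[OF 1[of i "fst x" y1],
        of "mollifier \<delta> j (snd x - y2)"] by (simp add: mollifier2_def)
  show "((\<lambda>t. mollifier2 \<delta> i j (x - (y1, t))) has_real_derivative
      - mollifier2 \<delta> i (Suc j) (x - (y1, y2))) (at y2)"
    using DERIV_cmult[OF 1[of j "snd x" y2], of "mollifier \<delta> i (fst x - y1)"] by (simp add:
        mollifier2_def)
  show "((\<lambda>t. mollifier2 \<delta> i j ((t, y2) - x)) has_real_derivative mollifier2 \<delta> (Suc i) j ((y1,
      y2) - x)) (at y1)"
    using DERIV_cmult_right[OF 2[of i "fst x" y1],
        of "mollifier \<delta> j (y2 - snd x)"] by (simp add: mollifier2_def)
  show "((\<lambda>t. mollifier2 \<delta> i j ((y1, t) - x)) has_real_derivative mollifier2 \<delta> i (Suc j) ((y1,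
      y2) - x)) (at y2)"
    using DERIV_cmult[OF 2[of j "snd x" y2], of "mollifier \<delta> i (y1 - fst x)"] by (simp add:
        mollifier2_def)
qed

lemma continuous_mollifier2_shift:
  assumes "\<delta> > 0"
  shows "continuous_on A (\<lambda>y. mollifier2 \<delta> i j (x - y))" "continuous_on A (\<lambda>y. mollifier2 \<delta> i j (y - x))"
  by (rule continuous_on_compose2[OF continuous_mollifier2[OF assms,
      of UNIV]]; auto intro!: continuous_intros)+

text \<open>The real form of the equation at \<open>\<i> * s\<close>. The partial derivatives are
  given as separate functions because w is only once differentiable, and L names the Laplacian of
  the real test function.\<close>

locale weak_helmholtz =
  fixes U :: "(real \<times> real) set" and s :: real and w w1 w2 :: "real \<times> real \<Rightarrow> real"
  assumes U: "open U"
    and w_cont: "continuous_on U w" and w1_cont: "continuous_on U w1" and w2_cont: "continuous_on U w2"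
    and w_deriv: "\<And>x y. (x, y) \<in> U \<Longrightarrow> ((\<lambda>t. w (t, y)) has_real_derivative w1 (x, y)) (at x)"
      "\<And>x y. (x, y) \<in> U \<Longrightarrow> ((\<lambda>t. w (x, t)) has_real_derivative w2 (x, y)) (at y)"
    and weak: "\<And>\<psi> L. smooth_within UNIV (\<lambda>y. complex_of_real (\<psi> y)) \<Longrightarrow> compact (closure {y. \<psi> y \<noteq> 0}) \<Longrightarrow>
      closure {y. \<psi> y \<noteq> 0} \<subseteq> U \<Longrightarrow> (\<And>y. laplacian (\<lambda>y. complex_of_real (\<psi> y)) y = of_real (L y)) \<Longrightarrow>
      (\<integral>y. extend0 U (\<lambda>y. w y * (s\<^sup>2 * \<psi> y - L y)) y \<partial>lborel) = 0"
begin

text \<open>No boundary term arises: w h has compact support in U, so its derivative integrates to 0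
  over each line.\<close>

lemma by_parts_fst:
  assumes C: "compact C" "C \<subseteq> U"
    and d: "\<And>x y. (x, y) \<in> U \<Longrightarrow> ((\<lambda>t. h (t, y)) has_real_derivative h1 (x, y)) (at x)"
    and c: "continuous_on U h" "continuous_on U h1"
    and z: "\<And>p. p \<in> U \<Longrightarrow> p \<notin> C \<Longrightarrow> h p = 0" "\<And>p. p \<in> U \<Longrightarrow> p \<notin> C \<Longrightarrow> h1 p = 0"
  shows "(\<integral>p. extend0 U (\<lambda>p. w p * h1 p) p \<partial>lborel) = - (\<integral>p. extend0 U (\<lambda>p. w1 p * h p) p \<partial>lborel)"
proof -
  have "(\<integral>p. extend0 U (\<lambda>p. w p * h1 p + w1 p * h p) p \<partial>lborel) = 0"
  proof (rule integral_partial_fst_eq_0[where F="extend0 U (\<lambda>p. w p * h p)" and C=C])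
    show "((\<lambda>t. extend0 U (\<lambda>p. w p * h p) (t, y)) has_real_derivative
        extend0 U (\<lambda>p. w p * h1 p + w1 p * h p) (x, y)) (at x)" for x y
      by (rule extend0_partial_fst[OF U C]) (use DERIV_mult'[OF w_deriv(1) d] z in \<open>auto simp:
          add.commute\<close>)
    show "continuous_on UNIV (extend0 U (\<lambda>p. w p * h1 p + w1 p * h p))"
      by (rule extend0_continuous[OF U C]) (use z in \<open>auto intro!: continuous_intros w_cont w1_cont c\<close>)
  qed (use C z in \<open>auto simp: extend0_def\<close>)
  moreover have "integrable lborel (extend0 U (\<lambda>p. w p * h1 p))" "integrable lborel (extend0 U (\<lambda>p.
      w1 p * h p))"
    by (rule extend0_integrable[OF U C]; use z in \<open>auto intro!: continuous_intros w_cont w1_cont c\<close>)+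
  ultimately show ?thesis by (simp add: extend0_add)
qed

lemma by_parts_snd:
  assumes C: "compact C" "C \<subseteq> U"
    and d: "\<And>x y. (x, y) \<in> U \<Longrightarrow> ((\<lambda>t. h (x, t)) has_real_derivative h1 (x, y)) (at y)"
    and c: "continuous_on U h" "continuous_on U h1"
    and z: "\<And>p. p \<in> U \<Longrightarrow> p \<notin> C \<Longrightarrow> h p = 0" "\<And>p. p \<in> U \<Longrightarrow> p \<notin> C \<Longrightarrow> h1 p = 0"
  shows "(\<integral>p. extend0 U (\<lambda>p. w p * h1 p) p \<partial>lborel) = - (\<integral>p. extend0 U (\<lambda>p. w2 p * h p) p \<partial>lborel)"
proof -
  have "(\<integral>p. extend0 U (\<lambda>p. w p * h1 p + w2 p * h p) p \<partial>lborel) = 0"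
  proof (rule integral_partial_snd_eq_0[where F="extend0 U (\<lambda>p. w p * h p)" and C=C])
    show "((\<lambda>t. extend0 U (\<lambda>p. w p * h p) (x, t)) has_real_derivative
        extend0 U (\<lambda>p. w p * h1 p + w2 p * h p) (x, y)) (at y)" for x y
      by (rule extend0_partial_snd[OF U C]) (use DERIV_mult'[OF w_deriv(2) d] z in \<open>auto simp:
          add.commute\<close>)
    show "continuous_on UNIV (extend0 U (\<lambda>p. w p * h1 p + w2 p * h p))"
      by (rule extend0_continuous[OF U C]) (use z in \<open>auto intro!: continuous_intros w_cont w2_cont c\<close>)
  qed (use C z in \<open>auto simp: extend0_def\<close>)
  moreover have "integrable lborel (extend0 U (\<lambda>p. w p * h1 p))" "integrable lborel (extend0 U (\<lambda>p.
      w2 p * h p))"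
    by (rule extend0_integrable[OF U C]; use z in \<open>auto intro!: continuous_intros w_cont w2_cont c\<close>)+
  ultimately show ?thesis by (simp add: extend0_add)
qed

text \<open>The test function is the mollifier centred at x. One of its two derivatives is moved
  onto w, which has no second one to offer; the signs from x - y and from the integration by parts
  cancel against the minus sign of the Laplacian.\<close>

lemma mollified_equation:
  assumes \<delta>: "\<delta> > 0" and x: "cball x (2 * \<delta>) \<subseteq> U"
  shows "s\<^sup>2 * (\<integral>y. extend0 U (\<lambda>y. w y * mollifier2 \<delta> 0 0 (x - y)) y \<partial>lborel) =
    (\<integral>y. extend0 U (\<lambda>y. w1 y * mollifier2 \<delta> 1 0 (x - y)) y \<partial>lborel) +
    (\<integral>y. extend0 U (\<lambda>y. w2 y * mollifier2 \<delta> 0 1 (x - y)) y \<partial>lborel)"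
proof -
  let ?R = "\<lambda>i j y. mollifier2 \<delta> i j (x - y)"
  have C: "compact (cball x (2 * \<delta>))" by simp
  have z: "?R i j y = 0" if "y \<notin> cball x (2 * \<delta>)" for i j y
    using that by (intro mollifier2_eq_0 \<delta>) (auto simp: dist_norm)
  note c = continuous_mollifier2_shift[OF \<delta>]
  have sub: "closure {y. ?R 0 0 y \<noteq> 0} \<subseteq> cball x (2 * \<delta>)"
  proof (rule closure_minimal)
    show "{y. ?R 0 0 y \<noteq> 0} \<subseteq> cball x (2 * \<delta>)" using z by blast
  qed simp
  then have cpt: "compact (closure {y. ?R 0 0 y \<noteq> 0})"
    using compact_Int_closed[OF C closed_closure[of "{y. ?R 0 0 y \<noteq> 0}"]] by (simp add: Int_absorb1)
  have i: "integrable lborel (extend0 U (\<lambda>y. f y * ?R i j y))" if "continuous_on U f" for f i j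
    by (rule extend0_integrable[OF U C x]) (use z that in \<open>auto intro!: continuous_intros c\<close>)
  have "0 = (\<integral>y. extend0 U (\<lambda>y. w y * (s\<^sup>2 * ?R 0 0 y - (?R 2 0 y + ?R 0 2 y))) y \<partial>lborel)"
    by (rule weak[OF mollifier2_test_function(1)[OF \<delta>] cpt order_trans[OF sub x]
        mollifier2_test_function(2)[OF \<delta>], symmetric])
  also have "\<dots> = (\<integral>y. s\<^sup>2 * extend0 U (\<lambda>y. w y * ?R 0 0 y) y
      + (extend0 U (\<lambda>y. w y * - ?R 2 0 y) y + extend0 U (\<lambda>y. w y * - ?R 0 2 y) y) \<partial>lborel)"
    by (rule Bochner_Integration.integral_cong) (auto simp: extend0_def algebra_simps)
  also have "\<dots> = s\<^sup>2 * (\<integral>y. extend0 U (\<lambda>y. w y * ?R 0 0 y) y \<partial>lborel)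
      + ((\<integral>y. extend0 U (\<lambda>y. w y * - ?R 2 0 y) y \<partial>lborel) + (\<integral>y. extend0 U (\<lambda>y. w y * - ?R 0 2 y) y
          \<partial>lborel))"
  proof -
    have "integrable lborel (extend0 U (\<lambda>y. w y * - ?R i j y))" for i j
      by (rule extend0_integrable[OF U C x]) (use z in \<open>auto intro!: continuous_intros c w_cont\<close>)
    then show ?thesis using i[OF w_cont] by simp
  qed
  also have "(\<integral>y. extend0 U (\<lambda>y. w y * - ?R 2 0 y) y \<partial>lborel) =
      - (\<integral>y. extend0 U (\<lambda>y. w1 y * ?R 1 0 y) y \<partial>lborel)"
    by (rule by_parts_fst[OF C x])
      (use mollifier2_partial(1)[OF \<delta>, of 1 0] z in \<open>auto intro!: continuous_intros c simp:
          numeral_2_eq_2\<close>)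
  also have "(\<integral>y. extend0 U (\<lambda>y. w y * - ?R 0 2 y) y \<partial>lborel) =
      - (\<integral>y. extend0 U (\<lambda>y. w2 y * ?R 0 1 y) y \<partial>lborel)"
    by (rule by_parts_snd[OF C x])
      (use mollifier2_partial(2)[OF \<delta>, of 0 1] z in \<open>auto intro!: continuous_intros c simp:
          numeral_2_eq_2\<close>)
  finally show ?thesis by simp
qed

text \<open>Formally this is the weak equation tested with \<open>g * w\<close>, which is not smooth. Testing instead
  with mollifiers centred at \<open>x\<close>, multiplying by \<open>g x * w x\<close> and integrating over \<open>x\<close> moves all
  derivatives off the mollifier by Fubini.\<close>

lemma energy_identity:
  assumes C: "compact C" "C \<subseteq> U"
    and d1: "\<And>x y. (x, y) \<in> U \<Longrightarrow> ((\<lambda>t. g (t, y)) has_real_derivative g1 (x, y)) (at x)"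
    and d2: "\<And>x y. (x, y) \<in> U \<Longrightarrow> ((\<lambda>t. g (x, t)) has_real_derivative g2 (x, y)) (at y)"
    and c: "continuous_on U g" "continuous_on U g1" "continuous_on U g2"
    and z: "\<And>p. p \<in> U \<Longrightarrow> p \<notin> C \<Longrightarrow> g p = 0" "\<And>p. p \<in> U \<Longrightarrow> p \<notin> C \<Longrightarrow> g1 p = 0" "\<And>p. p \<in> U \<Longrightarrow> p \<notin> C \<Longrightarrow> g2 p = 0"
  shows "(\<integral>p. extend0 U (\<lambda>p. g p * ((w1 p)\<^sup>2 + (w2 p)\<^sup>2 + s\<^sup>2 * (w p)\<^sup>2) + w p * (w1 p * g1 p + w2
      p * g2 p)) p \<partial>lborel) = 0"
proof -
  \<comment> \<open>g w and its two partial derivatives, extended by 0.\<close>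
  define A0 where "A0 = extend0 U (\<lambda>p. g p * w p)"
  define A1 where "A1 = extend0 U (\<lambda>p. g p * w1 p + g1 p * w p)"
  define A2 where "A2 = extend0 U (\<lambda>p. g p * w2 p + g2 p * w p)"
  have Ac: "continuous_on UNIV A0" "continuous_on UNIV A1" "continuous_on UNIV A2"
    unfolding A0_def A1_def A2_def
    by (rule extend0_continuous[OF U C]; use z in \<open>auto intro!: continuous_intros c w_cont w1_cont
        w2_cont\<close>)+
  have Az: "A0 p = 0" "A1 p = 0" "A2 p = 0" if "p \<notin> C" for p
    using z C that by (auto simp: A0_def A1_def A2_def extend0_def)
  have Ai: "integrable lborel A0" "integrable lborel A1" "integrable lborel A2"
    by (rule integrable_continuous_compact_support[OF _ C(1)]; use Ac Az in auto)+
  have Ad1: "((\<lambda>t. A0 (t, y)) has_real_derivative A1 (x, y)) (at x)" for x y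
    unfolding A0_def A1_def
    by (rule extend0_partial_fst[OF U C]) (use DERIV_mult'[OF d1 w_deriv(1)] z in \<open>auto simp:
        add.commute\<close>)
  have Ad2: "((\<lambda>t. A0 (x, t)) has_real_derivative A2 (x, y)) (at y)" for x y
    unfolding A0_def A2_def
    by (rule extend0_partial_snd[OF U C]) (use DERIV_mult'[OF d2 w_deriv(2)] z in \<open>auto simp:
        add.commute\<close>)
  obtain r where r: "r > 0" "(\<Union>x\<in>C. cball x r) \<subseteq> U"
    using compact_subset_open_imp_cball_epsilon_subset[OF C(1) U C(2)] by blast
  \<comment> \<open>A compact neighbourhood of C inside U. Mollification at points of C with support
    radius at most r sees only C', so w and its derivatives may be cut to C', which makes them
    bounded and integrable on the plane.\<close>
  define C' where "C' = {x + z | x z. x \<in> C \<and> z \<in> cball (0 :: real \<times> real) r}"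
  have C'eq: "C' = (\<Union>x\<in>C. cball x r)"
  proof -
    have "y \<in> C'" if "x \<in> C" "y \<in> cball x r" for x y
      unfolding C'_def using that by (intro CollectI exI[of _ x] exI[of _ "y - x"]) (auto simp:
          dist_norm norm_minus_commute)
    moreover have "\<exists>x\<in>C. y \<in> cball x r" if y: "y \<in> C'" for y
    proof -
      obtain x z where "y = x + z" "x \<in> C" "z \<in> cball 0 r" using y unfolding C'_def by blast
      then show ?thesis by (intro bexI[of _ x]) (simp_all add: dist_norm)
    qed
    ultimately show ?thesis by blast
  qed
  have C': "compact C'" unfolding C'_def by (rule compact_sums[OF C(1)]) simp
  have C'U: "C' \<subseteq> U" using r C'eq by simp
  define B where "B f y = indicator C' y *\<^sub>R f y" for f :: "real \<times> real \<Rightarrow> real" and y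
  have Bi: "integrable lborel (B f)" if "continuous_on U f" for f
    unfolding B_def[abs_def] by (rule borel_integrable_compact[OF C' continuous_on_subset[OF that C'U]])
  have Bm: "B f \<in> borel_measurable borel" if "continuous_on U f" for f
    using Bi[OF that] by auto
  have Bb: "\<exists>c. \<forall>y. \<bar>B f y\<bar> \<le> c" if "continuous_on U f" for f
  proof -
    have "bounded (f ` C')"
      by (intro compact_imp_bounded compact_continuous_image C' continuous_on_subset[OF that C'U])
    then obtain c where "\<forall>y\<in>C'. \<bar>f y\<bar> \<le> c" by (auto simp: bounded_iff)
    then have "\<bar>B f y\<bar> \<le> max c 0" for y by (auto simp: B_def indicator_def le_max_iff_disj)
    then show ?thesis by blast
  qed
  have Bcont: "isCont (B f) x" if f: "continuous_on U f" and x: "x \<in> C" for f x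
  proof -
    have sub: "ball x r \<subseteq> C'" using x C'eq by force
    have "continuous_on (ball x r) (B f)"
      by (rule continuous_on_eq[OF continuous_on_subset[OF f order_trans[OF sub C'U]]]) (use sub in
          \<open>auto simp: B_def\<close>)
    then show ?thesis using r by (simp add: continuous_on_eq_continuous_at)
  qed
  \<comment> \<open>2 \<delta> \<le> r is required because \<open>mollifier2 \<delta>\<close> lives
    in the ball of radius 2 \<delta>.\<close>
  define \<delta> where "\<delta> n = r / 2 / real (Suc n)" for n
  have \<delta>: "\<delta> n > 0" "2 * \<delta> n \<le> r" for n using r by (auto simp: \<delta>_def field_simps)
  have \<delta>0: "\<delta> \<longlonglongrightarrow> 0"
    unfolding \<delta>_def[abs_def] using LIMSEQ_Suc[OF lim_const_over_n[of "r / 2"]] by simp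
  let ?R = "\<lambda>n i j. mollifier2 (\<delta> n) i j"
  define J where "J A f n = (\<integral>x. A x * (\<integral>y. B f y * ?R n 0 0 (x - y) \<partial>lborel) \<partial>lborel)" for A f n
  have J_lim: "J A f \<longlonglongrightarrow> (\<integral>x. A x * B f x \<partial>lborel)"
    if A: "integrable lborel A" "\<And>p. p \<notin> C \<Longrightarrow> A p = 0" and f: "continuous_on U f" for A f
  proof -
    obtain c where c: "\<And>y. \<bar>B f y\<bar> \<le> c" using Bb[OF f] by blast
    show ?thesis unfolding J_def[abs_def]
      by (rule mollifier2_approx_identity[OF A(1) Bm[OF f] c _ \<delta>(1) \<delta>0]) (use Bcont[OF f] A(2) in blast)
  qed
  have swap: "(\<integral>x. A x * (\<integral>y. B f y * ?R n i j (x - y) \<partial>lborel) \<partial>lborel) =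
      (\<integral>y. B f y * (\<integral>x. A x * ?R n i j (x - y) \<partial>lborel) \<partial>lborel)"
    if A: "integrable lborel A" and f: "continuous_on U f" for A f n i j
  proof -
    obtain c where c: "\<And>z. \<bar>?R n i j z\<bar> \<le> c" using mollifier2_bounded by blast
    show ?thesis by (rule integral_convolution_swap[OF A Bi[OF f] mollifier2_measurable[OF \<delta>(1)] c])
  qed
  have conv: "(\<integral>y. extend0 U (\<lambda>y. f y * ?R n i j (x - y)) y \<partial>lborel) =
      (\<integral>y. B f y * ?R n i j (x - y) \<partial>lborel)"
    if x: "x \<in> C" for f n i j x
  proof (rule Bochner_Integration.integral_cong[OF refl])
    fix y
    show "extend0 U (\<lambda>y. f y * ?R n i j (x - y)) y = B f y * ?R n i j (x - y)"
    proof (cases "y \<in> cball x r")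
      case True
      then have "y \<in> C'" using C'eq x by blast
      moreover from this have "y \<in> U" using C'U by blast
      ultimately show ?thesis by (simp add: extend0_def B_def)
    next
      case False
      then have "?R n i j (x - y) = 0" using \<delta>(2)[of n] by (intro mollifier2_eq_0 \<delta>(1)) (auto simp:
          dist_norm)
      then show ?thesis by (simp add: extend0_def)
    qed
  qed
  \<comment> \<open>The mollified equation at x, multiplied by g w at x and integrated in x.\<close>
  have J0: "s\<^sup>2 * J A0 w n = (\<integral>x. A0 x * (\<integral>y. B w1 y * ?R n 1 0 (x - y) \<partial>lborel) \<partial>lborel)
      + (\<integral>x. A0 x * (\<integral>y. B w2 y * ?R n 0 1 (x - y) \<partial>lborel) \<partial>lborel)" for n
  proof -
    have pt: "s\<^sup>2 * (A0 x * (\<integral>y. B w y * ?R n 0 0 (x - y) \<partial>lborel)) =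
        A0 x * (\<integral>y. B w1 y * ?R n 1 0 (x - y) \<partial>lborel) + A0 x * (\<integral>y. B w2 y * ?R n 0 1 (x - y)
            \<partial>lborel)" for x
    proof (cases "x \<in> C")
      case True
      have "cball x (2 * \<delta> n) \<subseteq> U" using True r \<delta>(2)[of n] by force
      from mollified_equation[OF \<delta>(1) this] show ?thesis
        unfolding conv[OF True] by (simp add: algebra_simps)
    qed (use Az in simp)
    have int: "integrable lborel (\<lambda>x. A0 x * (\<integral>y. B f y * ?R n i j (x - y) \<partial>lborel))" if
        f: "continuous_on U f" for f i j
    proof -
      obtain c where c: "\<And>z. \<bar>?R n i j z\<bar> \<le> c" using mollifier2_bounded by blast
      have [measurable]: "B f \<in> borel_measurable borel" "A0 \<in> borel_measurable borel" "?R n i j \<in>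
          borel_measurable borel"
        using Bm[OF f] Ai(1) mollifier2_measurable[OF \<delta>(1)] by auto
      have bi: "integrable lborel (\<lambda>y. B f y * ?R n i j (x - y))" for x
      proof (rule Bochner_Integration.integrable_bound[OF integrable_mult_right[OF Bi[OF f], of c]])
        show "AE y in lborel. norm (B f y * ?R n i j (x - y)) \<le> norm (c * B f y)"
        proof (intro always_eventually allI)
          fix y show "norm (B f y * ?R n i j (x - y)) \<le> norm (c * B f y)"
            using c[of "x - y"] mult_left_mono[of "\<bar>?R n i j (x - y)\<bar>" "\<bar>c\<bar>" "\<bar>B f y\<bar>"] by (simp
                add: abs_mult mult.commute)
        qed
      qed simp
      show ?thesis
      proof (rule Bochner_Integration.integrable_bound[OF integrable_mult_right[OF Ai(1),
          of "\<integral>y. \<bar>c * B f y\<bar> \<partial>lborel"]])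
        show "AE x in lborel. norm (A0 x * (\<integral>y. B f y * ?R n i j (x - y) \<partial>lborel)) \<le>
            norm ((\<integral>y. \<bar>c * B f y\<bar> \<partial>lborel) * A0 x)"
        proof (intro always_eventually allI)
          fix x
          have "\<bar>\<integral>y. B f y * ?R n i j (x - y) \<partial>lborel\<bar> \<le> (\<integral>y. \<bar>c * B f y\<bar> \<partial>lborel)"
          proof (rule integral_abs_bound_integral[OF bi])
            show "integrable lborel (\<lambda>y. \<bar>c * B f y\<bar>)" using Bi[OF f] by simp
            fix y show "\<bar>B f y * ?R n i j (x - y)\<bar> \<le> \<bar>c * B f y\<bar>"
              using c[of "x - y"] mult_left_mono[of "\<bar>?R n i j (x - y)\<bar>" "\<bar>c\<bar>" "\<bar>B f y\<bar>"] by (simp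
                  add: abs_mult mult.commute)
          qed
          then have "\<bar>A0 x\<bar> * \<bar>\<integral>y. B f y * ?R n i j (x - y) \<partial>lborel\<bar> \<le>
              \<bar>A0 x\<bar> * \<bar>\<integral>y. \<bar>c * B f y\<bar> \<partial>lborel\<bar>"
            by (intro mult_left_mono) auto
          then show "norm (A0 x * (\<integral>y. B f y * ?R n i j (x - y) \<partial>lborel)) \<le>
              norm ((\<integral>y. \<bar>c * B f y\<bar> \<partial>lborel) * A0 x)"
            unfolding real_norm_def abs_mult by (simp only: mult.commute[of _ "\<bar>A0 x\<bar>"])
        qed
      qed measurable
    qed
    have "s\<^sup>2 * J A0 w n = (\<integral>x. s\<^sup>2 * (A0 x * (\<integral>y. B w y * ?R n 0 0 (x - y) \<partial>lborel)) \<partial>lborel)"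
      unfolding J_def by simp
    also have "\<dots> = (\<integral>x. A0 x * (\<integral>y. B w1 y * ?R n 1 0 (x - y) \<partial>lborel) + A0 x * (\<integral>y. B w2 y * ?R n
        0 1 (x - y) \<partial>lborel) \<partial>lborel)"
      unfolding pt ..
    also have "\<dots> = (\<integral>x. A0 x * (\<integral>y. B w1 y * ?R n 1 0 (x - y) \<partial>lborel) \<partial>lborel)
        + (\<integral>x. A0 x * (\<integral>y. B w2 y * ?R n 0 1 (x - y) \<partial>lborel) \<partial>lborel)"
      by (rule Bochner_Integration.integral_add[OF int[OF w1_cont] int[OF w2_cont]])
    finally show ?thesis .
  qed
  \<comment> \<open>After Fubini the remaining derivative of the mollifier is moved in x, so it
    falls on g w, which is once differentiable.\<close>
  have inner1: "(\<integral>x. A0 x * ?R n 1 0 (x - y) \<partial>lborel) = - (\<integral>x. A1 x * ?R n 0 0 (x - y) \<partial>lborel)" for n y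
  proof -
    note c = continuous_mollifier2_shift[OF \<delta>(1)]
    have "(\<integral>x. A0 x * ?R n 1 0 (x - y) + A1 x * ?R n 0 0 (x - y) \<partial>lborel) = 0"
      by (rule integral_partial_fst_eq_0[where F="\<lambda>x. A0 x * ?R n 0 0 (x - y)" and C=C])
        (use C Az in \<open>auto intro!: continuous_intros c Ac DERIV_mult'[THEN DERIV_cong] Ad1
            mollifier2_partial(3) \<delta>(1)\<close>)
    moreover have "integrable lborel (\<lambda>x. A0 x * ?R n 1 0 (x - y))" "integrable lborel (\<lambda>x. A1 x *
        ?R n 0 0 (x - y))"
      by (rule integrable_continuous_compact_support[OF _ C(1)]; use Az in \<open>auto intro!:
          continuous_intros Ac c\<close>)+
    ultimately show ?thesis by simp
  qed
  have inner2: "(\<integral>x. A0 x * ?R n 0 1 (x - y) \<partial>lborel) = - (\<integral>x. A2 x * ?R n 0 0 (x - y) \<partial>lborel)" for n y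
  proof -
    note c = continuous_mollifier2_shift[OF \<delta>(1)]
    have "(\<integral>x. A0 x * ?R n 0 1 (x - y) + A2 x * ?R n 0 0 (x - y) \<partial>lborel) = 0"
      by (rule integral_partial_snd_eq_0[where F="\<lambda>x. A0 x * ?R n 0 0 (x - y)" and C=C])
        (use C Az in \<open>auto intro!: continuous_intros c Ac DERIV_mult'[THEN DERIV_cong] Ad2
            mollifier2_partial(4) \<delta>(1)\<close>)
    moreover have "integrable lborel (\<lambda>x. A0 x * ?R n 0 1 (x - y))" "integrable lborel (\<lambda>x. A2 x *
        ?R n 0 0 (x - y))"
      by (rule integrable_continuous_compact_support[OF _ C(1)]; use Az in \<open>auto intro!:
          continuous_intros Ac c\<close>)+
    ultimately show ?thesis by simp
  qed
  have "s\<^sup>2 * J A0 w n + J A1 w1 n + J A2 w2 n = 0" for n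
    unfolding J0 unfolding J_def swap[OF Ai(1) w1_cont] swap[OF Ai(1) w2_cont] swap[OF Ai(2)
        w1_cont] swap[OF Ai(3) w2_cont]
    unfolding inner1 inner2 by simp
  \<comment> \<open>As the mollifiers concentrate, the three terms become the integrals of s^2 g w^2
    and of the two products of a partial derivative of g w with that of w.\<close>
  moreover have "(\<lambda>n. s\<^sup>2 * J A0 w n + J A1 w1 n + J A2 w2 n) \<longlonglongrightarrow>
      s\<^sup>2 * (\<integral>x. A0 x * B w x \<partial>lborel) + (\<integral>x. A1 x * B w1 x \<partial>lborel) + (\<integral>x. A2 x * B w2 x \<partial>lborel)"
    by (intro tendsto_intros J_lim Ai w_cont w1_cont w2_cont Az)
  ultimately have sum0: "s\<^sup>2 * (\<integral>x. A0 x * B w x \<partial>lborel) + (\<integral>x. A1 x * B w1 x \<partial>lborel) + (\<integral>x. A2 x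
      * B w2 x \<partial>lborel) = 0"
    using LIMSEQ_unique[OF tendsto_const[of 0 sequentially]] by simp
  have AB: "A x * B f x = extend0 U (\<lambda>x. a x * f x) x" if "A = extend0 U a" "\<And>p. p \<notin> C \<Longrightarrow> A p =
      0" for A a f x
  proof (cases "x \<in> C")
    case True
    moreover have "x \<in> cball x r" using r(1) by simp
    ultimately have "x \<in> C'" unfolding C'eq by (rule UN_I)
    moreover from this have "x \<in> U" using C'U by blast
    ultimately show ?thesis unfolding that(1) by (simp add: extend0_def B_def)
  next
    case False
    then have "extend0 U a x = 0" using that by metis
    then show ?thesis unfolding that(1) by (cases "x \<in> U") (simp_all add: extend0_def)
  qed
  have e: "(\<lambda>x. A0 x * B w x) = extend0 U (\<lambda>p. g p * w p * w p)"
    "(\<lambda>x. A1 x * B w1 x) = extend0 U (\<lambda>p. (g p * w1 p + g1 p * w p) * w1 p)"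
    "(\<lambda>x. A2 x * B w2 x) = extend0 U (\<lambda>p. (g p * w2 p + g2 p * w p) * w2 p)"
    using AB[OF A0_def Az(1)] AB[OF A1_def Az(2)] AB[OF A2_def Az(3)] by (auto simp: fun_eq_iff)
  have ei: "integrable lborel (extend0 U (\<lambda>p. g p * w p * w p))"
    "integrable lborel (extend0 U (\<lambda>p. (g p * w1 p + g1 p * w p) * w1 p))"
    "integrable lborel (extend0 U (\<lambda>p. (g p * w2 p + g2 p * w p) * w2 p))"
    by (rule extend0_integrable[OF U C]; use z in \<open>auto intro!: continuous_intros c w_cont w1_cont
        w2_cont\<close>)+
  have "(\<integral>p. extend0 U (\<lambda>p. g p * ((w1 p)\<^sup>2 + (w2 p)\<^sup>2 + s\<^sup>2 * (w p)\<^sup>2) + w p * (w1 p * g1 p + w2 p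
      * g2 p)) p \<partial>lborel) =
      (\<integral>p. s\<^sup>2 * extend0 U (\<lambda>p. g p * w p * w p) p + extend0 U (\<lambda>p. (g p * w1 p + g1 p * w p) * w1 p) p
        + extend0 U (\<lambda>p. (g p * w2 p + g2 p * w p) * w2 p) p \<partial>lborel)"
    by (rule Bochner_Integration.integral_cong) (auto simp: extend0_def algebra_simps power2_eq_square)
  also have "\<dots> = 0" using sum0 ei unfolding e by simp
  finally show ?thesis .
qed

end

section \<open>Removing the cutoffs\<close>

text \<open>\<open>sing \<epsilon> 0 = 0\<close> because \<open>0 powr a = 0\<close>, so bounds by \<open>sing \<epsilon> (fst y)\<close> only hold off a line,
  that is, almost everywhere.\<close>

definition sing :: "real \<Rightarrow> real \<Rightarrow> real" where
  "sing \<epsilon> t = (\<bar>t\<bar> / (1 + \<bar>t\<bar>)) powr (- \<epsilon>)"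

lemma sing_nonneg: "0 \<le> sing \<epsilon> t"
  by (simp add: sing_def)

lemma sing_antimono:
  assumes "\<epsilon> > 0" "t \<noteq> 0" "\<bar>t\<bar> \<le> \<bar>r\<bar>" shows "sing \<epsilon> r \<le> sing \<epsilon> t"
  unfolding sing_def
proof (rule powr_mono2')
  show "\<bar>t\<bar> / (1 + \<bar>t\<bar>) \<le> \<bar>r\<bar> / (1 + \<bar>r\<bar>)" using assms by (simp add: field_simps)
qed (use assms in auto)

lemma sing_ge_1:
  assumes "\<epsilon> > 0" "t \<noteq> 0" shows "1 \<le> sing \<epsilon> t"
proof -
  have "\<bar>t\<bar> / (1 + \<bar>t\<bar>) \<le> 1" by simp
  then have "1 powr (- \<epsilon>) \<le> (\<bar>t\<bar> / (1 + \<bar>t\<bar>)) powr (- \<epsilon>)"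
    using assms by (intro powr_mono2') auto
  then show ?thesis by (simp add: sing_def)
qed

lemma sing_measurable [measurable]: "sing \<epsilon> \<in> borel_measurable borel"
  unfolding sing_def[abs_def] by measurable

lemma exp_le_cosh: "exp \<bar>x\<bar> / 2 \<le> cosh (x :: real)"
  by (cases "x \<ge> 0") (auto simp: cosh_def)

lemma integrable_sing_over_cosh:
  assumes \<epsilon>: "0 < \<epsilon>" "\<epsilon> < 1" and \<mu>: "\<mu> > 0"
  shows "integrable lborel (\<lambda>t. sing \<epsilon> t / cosh (\<mu> * t))"
proof -
  \<comment> \<open>A majorant on the half-line: t / (1 + t) is at least t / 2 on [0, 1] and at
    least 1/2 beyond, 2 powr \<epsilon> \<le> 2, and cosh x \<ge> exp |x| / 2. Integrability at 0 is
    where \<epsilon> < 1 enters.\<close>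
  define D where "D t = indicator {0..1} t *\<^sub>R (2 * t powr (- \<epsilon>)) + indicator {0..} t *\<^sub>R (4 * exp
      (- \<mu> * t))" for t :: real
  have 1: "integrable lborel (\<lambda>t::real. indicator {0..1} t *\<^sub>R (2 * t powr (- \<epsilon>)))"
  proof -
    have "(\<lambda>t. t powr (- \<epsilon>)) integrable_on {0..1}" by (rule integrable_on_powr_from_0) (use \<epsilon> in auto)
    then have "(\<lambda>t. t powr (- \<epsilon>)) absolutely_integrable_on {0..1}"
      by (subst absolutely_integrable_on_iff_nonneg) auto
    from integrable_mult_right[OF this[unfolded set_integrable_def], of 2]
    show ?thesis by (subst (asm) integrable_completion) (auto simp: mult_ac)
  qed
  have 2: "integrable lborel (\<lambda>t::real. indicator {0..} t *\<^sub>R (4 * exp (- \<mu> * t)))"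
  proof -
    have "(\<lambda>t. exp (- \<mu> * t)) integrable_on {0..}" by (rule integrable_on_exp_minus_to_infinity[OF \<mu>])
    then have "(\<lambda>t. exp (- \<mu> * t)) absolutely_integrable_on {0..}"
      by (subst absolutely_integrable_on_iff_nonneg) auto
    from integrable_mult_right[OF this[unfolded set_integrable_def], of 4]
    show ?thesis by (subst (asm) integrable_completion) (auto simp: mult_ac)
  qed
  have D: "integrable lborel D" unfolding D_def by (intro Bochner_Integration.integrable_add 1 2)
  then have D': "integrable lborel (\<lambda>t. D (0 + (- 1) * t))" by (rule lborel_integrable_real_affine) simp
  have D0: "0 \<le> D t" for t by (auto simp: D_def indicator_def)
  have pos: "sing \<epsilon> t / cosh (\<mu> * t) \<le> D t" if t: "0 \<le> t" for t
  proof (cases "t \<le> 1")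
    case True
    have "sing \<epsilon> t \<le> 2 * t powr (- \<epsilon>)"
    proof (cases "t = 0")
      case False
      then have t: "t > 0" using t by simp
      have "sing \<epsilon> t \<le> (t / 2) powr (- \<epsilon>)"
        unfolding sing_def using t True \<epsilon> by (intro powr_mono2') (auto simp: field_simps)
      also have "\<dots> = 2 powr \<epsilon> * t powr (- \<epsilon>)"
        using t by (simp add: powr_divide powr_minus field_simps)
      also have "\<dots> \<le> 2 powr 1 * t powr (- \<epsilon>)"
        using \<epsilon> by (intro mult_right_mono powr_mono) auto
      finally show ?thesis by simp
    qed (simp add: sing_def)
    moreover have "sing \<epsilon> t / cosh (\<mu> * t) \<le> sing \<epsilon> t / 1"
      using cosh_real_ge_1[of "\<mu> * t"] sing_nonneg[of \<epsilon> t] by (intro divide_left_mono) auto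
    ultimately show ?thesis using t True by (auto simp: D_def add_increasing2)
  next
    case False
    then have t: "t > 1" by simp
    have "sing \<epsilon> t \<le> (1 / 2) powr (- \<epsilon>)"
      unfolding sing_def using t \<epsilon> by (intro powr_mono2') (auto simp: field_simps)
    also have "\<dots> = 2 powr \<epsilon>" by (simp add: powr_divide powr_minus)
    also have "\<dots> \<le> 2 powr 1" using \<epsilon> by (intro powr_mono) auto
    finally have s: "sing \<epsilon> t \<le> 2" by simp
    have "exp (\<mu> * t) / 2 \<le> cosh (\<mu> * t)" using exp_le_cosh[of "\<mu> * t"] t \<mu> by simp
    then have "sing \<epsilon> t / cosh (\<mu> * t) \<le> 2 / (exp (\<mu> * t) / 2)"
      using s sing_nonneg[of \<epsilon> t] by (intro frac_le) auto
    also have "\<dots> = 4 * exp (- \<mu> * t)" by (simp add: exp_minus field_simps)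
    finally show ?thesis using t by (simp add: D_def indicator_def)
  qed
  show ?thesis
  proof (rule Bochner_Integration.integrable_bound[OF Bochner_Integration.integrable_add[OF D D']])
    show "AE t in lborel. norm (sing \<epsilon> t / cosh (\<mu> * t)) \<le> norm (D t + D (0 + - 1 * t))"
    proof (intro always_eventually allI)
      fix t
      have "sing \<epsilon> t / cosh (\<mu> * t) \<le> D \<bar>t\<bar>"
        using pos[of "\<bar>t\<bar>"] by (cases "t \<ge> 0") (auto simp: sing_def)
      also have "\<dots> \<le> D t + D (- t)" using D0[of t] D0[of "- t"] by (cases "t \<ge> 0") auto
      finally show "norm (sing \<epsilon> t / cosh (\<mu> * t)) \<le> norm (D t + D (0 + - 1 * t))"
        using sing_nonneg[of \<epsilon> t] D0[of t] D0[of "- t"] by simp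
    qed
    have "(\<lambda>t. cosh (\<mu> * t)) \<in> borel_measurable borel"
      by (intro borel_measurable_continuous_onI continuous_intros)
    then show "(\<lambda>t. sing \<epsilon> t / cosh (\<mu> * t)) \<in> borel_measurable lborel" by simp
  qed
qed

section \<open>Rescaling of boundary strips\<close>

lemma AE_fst_snd_neq:
  "AE y in (lborel :: (real \<times> real) measure). fst y \<noteq> c" "AE y in (lborel :: (real \<times> real)
      measure). snd y \<noteq> c"
proof -
  have "{c} \<times> UNIV \<in> null_sets (lborel \<Otimes>\<^sub>M lborel :: (real \<times> real) measure)"
    by (rule null_setsI) (simp_all add: lborel.emeasure_pair_measure_Times)
  then show "AE y in (lborel :: (real \<times> real) measure). fst y \<noteq> c"
    unfolding lborel_prod by (rule AE_I') auto
  have "UNIV \<times> {c} \<in> null_sets (lborel \<Otimes>\<^sub>M lborel :: (real \<times> real) measure)"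
    by (rule null_setsI) (simp_all add: lborel.emeasure_pair_measure_Times)
  then show "AE y in (lborel :: (real \<times> real) measure). snd y \<noteq> c"
    unfolding lborel_prod by (rule AE_I') auto
qed

text \<open>Fubini with an affine substitution in the second variable. It straightens a line of
  slope \<alpha> and stretches the distance from it, so that a thin strip becomes one of fixed
  width.\<close>

lemma integral_shear:
  fixes f :: "real \<times> real \<Rightarrow> real"
  assumes f: "integrable lborel f" and k: "k \<noteq> 0"
    and F: "integrable lborel (\<lambda>z. f (fst z, \<alpha> * fst z + k * snd z))"
  shows "(\<integral>y. f y \<partial>lborel) = \<bar>k\<bar> * (\<integral>z. f (fst z, \<alpha> * fst z + k * snd z) \<partial>lborel)"
proof -
  have inner: "(\<integral>y. f (r, y) \<partial>lborel) = \<bar>k\<bar> * (\<integral>\<sigma>. f (r, \<alpha> * r + k * \<sigma>) \<partial>lborel)" for r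
    using lborel_integral_real_affine[OF k, of "\<lambda>y. f (r, y)" "\<alpha> * r"] by simp
  have "(\<integral>y. f y \<partial>lborel) = (\<integral>r. (\<integral>y. f (r, y) \<partial>lborel) \<partial>lborel)"
    using lborel_pair.integral_fst'[of f] f by (simp add: lborel_prod)
  also have "\<dots> = (\<integral>r. \<bar>k\<bar> * (\<integral>\<sigma>. f (r, \<alpha> * r + k * \<sigma>) \<partial>lborel) \<partial>lborel)"
    unfolding inner ..
  also have "\<dots> = \<bar>k\<bar> * (\<integral>z. f (fst z, \<alpha> * fst z + k * snd z) \<partial>lborel)"
    using lborel_pair.integral_fst'[of "\<lambda>z. f (fst z,
        \<alpha> * fst z + k * snd z)"] F by (simp add: lborel_prod)
  finally show ?thesis .
qed

text \<open>The derivative of a boundary cutoff grows like the inverse of the width of its strip.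
  The Jacobian |k n| cancels this growth, so the rescaled integrands have a common majorant.\<close>

lemma strip_integral_tendsto_0:
  fixes f :: "nat \<Rightarrow> real \<times> real \<Rightarrow> real"
  assumes f: "\<And>n. integrable lborel (f n)" and k: "\<And>n. k n \<noteq> 0" and W: "integrable lborel W"
    and bd: "\<And>n. AE z in lborel. \<bar>\<bar>k n\<bar> * f n (fst z, \<alpha> * fst z + k n * snd z)\<bar> \<le> W z"
    and lim: "AE z in lborel. (\<lambda>n. \<bar>k n\<bar> * f n (fst z, \<alpha> * fst z + k n * snd z)) \<longlonglongrightarrow> 0"
  shows "(\<lambda>n. \<integral>y. f n y \<partial>lborel) \<longlonglongrightarrow> 0"
proof -
  let ?V = "\<lambda>n z. \<bar>k n\<bar> * f n (fst z, \<alpha> * fst z + k n * snd z)"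
  have [measurable]: "f n \<in> borel_measurable borel" for n using f[of n] by auto
  have m: "(\<lambda>z. f n (fst z, \<alpha> * fst z + k n * snd z)) \<in> borel_measurable borel" for n
    by (rule measurable_compose[where N=borel])
      (auto intro!: borel_measurable_continuous_onI continuous_intros)
  have V: "integrable lborel (?V n)" for n
    by (rule Bochner_Integration.integrable_bound[OF W]) (use m bd[of n] in \<open>auto elim: eventually_mono\<close>)
  have "(\<integral>y. f n y \<partial>lborel) = (\<integral>z. ?V n z \<partial>lborel)" for n
  proof -
    have "integrable lborel (\<lambda>z. f n (fst z, \<alpha> * fst z + k n * snd z))"
      using V[of n] k[of n] by simp
    from integral_shear[OF f k this] show ?thesis by simp
  qed
  moreover have "(\<lambda>n. \<integral>z. ?V n z \<partial>lborel) \<longlonglongrightarrow> (integral\<^sup>L lborel (\<lambda>z :: real \<times> real. 0))"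
    by (rule integral_dominated_convergence[where w=W]) (use m bd lim W in auto)
  ultimately show ?thesis by simp
qed

text \<open>For lines that are graphs over the second coordinate. This suits the side at angle
  \<phi>, where sin \<phi> > 0 while cos \<phi> may vanish.\<close>

lemma strip_integral_tendsto_0':
  fixes f :: "nat \<Rightarrow> real \<times> real \<Rightarrow> real"
  assumes f: "\<And>n. integrable lborel (f n)" and k: "\<And>n. k n \<noteq> 0" and W: "integrable lborel W"
    and bd: "\<And>n. AE z in lborel. \<bar>\<bar>k n\<bar> * f n (\<alpha> * fst z + k n * snd z, fst z)\<bar> \<le> W z"
    and lim: "AE z in lborel. (\<lambda>n. \<bar>k n\<bar> * f n (\<alpha> * fst z + k n * snd z, fst z)) \<longlonglongrightarrow> 0"
  shows "(\<lambda>n. \<integral>y. f n y \<partial>lborel) \<longlonglongrightarrow> 0"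
proof -
  let ?g = "\<lambda>n z. f n (snd z, fst z)"
  have g: "integrable lborel (?g n)" for n
    using lborel_pair.integrable_product_swap[of "f n"] f[of n] by (simp add: lborel_prod
        case_prod_unfold)
  have eq: "(\<integral>y. f n y \<partial>lborel) = (\<integral>y. ?g n y \<partial>lborel)" for n
    using lborel_pair.integral_product_swap[of "f n"] f[of n] by (auto simp: lborel_prod
        case_prod_unfold)
  show ?thesis
    unfolding eq by (rule strip_integral_tendsto_0[OF g k W]) (use bd lim in simp_all)
qed

lemma Bseq_mult_tendsto_0:
  fixes a b :: "nat \<Rightarrow> real"
  assumes "Bseq a" "b \<longlonglongrightarrow> 0" shows "(\<lambda>n. a n * b n) \<longlonglongrightarrow> 0"
  using bounded_bilinear.Bfun_prod_Zfun[OF bounded_bilinear_mult assms(1)] assms(2) by (simp add: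
      tendsto_Zfun_iff)

lemma extend0_measurable:
  assumes "open U" "continuous_on U f" shows "extend0 U f \<in> borel_measurable borel"
proof -
  have "extend0 U f = (\<lambda>x. indicator U x *\<^sub>R f x)" by (auto simp: extend0_def indicator_def fun_eq_iff)
  then show ?thesis using borel_measurable_continuous_on_indicator[of U f] assms by simp
qed

lemma continuous_on_smooth_step [continuous_intros]:
  "continuous_on A f \<Longrightarrow> continuous_on A (\<lambda>x. smooth_step n (f x))"
  by (rule continuous_on_compose2[OF continuous_smooth_step[of UNIV]]) auto

text \<open>One factor of the weight, cut off at distance N = n + 1. The argument 2 - 3 (t/N)^2 is
  at least 1 for |t| \<le> N / sqrt 3 and equals - 1 at |t| = N; the square keeps it smooth at
  0.\<close>

definition taper :: "real \<Rightarrow> nat \<Rightarrow> real \<Rightarrow> real" where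
  "taper \<mu> n t = smooth_step 0 (2 - 3 * (t / real (Suc n))\<^sup>2) / cosh (\<mu> * t)"

definition taper' :: "real \<Rightarrow> nat \<Rightarrow> real \<Rightarrow> real" where
  "taper' \<mu> n t = smooth_step 1 (2 - 3 * (t / real (Suc n))\<^sup>2) * (- 6 * t / (real (Suc n))\<^sup>2) /
      cosh (\<mu> * t)
    - \<mu> * sinh (\<mu> * t) / (cosh (\<mu> * t))\<^sup>2 * smooth_step 0 (2 - 3 * (t / real (Suc n))\<^sup>2)"

lemma taper_deriv: "(taper \<mu> n has_real_derivative taper' \<mu> n t) (at t)"
proof -
  let ?N = "real (Suc n)"
  have 1: "((\<lambda>t. smooth_step 0 (2 - 3 * (t / ?N)\<^sup>2)) has_real_derivative
      smooth_step 1 (2 - 3 * (t / ?N)\<^sup>2) * (- 6 * t / ?N\<^sup>2)) (at t)"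
  proof -
    have "((\<lambda>t. 2 - 3 * (t / ?N)\<^sup>2) has_real_derivative (- 6 * t / ?N\<^sup>2)) (at t)"
      by (auto intro!: derivative_eq_intros simp: power2_eq_square simp del: of_nat_Suc)
    from DERIV_chain2[OF smooth_step_deriv[of 0] this] show ?thesis by simp
  qed
  have 2: "((\<lambda>t. 1 / cosh (\<mu> * t)) has_real_derivative - (\<mu> * sinh (\<mu> * t) / (cosh (\<mu> * t))\<^sup>2)) (at t)"
    by (auto intro!: derivative_eq_intros simp: power2_eq_square)
  have "((\<lambda>t. smooth_step 0 (2 - 3 * (t / ?N)\<^sup>2) * (1 / cosh (\<mu> * t))) has_real_derivative
      taper' \<mu> n t) (at t)"
    by (rule DERIV_cong[OF DERIV_mult[OF 1 2]]) (simp add: taper'_def)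
  then show ?thesis by (simp add: taper_def[abs_def])
qed

lemma continuous_taper: "continuous_on A (taper \<mu> n)" "continuous_on A (taper' \<mu> n)"
  unfolding taper_def[abs_def] taper'_def[abs_def]
  by (auto intro!: continuous_intros simp del: of_nat_Suc)

lemma taper_eq_0:
  assumes "\<bar>t\<bar> \<ge> real (Suc n)" shows "taper \<mu> n t = 0" "taper' \<mu> n t = 0"
proof -
  have "1 \<le> \<bar>t / real (Suc n)\<bar>" using assms by (simp add: abs_divide del: of_nat_Suc)
  then have "1\<^sup>2 \<le> \<bar>t / real (Suc n)\<bar>\<^sup>2" by (intro power_mono) auto
  then have "1 \<le> (t / real (Suc n))\<^sup>2" unfolding power2_abs by simp
  then have "2 - 3 * (t / real (Suc n))\<^sup>2 \<le> - 1" by linarith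
  then show "taper \<mu> n t = 0" "taper' \<mu> n t = 0"
    using smooth_step_0 smooth_step_Suc_eq_0[of "2 - 3 * (t / real (Suc n))\<^sup>2" 0]
    by (simp_all add: taper_def taper'_def del: of_nat_Suc)
qed

lemma taper_bounds: "0 \<le> taper \<mu> n t" "taper \<mu> n t \<le> 1 / cosh (\<mu> * t)"
  using smooth_step_range by (auto simp: taper_def intro!: divide_right_mono)

lemma inverse_cosh_deriv_bound:
  fixes t :: real
  assumes "\<mu> > 0" shows "\<bar>\<mu> * sinh (\<mu> * t) / (cosh (\<mu> * t))\<^sup>2\<bar> \<le> \<mu> / cosh (\<mu> * t)"
proof -
  have "\<bar>sinh (\<mu> * t)\<bar> \<le> cosh (\<mu> * t)"
    using cosh_minus_sinh[of "\<mu> * t"] cosh_plus_sinh[of "\<mu> * t"] exp_gt_zero[of "\<mu> * t"]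
        exp_gt_zero[of "- (\<mu> * t)"]
    by linarith
  then have "\<bar>sinh (\<mu> * t)\<bar> / cosh (\<mu> * t) \<le> 1" by simp
  then have "\<mu> / cosh (\<mu> * t) * (\<bar>sinh (\<mu> * t)\<bar> / cosh (\<mu> * t)) \<le> \<mu> / cosh (\<mu> * t) * 1"
    using assms by (intro mult_left_mono) auto
  then show ?thesis using assms by (simp add: abs_mult power2_eq_square)
qed

text \<open>The bound is independent of n: on the support of the cutoff |t| \<le> N, so the inner
  derivative 6 |t| / N^2 is at most 6. The weight itself contributes \<mu>.\<close>

lemma taper'_bound:
  assumes "\<mu> > 0"
  obtains L where "L \<ge> 0" "\<And>n t. \<bar>taper' \<mu> n t\<bar> \<le> L / cosh (\<mu> * t)"
proof -
  obtain B where B: "\<And>t. \<bar>smooth_step 1 t\<bar> \<le> B" using smooth_step_bounded by blast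
  have B0: "0 \<le> B" using B[of 0] by linarith
  have "\<bar>taper' \<mu> n t\<bar> \<le> (6 * B + \<mu>) / cosh (\<mu> * t)" for n t
  proof (cases "\<bar>t\<bar> \<ge> real (Suc n)")
    case True
    then show ?thesis using taper_eq_0(2)[OF True] B0 assms by simp
  next
    case False
    let ?N = "real (Suc n)"
    have "\<bar>- 6 * t / ?N\<^sup>2\<bar> \<le> 6"
    proof -
      have "\<bar>t\<bar> \<le> ?N * 1" using False by simp
      also have "\<dots> \<le> ?N * ?N" by (intro mult_left_mono) auto
      finally show ?thesis by (simp add: abs_mult power2_eq_square pos_divide_le_eq del: of_nat_Suc)
    qed
    then have "\<bar>smooth_step 1 (2 - 3 * (t / ?N)\<^sup>2)\<bar> * \<bar>- 6 * t / ?N\<^sup>2\<bar> \<le> B * 6"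
      using B B0 by (intro mult_mono) auto
    then have 1: "\<bar>smooth_step 1 (2 - 3 * (t / ?N)\<^sup>2) * (- 6 * t / ?N\<^sup>2) / cosh (\<mu> * t)\<bar> \<le>
        6 * B / cosh (\<mu> * t)"
      unfolding abs_divide[of "smooth_step 1 (2 - 3 * (t / ?N)\<^sup>2) * (- 6 * t / ?N\<^sup>2)" "cosh (\<mu> * t)"]
        abs_mult[of "smooth_step 1 (2 - 3 * (t / ?N)\<^sup>2)"] abs_of_nonneg[OF cosh_real_nonneg]
            mult.commute[of 6 B]
      by (rule divide_right_mono) (rule cosh_real_nonneg)
    have "\<bar>\<mu> * sinh (\<mu> * t) / (cosh (\<mu> * t))\<^sup>2\<bar> * \<bar>smooth_step 0 (2 - 3 * (t / ?N)\<^sup>2)\<bar> \<le>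
        \<mu> / cosh (\<mu> * t) * 1"
      using smooth_step_range assms by (intro mult_mono inverse_cosh_deriv_bound) auto
    then have 2: "\<bar>\<mu> * sinh (\<mu> * t) / (cosh (\<mu> * t))\<^sup>2 * smooth_step 0 (2 - 3 * (t / ?N)\<^sup>2)\<bar> \<le>
        \<mu> / cosh (\<mu> * t)"
      unfolding abs_mult[of "\<mu> * sinh (\<mu> * t) / (cosh (\<mu> * t))\<^sup>2"] by simp
    show ?thesis
      unfolding taper'_def add_divide_distrib by (rule order_trans[OF abs_triangle_ineq4
          add_mono[OF 1 2]])
  qed
  with B0 assms show thesis by (intro that[of "6 * B + \<mu>"]) auto
qed

lemma taper_tendsto:
  "(\<lambda>n. taper \<mu> n t) \<longlonglongrightarrow> 1 / cosh (\<mu> * t)"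
  "(\<lambda>n. taper' \<mu> n t) \<longlonglongrightarrow> - (\<mu> * sinh (\<mu> * t) / (cosh (\<mu> * t))\<^sup>2)"
proof -
  have N: "\<forall>\<^sub>F n in sequentially. real (Suc n) \<ge> 2 * \<bar>t\<bar>"
  proof -
    obtain m :: nat where "real m \<ge> 2 * \<bar>t\<bar>" using real_arch_simple by blast
    then show ?thesis by (intro eventually_sequentiallyI[of m]) auto
  qed
  have *: "1 \<le> 2 - 3 * (t / real (Suc n))\<^sup>2" if "real (Suc n) \<ge> 2 * \<bar>t\<bar>" for n
  proof -
    have "\<bar>t / real (Suc n)\<bar> \<le> 1 / 2" using that by (simp add: abs_divide field_simps)
    then have "\<bar>t / real (Suc n)\<bar>\<^sup>2 \<le> (1 / 2)\<^sup>2" by (intro power_mono) auto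
    then have "(t / real (Suc n))\<^sup>2 \<le> 1 / 4" unfolding power2_abs by (simp add: power2_eq_square)
    then show ?thesis by linarith
  qed
  show "(\<lambda>n. taper \<mu> n t) \<longlonglongrightarrow> 1 / cosh (\<mu> * t)"
    by (rule tendsto_eventually, rule eventually_mono[OF N]) (use * in \<open>simp add: taper_def
        smooth_step_1 del: of_nat_Suc\<close>)
  show "(\<lambda>n. taper' \<mu> n t) \<longlonglongrightarrow> - (\<mu> * sinh (\<mu> * t) / (cosh (\<mu> * t))\<^sup>2)"
  proof (rule tendsto_eventually, rule eventually_mono[OF N])
    fix n assume "real (Suc n) \<ge> 2 * \<bar>t\<bar>"
    from *[OF this] have "smooth_step (Suc 0) (2 - 3 * (t / real (Suc n))\<^sup>2) = 0"
      "smooth_step 0 (2 - 3 * (t / real (Suc n))\<^sup>2) = 1"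
      by (intro smooth_step_Suc_eq_0 smooth_step_1; linarith)+
    then show "taper' \<mu> n t = - (\<mu> * sinh (\<mu> * t) / (cosh (\<mu> * t))\<^sup>2)"
      by (simp add: taper'_def del: of_nat_Suc)
  qed
qed

text \<open>\<open>bc1\<close> and \<open>bc2\<close> are products of w with its normal derivative,
  so one locale serves every type of boundary condition. Continuity up to the closure without the
  corner gives these products a meaning as limits from inside.\<close>

locale wedge_helmholtz = weak_helmholtz "Q \<phi>" s w w1 w2 for \<phi> s w w1 w2 +
  fixes \<epsilon> M :: real
  assumes phi: "0 < \<phi>" "\<phi> < pi" and eps: "0 < \<epsilon>" "\<epsilon> < 1" and s: "s \<noteq> 0"
    and cl_w: "continuous_on (closure (Q \<phi>)) w"
    and cl_w1: "continuous_on (closure (Q \<phi>) - {0}) w1"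
    and cl_w2: "continuous_on (closure (Q \<phi>) - {0}) w2"
    and bd_w: "\<And>y. y \<in> Q \<phi> \<Longrightarrow> \<bar>w y\<bar> \<le> M"
    and bd_w1: "\<And>y. y \<in> Q \<phi> \<Longrightarrow> \<bar>w1 y\<bar> \<le> M * sing \<epsilon> (norm y)"
    and bd_w2: "\<And>y. y \<in> Q \<phi> \<Longrightarrow> \<bar>w2 y\<bar> \<le> M * sing \<epsilon> (norm y)"
    and bc1: "\<And>r. r > 0 \<Longrightarrow> w (r, 0) * w2 (r, 0) = 0"
    and bc2: "\<And>r. r > 0 \<Longrightarrow> w (r * cos \<phi>, r * sin \<phi>) *
      (sin \<phi> * w1 (r * cos \<phi>, r * sin \<phi>) - cos \<phi> * w2 (r * cos \<phi>, r * sin \<phi>)) = 0"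
begin

text \<open>Small enough to leave the coefficients 1 - \<mu> / 2 \<ge> 0 and s^2 - \<mu> \<ge> s^2 /
  2 in \<open>Xlim_lower\<close>.\<close>

definition \<mu> :: real where "\<mu> = min 1 (s\<^sup>2) / 2"

lemma mu: "0 < \<mu>" "\<mu> \<le> 1 / 2" "\<mu> \<le> s\<^sup>2 / 2"
  using s by (auto simp: \<mu>_def)

lemma sin_pos: "sin \<phi> > 0"
  using phi by (rule sin_gt_zero)

text \<open>\<open>Q \<phi>\<close> is where \<open>d1\<close> or \<open>d2\<close> is positive; these are the signed distances from the lines
  through \<open>Q1\<close> and \<open>Q2 \<phi>\<close>.\<close>

definition d1 :: "real \<times> real \<Rightarrow> real" where "d1 y = - snd y"
definition d2 :: "real \<times> real \<Rightarrow> real" where "d2 y = snd y * cos \<phi> - fst y * sin \<phi>"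

lemma Q_iff: "y \<in> Q \<phi> \<longleftrightarrow> 0 < d1 y \<or> 0 < d2 y"
  by (simp add: Q_eq[OF phi] d1_def d2_def)

section \<open>The cutoff near the boundary and the test weight\<close>

definition N :: "nat \<Rightarrow> real" where "N n = real (Suc n)"

lemma N_pos: "N n > 0" by (simp add: N_def)

text \<open>The transition takes place for N t between 1 and 3, that is, at positive distance from
  the boundary.\<close>

definition \<eta> :: "nat \<Rightarrow> real \<Rightarrow> real" where "\<eta> n t = smooth_step 0 (N n * t - 2)"
definition \<eta>' :: "nat \<Rightarrow> real \<Rightarrow> real" where "\<eta>' n t = N n * smooth_step 1 (N n * t - 2)"

lemma eta_range: "0 \<le> \<eta> n t" "\<eta> n t \<le> 1"
  by (auto simp: \<eta>_def smooth_step_range)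

lemma eta_eq_0: "N n * t \<le> 1 \<Longrightarrow> \<eta> n t = 0" "N n * t \<le> 1 \<Longrightarrow> \<eta>' n t = 0"
  using smooth_step_Suc_eq_0[of "N n * t - 2" 0] by (auto simp: \<eta>_def \<eta>'_def smooth_step_0)

lemma eta_eq_1: "N n * t \<ge> 3 \<Longrightarrow> \<eta> n t = 1" "N n * t \<ge> 3 \<Longrightarrow> \<eta>' n t = 0"
  using smooth_step_Suc_eq_0[of "N n * t - 2" 0] by (auto simp: \<eta>_def \<eta>'_def smooth_step_1)

lemma eta_deriv: "(\<eta> n has_real_derivative \<eta>' n t) (at t)"
proof -
  have "((\<lambda>t. N n * t - 2) has_real_derivative N n) (at t)"
    by (auto intro!: derivative_eq_intros)
  from DERIV_chain2[OF smooth_step_deriv[of 0] this] show ?thesis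
    by (simp add: \<eta>_def[abs_def] \<eta>'_def mult.commute)
qed

lemma eta_continuous: "continuous_on A f \<Longrightarrow> continuous_on A (\<lambda>x. \<eta> n (f x))" "continuous_on A f \<Longrightarrow>
    continuous_on A (\<lambda>x. \<eta>' n (f x))"
  unfolding \<eta>_def \<eta>'_def by (intro continuous_intros; assumption)+

lemma eventually_N_ge: "t > 0 \<Longrightarrow> \<forall>\<^sub>F n in sequentially. N n * t \<ge> c"
proof -
  assume t: "t > 0"
  obtain m :: nat where m: "real m \<ge> c / t" using real_arch_simple by blast
  have "N n * t \<ge> c" if "n \<ge> m" for n
  proof -
    have "c / t \<le> N n" using m that by (simp add: N_def)
    then show ?thesis using t by (simp add: field_simps)
  qed
  then show ?thesis by (rule eventually_sequentiallyI)
qed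

lemma d_continuous: "continuous_on A d1" "continuous_on A d2"
  unfolding d1_def[abs_def] d2_def[abs_def] by (intro continuous_intros)+

text \<open>\<open>Q \<phi>\<close> is a union of half-planes, so a point is near its boundary only
  if both d1 and d2 are small; hence the complements are multiplied. The gradient splits into one
  strip for each line.\<close>

definition cutN :: "nat \<Rightarrow> real \<times> real \<Rightarrow> real" where
  "cutN n y = 1 - (1 - \<eta> n (d1 y)) * (1 - \<eta> n (d2 y))"

lemma cutN_range: "0 \<le> cutN n y" "cutN n y \<le> 1"
proof -
  have "0 \<le> (1 - \<eta> n (d1 y)) * (1 - \<eta> n (d2 y))" "(1 - \<eta> n (d1 y)) * (1 - \<eta> n (d2 y)) \<le> 1"
    using eta_range by (auto intro: mult_nonneg_nonneg mult_le_one)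
  then show "0 \<le> cutN n y" "cutN n y \<le> 1" by (simp_all add: cutN_def)
qed

lemma cutN_tendsto: "y \<in> Q \<phi> \<Longrightarrow> (\<lambda>n. cutN n y) \<longlonglongrightarrow> 1"
proof (rule tendsto_eventually)
  assume "y \<in> Q \<phi>"
  then consider "0 < d1 y" | "0 < d2 y" by (auto simp: Q_iff)
  then show "\<forall>\<^sub>F n in sequentially. cutN n y = 1"
  proof cases
    case 1
    from eventually_N_ge[OF this, of 3] show ?thesis
      by eventually_elim (simp add: cutN_def eta_eq_1)
  next
    case 2
    from eventually_N_ge[OF this, of 3] show ?thesis
      by eventually_elim (simp add: cutN_def eta_eq_1)
  qed
qed

abbreviation tp where "tp \<equiv> taper \<mu>"
abbreviation tp' where "tp' \<equiv> taper' \<mu>"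

text \<open>The derivative of \<open>cutN\<close> with respect to d1. It lives along the whole first
  line, but the factor with d2 switches it off, as n grows, on the half of that line running inside
  \<open>Q \<phi>\<close>.\<close>

definition strip1 :: "nat \<Rightarrow> real \<times> real \<Rightarrow> real" where
  "strip1 n y = (1 - \<eta> n (d2 y)) * \<eta>' n (d1 y)"
definition strip2 :: "nat \<Rightarrow> real \<times> real \<Rightarrow> real" where
  "strip2 n y = (1 - \<eta> n (d1 y)) * \<eta>' n (d2 y)"

definition g where "g n y = cutN n y * (tp n (fst y) * tp n (snd y))"
definition g1 where "g1 n y = cutN n y * (tp' n (fst y) * tp n (snd y)) + (- sin \<phi> * strip2 n y) *
    (tp n (fst y) * tp n (snd y))"
definition g2 where "g2 n y = cutN n y * (tp n (fst y) * tp' n (snd y)) + (cos \<phi> * strip2 n y -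
    strip1 n y) * (tp n (fst y) * tp n (snd y))"

definition C :: "nat \<Rightarrow> (real \<times> real) set" where
  "C n = {y. \<bar>fst y\<bar> \<le> N n \<and> \<bar>snd y\<bar> \<le> N n \<and> (1 \<le> N n * d1 y \<or> 1 \<le> N n * d2 y)}"

lemma C: "compact (C n)" "C n \<subseteq> Q \<phi>"
proof -
  have "C n \<subseteq> cbox (- N n, - N n) (N n, N n)" by (auto simp: C_def cbox_Pair_eq abs_le_iff)
  then have "bounded (C n)" using bounded_cbox bounded_subset by blast
  moreover have "closed (C n)" unfolding C_def
    by (intro closed_Collect_conj closed_Collect_disj closed_Collect_le continuous_intros d_continuous)
  ultimately show "compact (C n)" by (simp add: compact_eq_bounded_closed)
  show "C n \<subseteq> Q \<phi>"
  proof
    fix y assume "y \<in> C n"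
    then have "0 < N n * d1 y \<or> 0 < N n * d2 y" by (auto simp: C_def)
    then show "y \<in> Q \<phi>" using N_pos[of n] by (simp add: Q_iff zero_less_mult_iff)
  qed
qed

lemma outside_C:
  assumes "y \<notin> C n"
  shows "tp n (fst y) * tp n (snd y) = 0 \<and> tp' n (fst y) * tp n (snd y) = 0 \<and>
      tp n (fst y) * tp' n (snd y) = 0
    \<or> cutN n y = 0 \<and> strip1 n y = 0 \<and> strip2 n y = 0"
proof (cases "\<bar>fst y\<bar> \<le> N n \<and> \<bar>snd y\<bar> \<le> N n")
  case True
  then have "N n * d1 y \<le> 1" "N n * d2 y \<le> 1" using assms by (auto simp: C_def)
  then show ?thesis by (simp add: cutN_def strip1_def strip2_def eta_eq_0)
next
  case False
  then have "\<bar>fst y\<bar> \<ge> real (Suc n) \<or> \<bar>snd y\<bar> \<ge> real (Suc n)" by (auto simp: N_def)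
  then show ?thesis using taper_eq_0 by (elim disjE) simp_all
qed

lemma g_eq_0: "y \<notin> C n \<Longrightarrow> g n y = 0" "y \<notin> C n \<Longrightarrow> g1 n y = 0" "y \<notin> C n \<Longrightarrow> g2 n y = 0"
  using outside_C[of y n] by (auto simp: g_def g1_def g2_def)

lemma continuous_tp: "continuous_on A f \<Longrightarrow> continuous_on A (\<lambda>x. tp n (f x))" "continuous_on A f \<Longrightarrow>
    continuous_on A (\<lambda>x. tp' n (f x))"
  by (rule continuous_on_compose2[OF continuous_taper(1)[of UNIV]] continuous_on_compose2[OF
      continuous_taper(2)[of UNIV]]; auto)+

lemma continuous_cut: "continuous_on A (cutN n)" "continuous_on A (strip1 n)" "continuous_on A
    (strip2 n)"
  unfolding cutN_def[abs_def] strip1_def[abs_def] strip2_def[abs_def]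
  by (intro continuous_intros eta_continuous d_continuous)+

lemma continuous_g: "continuous_on A (g n)" "continuous_on A (g1 n)" "continuous_on A (g2 n)"
  unfolding g_def[abs_def] g1_def[abs_def] g2_def[abs_def]
  by (intro continuous_intros continuous_cut continuous_tp)+

lemma cutN_deriv:
  "((\<lambda>t. cutN n (t, y)) has_real_derivative - sin \<phi> * strip2 n (x, y)) (at x)"
  "((\<lambda>t. cutN n (x, t)) has_real_derivative cos \<phi> * strip2 n (x, y) - strip1 n (x, y)) (at y)"
proof -
  have e2: "((\<lambda>t. \<eta> n (d2 (t, y))) has_real_derivative \<eta>' n (d2 (x, y)) * (- sin \<phi>)) (at x)"
    by (rule DERIV_chain2[OF eta_deriv]) (auto intro!: derivative_eq_intros simp: d2_def)
  show "((\<lambda>t. cutN n (t, y)) has_real_derivative - sin \<phi> * strip2 n (x, y)) (at x)"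
    unfolding cutN_def d1_def snd_conv
    by (rule DERIV_cong[OF DERIV_diff[OF DERIV_const DERIV_mult[OF DERIV_const DERIV_diff[OF
        DERIV_const e2]]]])
      (simp add: strip2_def d1_def)
  have f1: "((\<lambda>t. \<eta> n (d1 (x, t))) has_real_derivative \<eta>' n (d1 (x, y)) * (- 1)) (at y)"
    by (rule DERIV_chain2[OF eta_deriv]) (auto intro!: derivative_eq_intros simp: d1_def)
  have f2: "((\<lambda>t. \<eta> n (d2 (x, t))) has_real_derivative \<eta>' n (d2 (x, y)) * cos \<phi>) (at y)"
    by (rule DERIV_chain2[OF eta_deriv]) (auto intro!: derivative_eq_intros simp: d2_def)
  show "((\<lambda>t. cutN n (x, t)) has_real_derivative cos \<phi> * strip2 n (x, y) - strip1 n (x, y)) (at y)"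
    unfolding cutN_def
    by (rule DERIV_cong[OF DERIV_diff[OF DERIV_const DERIV_mult[OF DERIV_diff[OF DERIV_const f1]
        DERIV_diff[OF DERIV_const f2]]]])
      (simp add: strip1_def strip2_def algebra_simps)
qed

lemma g_deriv:
  "((\<lambda>t. g n (t, y)) has_real_derivative g1 n (x, y)) (at x)"
  "((\<lambda>t. g n (x, t)) has_real_derivative g2 n (x, y)) (at y)"
proof -
  show "((\<lambda>t. g n (t, y)) has_real_derivative g1 n (x, y)) (at x)"
    unfolding g_def fst_conv snd_conv
    by (rule DERIV_cong[OF DERIV_mult[OF cutN_deriv(1) DERIV_cmult_right[OF taper_deriv]]]) (simp
        add: g1_def)
  show "((\<lambda>t. g n (x, t)) has_real_derivative g2 n (x, y)) (at y)"
    unfolding g_def fst_conv snd_conv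
    by (rule DERIV_cong[OF DERIV_mult[OF cutN_deriv(2) DERIV_cmult[OF taper_deriv]]]) (simp add: g2_def)
qed

text \<open>The energy integrand split by the part of g that is differentiated: X collects the terms
  free of derivatives of \<open>cutN\<close>, Y and Z those of the two strips. The factors beside w
  in Y and Z are the normal derivatives on the two lines up to sign.\<close>

definition X where "X n = extend0 (Q \<phi>) (\<lambda>y. cutN n y *
  (tp n (fst y) * tp n (snd y) * ((w1 y)\<^sup>2 + (w2 y)\<^sup>2 + s\<^sup>2 * (w y)\<^sup>2)
    + w y * (w1 y * (tp' n (fst y) * tp n (snd y)) + w2 y * (tp n (fst y) * tp' n (snd y)))))"
definition Y where "Y n = extend0 (Q \<phi>) (\<lambda>y. tp n (fst y) * tp n (snd y) * (w y * (- w2 y)) *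
    strip1 n y)"
definition Z where "Z n = extend0 (Q \<phi>) (\<lambda>y. tp n (fst y) * tp n (snd y) * (w y * (cos \<phi> * w2 y -
    sin \<phi> * w1 y)) * strip2 n y)"

lemma XYZ_integrable: "integrable lborel (X n)" "integrable lborel (Y n)" "integrable lborel (Z n)"
  unfolding X_def Y_def Z_def
  by (rule extend0_integrable[OF U C];
      (intro continuous_intros continuous_cut continuous_tp w_cont w1_cont w2_cont)?; use outside_C
          in force)+

lemma integral_XYZ: "(\<integral>y. X n y \<partial>lborel) + (\<integral>y. Y n y \<partial>lborel) + (\<integral>y. Z n y \<partial>lborel) = 0"
proof -
  have "(\<integral>y. extend0 (Q \<phi>) (\<lambda>p. g n p * ((w1 p)\<^sup>2 + (w2 p)\<^sup>2 + s\<^sup>2 * (w p)\<^sup>2) + w p * (w1 p * g1 n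
      p + w2 p * g2 n p)) y \<partial>lborel) = 0"
    by (rule energy_identity[OF C[of n]]) (auto intro: g_deriv continuous_g g_eq_0)
  moreover have "extend0 (Q \<phi>) (\<lambda>p. g n p * ((w1 p)\<^sup>2 + (w2 p)\<^sup>2 + s\<^sup>2 * (w p)\<^sup>2) + w p * (w1 p *
      g1 n p + w2 p * g2 n p)) y
      = X n y + Y n y + Z n y" for y
    by (simp add: extend0_def X_def Y_def Z_def g_def g1_def g2_def algebra_simps)
  ultimately show ?thesis using XYZ_integrable[of n] by simp
qed

abbreviation p where "p t \<equiv> 1 / cosh (\<mu> * t)"

text \<open>The one-dimensional majorant: the corner singularity seen along one coordinate, with the
  decay of the weight.\<close>

definition m where "m t = sing \<epsilon> t / cosh (\<mu> * t)"

lemma M_nonneg: "0 \<le> M"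
proof -
  have "(0, - 1) \<in> Q \<phi>" by (simp add: Q_iff d1_def)
  from bd_w[OF this] show ?thesis by linarith
qed

lemma p_le_1: "p t \<le> 1" using cosh_real_ge_1[of "\<mu> * t"] by simp

lemma m_integrable: "integrable lborel m"
  unfolding m_def[abs_def] by (rule integrable_sing_over_cosh[OF eps mu(1)])

lemma strip_weight_integrable:
  "integrable lborel (\<lambda>z::real \<times> real. m (fst z) * indicator {1..3} (snd z))"
  using has_bochner_integral_lborel_product[OF has_bochner_integral_integrable[OF m_integrable]
      has_bochner_integral_real_indicator[of "{1..3}" "lborel :: real measure"]]
  by (auto simp: has_bochner_integral_iff)

lemma m_nonneg: "0 \<le> m t" by (simp add: m_def sing_nonneg)

lemma norm_sing:
  assumes "r \<noteq> 0" "\<bar>r\<bar> \<le> norm y" shows "sing \<epsilon> (norm y) \<le> sing \<epsilon> r"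
  by (rule sing_antimono[OF eps(1)]) (use assms in auto)

text \<open>Applied with r a Cartesian coordinate of y, which turns the singularity in |y| into a
  function of one variable.\<close>

lemma bd_ww:
  assumes "y \<in> Q \<phi>" "r \<noteq> 0" "\<bar>r\<bar> \<le> norm y"
  shows "\<bar>w y * w1 y\<bar> \<le> M\<^sup>2 * sing \<epsilon> r" "\<bar>w y * w2 y\<bar> \<le> M\<^sup>2 * sing \<epsilon> r"
proof -
  have *: "M * (M * sing \<epsilon> (norm y)) \<le> M * (M * sing \<epsilon> r)"
    using M_nonneg norm_sing[OF assms(2,3)] by (intro mult_left_mono) auto
  have "\<bar>w y\<bar> * \<bar>w1 y\<bar> \<le> M * (M * sing \<epsilon> (norm y))" "\<bar>w y\<bar> * \<bar>w2 y\<bar> \<le> M * (M * sing \<epsilon> (norm y))"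
    using bd_w[OF assms(1)] bd_w1[OF assms(1)] bd_w2[OF assms(1)] M_nonneg by (intro mult_mono; simp)+
  then show "\<bar>w y * w1 y\<bar> \<le> M\<^sup>2 * sing \<epsilon> r" "\<bar>w y * w2 y\<bar> \<le> M\<^sup>2 * sing \<epsilon> r"
    using * by (simp_all add: abs_mult power2_eq_square mult.assoc)
qed

lemma step1_bound: obtains B where "B \<ge> 0" "\<And>t. \<bar>smooth_step 1 t\<bar> \<le> B"
proof -
  obtain B where B: "\<And>t. \<bar>smooth_step 1 t\<bar> \<le> B" using smooth_step_bounded by blast
  show thesis by (rule that[OF order_trans[OF abs_ge_zero B] B])
qed

lemma taper_coef_bound:
  assumes B: "B \<ge> 0" "\<And>t. \<bar>smooth_step 1 t\<bar> \<le> B"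
  shows "\<bar>tp n a * tp n b * (1 - \<eta> n t) * smooth_step 1 u\<bar> \<le> p a * B"
proof -
  have "tp n a * tp n b \<le> p a * 1"
    using taper_bounds[of \<mu> n] p_le_1[of b] order_trans by (intro mult_mono) blast+
  then have "\<bar>tp n a * tp n b\<bar> \<le> p a" using taper_bounds(1)[of \<mu> n] by simp
  then have "\<bar>tp n a * tp n b\<bar> * \<bar>1 - \<eta> n t\<bar> \<le> p a * 1"
    using eta_range[of n t] by (intro mult_mono) auto
  from mult_mono[OF this B(2)[of u]] show ?thesis by (simp add: abs_mult)
qed

text \<open>In the coordinates y1 and N d1(y) the strip is R times [1, 3]. For y1 > 0 the point
  tends to \<open>Q1\<close>, where continuity and \<open>bc1\<close> give the limit 0; for y1 < 0
  it tends to a point inside \<open>Q \<phi>\<close>, where the strip is eventually switched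
  off.\<close>

lemma Y_tendsto: "(\<lambda>n. \<integral>y. Y n y \<partial>lborel) \<longlonglongrightarrow> 0"
proof -
  obtain B where B: "B \<ge> 0" "\<And>t. \<bar>smooth_step 1 t\<bar> \<le> B" using step1_bound by metis
  define W where "W z = (M\<^sup>2 * B) * (m (fst z) * indicator {1..3} (snd z))" for z :: "real \<times> real"
  have W: "integrable lborel W" unfolding W_def[abs_def] using strip_weight_integrable by simp
  \<comment> \<open>Makes \<open>snd z\<close> equal to N d1; its absolute value cancels the factor
    N in \<eta>'.\<close>
  define k where "k n = - 1 / N n" for n
  have k: "k n \<noteq> 0" "\<bar>k n\<bar> = 1 / N n" for n using N_pos[of n] by (auto simp: k_def)
  let ?pt = "\<lambda>n z. (fst z, 0 * fst z + k n * snd z)"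
  have d1: "N n * d1 (?pt n z) = snd z" for n z using N_pos[of n] by (simp add: d1_def k_def)
  have V0: "\<bar>k n\<bar> * Y n (?pt n z) = 0" if "snd z \<notin> {1..3}" for n z
  proof -
    have "\<eta>' n (d1 (?pt n z)) = 0" using that d1[of n z] eta_eq_0(2) eta_eq_1(2) by (metis
        atLeastAtMost_iff linorder_le_cases)
    then show ?thesis by (simp add: Y_def extend0_def strip1_def)
  qed
  have inQ: "?pt n z \<in> Q \<phi>" if "snd z \<in> {1..3}" for n z
  proof -
    have "0 < N n * d1 (?pt n z)" using that unfolding d1 by simp
    then show ?thesis using N_pos[of n] by (simp add: Q_iff zero_less_mult_iff)
  qed
  have V: "\<bar>k n\<bar> * Y n (?pt n z) = (tp n (fst (?pt n z)) * tp n (snd (?pt n z)) * (1 - \<eta> n (d2 (?pt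
      n z))) * smooth_step 1 (snd z - 2))
      * (w (?pt n z) * (- w2 (?pt n z)))" if "snd z \<in> {1..3}" for n z
    unfolding k(2) Y_def extend0_def strip1_def \<eta>'_def d1 using inQ[OF that] N_pos[of n] by simp
  note coef = taper_coef_bound[OF B]
  show ?thesis
  proof (rule strip_integral_tendsto_0[where \<alpha>=0 and k=k and W=W])
    show "integrable lborel (Y n)" for n by (rule XYZ_integrable)
    show "k n \<noteq> 0" for n by (rule k)
    show "integrable lborel W" by (rule W)
    show "AE z in lborel. \<bar>\<bar>k n\<bar> * Y n (?pt n z)\<bar> \<le> W z" for n
      using AE_fst_snd_neq(1)[of 0]
    proof eventually_elim
      case (elim z)
      show ?case
      proof (cases "snd z \<in> {1..3}")
        case True
        have "\<bar>fst z\<bar> \<le> norm (?pt n z)" using norm_fst_le[of "fst z"] by simp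
        from bd_ww(2)[OF inQ[OF True] elim this]
        have "\<bar>\<bar>k n\<bar> * Y n (?pt n z)\<bar> \<le> (p (fst z) * B) * (M\<^sup>2 * sing \<epsilon> (fst z))"
          unfolding V[OF True] abs_mult[of _ "w (?pt n z) * (- w2 (?pt n z))"]
          using coef[of n "fst (?pt n z)"] B(1) by (intro mult_mono) auto
        then show ?thesis using True by (simp add: W_def m_def mult_ac)
      next
        case False
        then show ?thesis unfolding V0[OF False] by (simp add: W_def)
      qed
    qed
    show "AE z in lborel. (\<lambda>n. \<bar>k n\<bar> * Y n (?pt n z)) \<longlonglongrightarrow> 0"
      using AE_fst_snd_neq(1)[of 0]
    proof eventually_elim
      case (elim z)
      show ?case
      proof (cases "snd z \<in> {1..3}")
        case False
        then show ?thesis unfolding V0[OF False] by simp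
      next
        case True
        show ?thesis
        proof (cases "fst z > 0")
          case pos: True
          have in_cl: "?pt n z \<in> closure (Q \<phi>) - {0}" for n
            using inQ[OF True, of n] pos closure_subset[of "Q \<phi>"] by (auto simp: zero_prod_def)
          have lim_cl: "(fst z, 0) \<in> closure (Q \<phi>) - {0}"
            using pos by (simp add: closure_Q[OF phi] zero_prod_def)
          have pt: "(\<lambda>n. ?pt n z) \<longlonglongrightarrow> (fst z, 0)"
          proof -
            have "(\<lambda>n. 0 * fst z + k n * snd z) \<longlonglongrightarrow> 0 * fst z + - 0 * snd z"
              unfolding k_def N_def using LIMSEQ_Suc[OF lim_1_over_n] by (intro tendsto_intros)
                  (auto intro: tendsto_minus_cancel)
            then show ?thesis by (intro tendsto_Pair) simp_all
          qed
          have "(\<lambda>n. w (?pt n z)) \<longlonglongrightarrow> w (fst z, 0)"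
            by (rule continuous_on_tendsto_compose[OF cl_w pt]) (use in_cl lim_cl in auto)
          moreover have "(\<lambda>n. w2 (?pt n z)) \<longlonglongrightarrow> w2 (fst z, 0)"
            by (rule continuous_on_tendsto_compose[OF cl_w2 pt]) (use in_cl lim_cl in auto)
          ultimately have "(\<lambda>n. w (?pt n z) * (- w2 (?pt n z))) \<longlonglongrightarrow> w (fst z, 0) * (- w2 (fst z, 0))"
            by (intro tendsto_intros)
          then have *: "(\<lambda>n. w (?pt n z) * (- w2 (?pt n z))) \<longlonglongrightarrow> 0" using bc1[OF pos] by simp
          have "Bseq (\<lambda>n. tp n (fst (?pt n z)) * tp n (snd (?pt n z)) * (1 - \<eta> n (d2 (?pt n z))) *
              smooth_step 1 (snd z - 2))"
            using coef by (intro BseqI'[of _ "p (fst z) * B"]) simp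
          from Bseq_mult_tendsto_0[OF this *] show ?thesis unfolding V[OF True] .
        next
          case False
          then have neg: "fst z < 0" using elim by simp
          \<comment> \<open>The extra |snd z cos \<phi>| compensates the displacement of the point
            from the line in N d2, so that N d2 \<ge> 3 still follows.\<close>
          have "\<forall>\<^sub>F n in sequentially. N n * (- fst z * sin \<phi>) \<ge> 3 + \<bar>snd z * cos \<phi>\<bar>"
            by (rule eventually_N_ge) (use neg sin_pos in \<open>simp add: mult_neg_pos\<close>)
          then have "\<forall>\<^sub>F n in sequentially. \<bar>k n\<bar> * Y n (?pt n z) = 0"
          proof eventually_elim
            case (elim n)
            have "N n * d2 (?pt n z) = N n * (- fst z * sin \<phi>) - snd z * cos \<phi>"
              using N_pos[of n] by (simp add: d2_def k_def field_simps)
            also have "\<dots> \<ge> 3" using elim by linarith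
            finally have "\<eta> n (d2 (?pt n z)) = 1" by (rule eta_eq_1)
            then show ?case by (simp add: Y_def extend0_def strip1_def)
          qed
          then show ?thesis by (rule tendsto_eventually)
        qed
      qed
    qed
  qed
qed

text \<open>The same for the second line, in the coordinates y2 and N d2(y). That line is y1 = (cos
  \<phi> / sin \<phi>) y2; its half y2 > 0 is \<open>Q2 \<phi>\<close>, and on the half y2 < 0 the
  distance d1 is positive.\<close>

lemma Z_tendsto: "(\<lambda>n. \<integral>y. Z n y \<partial>lborel) \<longlonglongrightarrow> 0"
proof -
  obtain B where B: "B \<ge> 0" "\<And>t. \<bar>smooth_step 1 t\<bar> \<le> B" using step1_bound by metis
  define W where "W z = (2 * M\<^sup>2 * B / sin \<phi>) * (m (fst z) * indicator {1..3} (snd z))" for z ::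
      "real \<times> real"
  have W: "integrable lborel W" unfolding W_def[abs_def] using strip_weight_integrable by simp
  \<comment> \<open>d2 changes by - sin \<phi> per unit of y1, so this factor makes
    \<open>snd z\<close> equal to N d2.\<close>
  define k where "k n = - 1 / (N n * sin \<phi>)" for n
  define \<alpha> where "\<alpha> = cos \<phi> / sin \<phi>"
  have k: "k n \<noteq> 0" "\<bar>k n\<bar> = 1 / (N n * sin \<phi>)" for n using N_pos[of n] sin_pos by (auto simp: k_def)
  let ?pt = "\<lambda>n z. (\<alpha> * fst z + k n * snd z, fst z)"
  have d2: "N n * d2 (?pt n z) = snd z" for n z
  proof -
    have "d2 (?pt n z) = fst z * cos \<phi> - (\<alpha> * sin \<phi>) * fst z - (k n * sin \<phi>) * snd z"
      by (simp add: d2_def algebra_simps)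
    also have "\<alpha> * sin \<phi> = cos \<phi>" using sin_pos by (simp add: \<alpha>_def)
    also have "k n * sin \<phi> = - 1 / N n" using sin_pos by (simp add: k_def)
    finally show ?thesis using N_pos[of n] by simp
  qed
  have V0: "\<bar>k n\<bar> * Z n (?pt n z) = 0" if "snd z \<notin> {1..3}" for n z
  proof -
    have "\<eta>' n (d2 (?pt n z)) = 0" using that d2[of n z] eta_eq_0(2) eta_eq_1(2) by (metis
        atLeastAtMost_iff linorder_le_cases)
    then show ?thesis by (simp add: Z_def extend0_def strip2_def)
  qed
  have inQ: "?pt n z \<in> Q \<phi>" if "snd z \<in> {1..3}" for n z
  proof -
    have "0 < N n * d2 (?pt n z)" using that unfolding d2 by simp
    then show ?thesis using N_pos[of n] by (simp add: Q_iff zero_less_mult_iff)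
  qed
  have V: "\<bar>k n\<bar> * Z n (?pt n z) = (tp n (snd (?pt n z)) * tp n (fst (?pt n z)) * (1 - \<eta> n (d1 (?pt
      n z))) * smooth_step 1 (snd z - 2))
      * (w (?pt n z) * (cos \<phi> * w2 (?pt n z) - sin \<phi> * w1 (?pt n z)) / sin \<phi>)" if
          "snd z \<in> {1..3}" for n z
    unfolding k(2) Z_def extend0_def strip2_def \<eta>'_def d2 using inQ[OF that] N_pos[of n] sin_pos by simp
  note coef = taper_coef_bound[OF B]
  show ?thesis
  proof (rule strip_integral_tendsto_0'[where \<alpha>=\<alpha> and k=k and W=W])
    show "integrable lborel (Z n)" for n by (rule XYZ_integrable)
    show "k n \<noteq> 0" for n by (rule k)
    show "integrable lborel W" by (rule W)
    show "AE z in lborel. \<bar>\<bar>k n\<bar> * Z n (?pt n z)\<bar> \<le> W z" for n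
      using AE_fst_snd_neq(1)[of 0]
    proof eventually_elim
      case (elim z)
      show ?case
      proof (cases "snd z \<in> {1..3}")
        case True
        have "\<bar>fst z\<bar> \<le> norm (?pt n z)" using norm_snd_le[of "fst z"] by simp
        note b = bd_ww[OF inQ[OF True] elim this]
        have "\<bar>w (?pt n z) * (cos \<phi> * w2 (?pt n z) - sin \<phi> * w1 (?pt n z))\<bar> \<le>
            \<bar>cos \<phi>\<bar> * \<bar>w (?pt n z) * w2 (?pt n z)\<bar> + \<bar>sin \<phi>\<bar> * \<bar>w (?pt n z) * w1 (?pt n z)\<bar>"
          unfolding abs_mult[symmetric] right_diff_distrib by (rule order_trans[OF
              abs_triangle_ineq4]) (simp add: mult_ac)
        also have "\<dots> \<le> 1 * (M\<^sup>2 * sing \<epsilon> (fst z)) + 1 * (M\<^sup>2 * sing \<epsilon> (fst z))"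
          by (intro add_mono mult_mono b) auto
        finally have "\<bar>w (?pt n z) * (cos \<phi> * w2 (?pt n z) - sin \<phi> * w1 (?pt n z)) / sin \<phi>\<bar> \<le>
            2 * (M\<^sup>2 * sing \<epsilon> (fst z)) / sin \<phi>"
          unfolding abs_divide[of _ "sin \<phi>"] abs_of_pos[OF sin_pos] using sin_pos by (intro
              divide_right_mono) (auto simp: mult.commute)
        then have "\<bar>\<bar>k n\<bar> * Z n (?pt n z)\<bar> \<le> (p (fst z) * B) * (2 * (M\<^sup>2 * sing \<epsilon> (fst z)) / sin \<phi>)"
          unfolding V[OF True] abs_mult[of _ "w (?pt n z) * (cos \<phi> * w2 (?pt n z) - sin \<phi> * w1 (?pt
              n z)) / sin \<phi>"]
          using coef[of n "snd (?pt n z)"] B(1) by (intro mult_mono) auto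
        then show ?thesis using True by (simp add: W_def m_def mult_ac)
      next
        case False
        then show ?thesis unfolding V0[OF False] by (simp add: W_def)
      qed
    qed
    show "AE z in lborel. (\<lambda>n. \<bar>k n\<bar> * Z n (?pt n z)) \<longlonglongrightarrow> 0"
      using AE_fst_snd_neq(1)[of 0]
    proof eventually_elim
      case (elim z)
      show ?case
      proof (cases "snd z \<in> {1..3}")
        case False
        then show ?thesis unfolding V0[OF False] by simp
      next
        case True
        show ?thesis
        proof (cases "fst z > 0")
          case pos: True
          \<comment> \<open>The distance from the corner of the limit point on
            \<open>Q2 \<phi>\<close>.\<close>
          define r where "r = fst z / sin \<phi>"
          have r: "r > 0" "(\<alpha> * fst z, fst z) = (r * cos \<phi>, r * sin \<phi>)"
            using pos sin_pos by (auto simp: r_def \<alpha>_def)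
          have in_cl: "?pt n z \<in> closure (Q \<phi>) - {0}" for n
            using inQ[OF True, of n] pos closure_subset[of "Q \<phi>"] by (auto simp: zero_prod_def)
          have lim_cl: "(\<alpha> * fst z, fst z) \<in> closure (Q \<phi>) - {0}"
            unfolding r(2) using r(1) sin_pos by (simp add: closure_Q[OF phi] mult_ac zero_prod_def)
          have pt: "(\<lambda>n. ?pt n z) \<longlonglongrightarrow> (\<alpha> * fst z, fst z)"
          proof -
            have "(\<lambda>n. (- 1 / sin \<phi>) * (1 / real (Suc n))) \<longlonglongrightarrow> (- 1 / sin \<phi>) * 0"
              by (intro tendsto_intros LIMSEQ_Suc[OF lim_1_over_n])
            moreover have "k = (\<lambda>n. (- 1 / sin \<phi>) * (1 / real (Suc n)))"
              by (simp add: k_def N_def fun_eq_iff del: of_nat_Suc)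
            ultimately have "k \<longlonglongrightarrow> (- 1 / sin \<phi>) * 0" by simp
            then have "(\<lambda>n. \<alpha> * fst z + k n * snd z) \<longlonglongrightarrow> \<alpha> * fst z + (- 1 / sin \<phi>) * 0 * snd z"
              by (intro tendsto_intros)
            then show ?thesis by (intro tendsto_Pair) simp_all
          qed
          have "(\<lambda>n. w (?pt n z)) \<longlonglongrightarrow> w (\<alpha> * fst z, fst z)"
            by (rule continuous_on_tendsto_compose[OF cl_w pt]) (use in_cl lim_cl in auto)
          moreover have "(\<lambda>n. w2 (?pt n z)) \<longlonglongrightarrow> w2 (\<alpha> * fst z, fst z)"
            by (rule continuous_on_tendsto_compose[OF cl_w2 pt]) (use in_cl lim_cl in auto)
          moreover have "(\<lambda>n. w1 (?pt n z)) \<longlonglongrightarrow> w1 (\<alpha> * fst z, fst z)"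
            by (rule continuous_on_tendsto_compose[OF cl_w1 pt]) (use in_cl lim_cl in auto)
          ultimately have "(\<lambda>n. w (?pt n z) * (cos \<phi> * w2 (?pt n z) - sin \<phi> * w1 (?pt n z)) / sin \<phi>)
              \<longlonglongrightarrow> w (\<alpha> * fst z, fst z) * (cos \<phi> * w2 (\<alpha> * fst z, fst z) - sin \<phi> * w1 (\<alpha> * fst z,
                  fst z)) / sin \<phi>"
            using sin_pos by (intro tendsto_intros) auto
          moreover have "w (\<alpha> * fst z, fst z) * (cos \<phi> * w2 (\<alpha> * fst z,
              fst z) - sin \<phi> * w1 (\<alpha> * fst z, fst z)) = 0"
            using bc2[OF r(1)] unfolding r(2) by auto
          ultimately have *: "(\<lambda>n. w (?pt n z) * (cos \<phi> * w2 (?pt n z) - sin \<phi> * w1 (?pt n z)) /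
              sin \<phi>) \<longlonglongrightarrow> 0"
            by simp
          have "Bseq (\<lambda>n. tp n (snd (?pt n z)) * tp n (fst (?pt n z)) * (1 - \<eta> n (d1 (?pt n z))) *
              smooth_step 1 (snd z - 2))"
            using coef by (intro BseqI'[of _ "p (fst z) * B"]) simp
          from Bseq_mult_tendsto_0[OF this *] show ?thesis unfolding V[OF True] .
        next
          case False
          then have neg: "fst z < 0" using elim by simp
          have "\<forall>\<^sub>F n in sequentially. N n * (- fst z) \<ge> 3"
            by (rule eventually_N_ge) (use neg in simp)
          then have "\<forall>\<^sub>F n in sequentially. \<bar>k n\<bar> * Z n (?pt n z) = 0"
          proof eventually_elim
            case (elim n)
            then have "\<eta> n (d1 (?pt n z)) = 1" by (intro eta_eq_1) (simp add: d1_def)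
            then show ?case by (simp add: Z_def extend0_def strip2_def)
          qed
          then show ?thesis by (rule tendsto_eventually)
        qed
      qed
    qed
  qed
qed

section \<open>The limit of the interior energy\<close>

abbreviation p' where "p' t \<equiv> - (\<mu> * sinh (\<mu> * t) / (cosh (\<mu> * t))\<^sup>2)"

definition Xlim where "Xlim = extend0 (Q \<phi>) (\<lambda>y.
  p (fst y) * p (snd y) * ((w1 y)\<^sup>2 + (w2 y)\<^sup>2 + s\<^sup>2 * (w y)\<^sup>2)
    + w y * (w1 y * (p' (fst y) * p (snd y)) + w2 y * (p (fst y) * p' (snd y))))"

lemma Xlim_measurable: "Xlim \<in> borel_measurable borel"
  unfolding Xlim_def
  by (rule extend0_measurable[OF U]) (intro continuous_intros w_cont w1_cont w2_cont; simp)

text \<open>The gradient squared may grow like |y| powr (- 2 \<epsilon>). Giving one factor to each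
  coordinate bounds it by a product of one-dimensional singularities, each integrable since
  \<epsilon> < 1. Both coordinates must be nonzero, because \<open>sing\<close> is 0 at 0.\<close>

lemma X_dominated:
  obtains K where "\<And>n y. fst y \<noteq> 0 \<Longrightarrow> snd y \<noteq> 0 \<Longrightarrow> \<bar>X n y\<bar> \<le> K * (m (fst y) * m (snd y))"
proof -
  obtain L where L: "L \<ge> 0" "\<And>n t. \<bar>tp' n t\<bar> \<le> L / cosh (\<mu> * t)" using taper'_bound[OF mu(1)] by metis
  define K where "K = M\<^sup>2 * (2 + s\<^sup>2 + 2 * L)"
  have K: "K \<ge> 0" using L by (simp add: K_def)
  have "\<bar>X n y\<bar> \<le> K * (m (fst y) * m (snd y))" if ne: "fst y \<noteq> 0" "snd y \<noteq> 0" for n y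
  proof (cases "y \<in> Q \<phi>")
    case False
    then show ?thesis using K m_nonneg by (simp add: X_def extend0_def)
  next
    case True
    define q where "q = sing \<epsilon> (fst y) * sing \<epsilon> (snd y)"
    define P where "P = p (fst y) * p (snd y)"
    have nrm: "\<bar>fst y\<bar> \<le> norm y" "\<bar>snd y\<bar> \<le> norm y"
      using norm_fst_le[of "fst y" "snd y"] norm_snd_le[of "snd y" "fst y"] by auto
    have sf: "1 \<le> sing \<epsilon> (fst y)" "1 \<le> sing \<epsilon> (snd y)" using ne eps by (auto intro: sing_ge_1)
    have q1: "sing \<epsilon> (fst y) \<le> q" "1 \<le> q"
      unfolding q_def using sf mult_left_mono[OF sf(2), of "sing \<epsilon> (fst y)"] mult_mono[OF sf] by auto
    have nq: "(sing \<epsilon> (norm y))\<^sup>2 \<le> q"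
      unfolding q_def power2_eq_square
      by (intro mult_mono norm_sing ne nrm sing_nonneg)
    have sq: "f\<^sup>2 \<le> M\<^sup>2 * q" if "\<bar>f\<bar> \<le> M * sing \<epsilon> (norm y)" for f
    proof -
      have "\<bar>f\<bar>\<^sup>2 \<le> (M * sing \<epsilon> (norm y))\<^sup>2" using that by (intro power_mono) auto
      also have "\<dots> \<le> M\<^sup>2 * q" unfolding power_mult_distrib using nq by (intro mult_left_mono) auto
      finally show ?thesis by simp
    qed
    have w2q: "(w y)\<^sup>2 \<le> M\<^sup>2 * q"
    proof -
      have "\<bar>w y\<bar>\<^sup>2 \<le> M\<^sup>2" using bd_w[OF True] by (intro power_mono) auto
      also have "\<dots> \<le> M\<^sup>2 * q" using q1 mult_left_mono[of 1 q "M\<^sup>2"] by simp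
      finally show ?thesis by simp
    qed
    have A: "(w1 y)\<^sup>2 + (w2 y)\<^sup>2 + s\<^sup>2 * (w y)\<^sup>2 \<le> M\<^sup>2 * q + M\<^sup>2 * q + s\<^sup>2 * (M\<^sup>2 * q)"
      using sq[OF bd_w1[OF True]] sq[OF bd_w2[OF True]] w2q by (intro add_mono mult_left_mono) auto
    have ww: "\<bar>w y * w1 y\<bar> \<le> M\<^sup>2 * q" "\<bar>w y * w2 y\<bar> \<le> M\<^sup>2 * q"
      using bd_ww[OF True ne(1) nrm(1)] mult_left_mono[OF q1(1), of "M\<^sup>2"] by auto
    have P0: "0 \<le> P" by (simp add: P_def)
    have t1: "tp n (fst y) * tp n (snd y) \<le> P"
      unfolding P_def by (intro mult_mono taper_bounds) simp
    have t1': "0 \<le> tp n (fst y) * tp n (snd y)" by (intro mult_nonneg_nonneg taper_bounds)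
    have t2: "\<bar>tp' n (fst y) * tp n (snd y)\<bar> \<le> L * P"
    proof -
      have "\<bar>tp' n (fst y)\<bar> * \<bar>tp n (snd y)\<bar> \<le> (L / cosh (\<mu> * fst y)) * p (snd y)"
        using taper_bounds[of \<mu> n "snd y"] L by (intro mult_mono) auto
      then show ?thesis by (simp add: abs_mult P_def)
    qed
    have t3: "\<bar>tp n (fst y) * tp' n (snd y)\<bar> \<le> L * P"
    proof -
      have "\<bar>tp n (fst y)\<bar> * \<bar>tp' n (snd y)\<bar> \<le> p (fst y) * (L / cosh (\<mu> * snd y))"
        using taper_bounds[of \<mu> n "fst y"] L by (intro mult_mono) auto
      then show ?thesis by (simp add: abs_mult P_def)
    qed
    let ?A = "tp n (fst y) * tp n (snd y) * ((w1 y)\<^sup>2 + (w2 y)\<^sup>2 + s\<^sup>2 * (w y)\<^sup>2)"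
    let ?B = "(w y * w1 y) * (tp' n (fst y) * tp n (snd y))" and ?C =
        "(w y * w2 y) * (tp n (fst y) * tp' n (snd y))"
    have "\<bar>?A\<bar> \<le> P * (M\<^sup>2 * q + M\<^sup>2 * q + s\<^sup>2 * (M\<^sup>2 * q))"
      unfolding abs_mult[of "tp n (fst y) * tp n (snd y)"]
      using t1 t1' A P0 by (intro mult_mono) auto
    moreover have "\<bar>?B\<bar> \<le> (M\<^sup>2 * q) * (L * P)"
      unfolding abs_mult[of "w y * w1 y"] using ww t2 q1 by (intro mult_mono) auto
    moreover have "\<bar>?C\<bar> \<le> (M\<^sup>2 * q) * (L * P)"
      unfolding abs_mult[of "w y * w2 y"] using ww t3 q1 by (intro mult_mono) auto
    ultimately have "\<bar>?A + ?B + ?C\<bar> \<le> P * (M\<^sup>2 * q + M\<^sup>2 * q + s\<^sup>2 * (M\<^sup>2 * q)) + (M\<^sup>2 * q) * (L *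
        P) + (M\<^sup>2 * q) * (L * P)"
      by linarith
    also have "\<dots> = K * (P * q)" by (simp add: K_def algebra_simps)
    finally have "\<bar>cutN n y\<bar> * \<bar>?A + ?B + ?C\<bar> \<le> 1 * (K * (P * q))"
      using cutN_range[of n y] by (intro mult_mono) auto
    moreover have "X n y = cutN n y * (?A + ?B + ?C)"
      using True by (simp add: X_def extend0_def algebra_simps)
    moreover have "P * q = m (fst y) * m (snd y)" by (simp add: P_def q_def m_def)
    ultimately show ?thesis by (simp add: abs_mult)
  qed
  then show thesis by (rule that)
qed

lemma X_tendsto: "AE y in lborel. (\<lambda>n. X n y) \<longlonglongrightarrow> Xlim y"
proof (intro always_eventually allI)
  fix y
  show "(\<lambda>n. X n y) \<longlonglongrightarrow> Xlim y"
  proof (cases "y \<in> Q \<phi>")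
    case True
    have "(\<lambda>n. cutN n y * (tp n (fst y) * tp n (snd y) * ((w1 y)\<^sup>2 + (w2 y)\<^sup>2 + s\<^sup>2 * (w y)\<^sup>2)
        + w y * (w1 y * (tp' n (fst y) * tp n (snd y)) + w2 y * (tp n (fst y) * tp' n (snd y)))))
      \<longlonglongrightarrow> 1 * (p (fst y) * p (snd y) * ((w1 y)\<^sup>2 + (w2 y)\<^sup>2 + s\<^sup>2 * (w y)\<^sup>2)
        + w y * (w1 y * (p' (fst y) * p (snd y)) + w2 y * (p (fst y) * p' (snd y))))"
      by (intro tendsto_mult tendsto_add tendsto_const cutN_tendsto[OF True] taper_tendsto)
    then show ?thesis using True by (simp add: X_def Xlim_def extend0_def)
  qed (simp add: X_def Xlim_def extend0_def)
qed

text \<open>Coercivity: the derivative of each weight factor is at most \<mu> times the factor, and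
  |w f| \<le> (w^2 + f^2) / 2. So the cross terms cost at most \<mu> / 2 of each squared derivative
  and \<mu> of w^2, which leaves half of s^2 w^2.\<close>

lemma Xlim_lower: "y \<in> Q \<phi> \<Longrightarrow> p (fst y) * p (snd y) * (s\<^sup>2 / 2 * (w y)\<^sup>2) \<le> Xlim y"
proof -
  assume y: "y \<in> Q \<phi>"
  define P where "P = p (fst y) * p (snd y)"
  have P: "0 \<le> P" by (simp add: P_def)
  have t: "\<bar>p' (fst y) * p (snd y)\<bar> \<le> \<mu> * P" "\<bar>p (fst y) * p' (snd y)\<bar> \<le> \<mu> * P"
  proof -
    have "\<bar>p' (fst y)\<bar> * p (snd y) \<le> \<mu> / cosh (\<mu> * fst y) * p (snd y)"
      unfolding abs_minus by (intro mult_right_mono inverse_cosh_deriv_bound[OF mu(1)]) simp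
    then show "\<bar>p' (fst y) * p (snd y)\<bar> \<le> \<mu> * P" by (simp add: abs_mult P_def)
    have "p (fst y) * \<bar>p' (snd y)\<bar> \<le> p (fst y) * (\<mu> / cosh (\<mu> * snd y))"
      unfolding abs_minus by (intro mult_left_mono inverse_cosh_deriv_bound[OF mu(1)]) simp
    then show "\<bar>p (fst y) * p' (snd y)\<bar> \<le> \<mu> * P" by (simp add: abs_mult P_def)
  qed
  have amgm: "\<bar>w y * f\<bar> \<le> ((w y)\<^sup>2 + f\<^sup>2) / 2" for f
  proof -
    have "0 \<le> (\<bar>w y\<bar> - \<bar>f\<bar>)\<^sup>2" by simp
    then show ?thesis by (simp add: power2_diff abs_mult)
  qed
  have "\<bar>w y * w1 y * (p' (fst y) * p (snd y))\<bar> \<le> ((w y)\<^sup>2 + (w1 y)\<^sup>2) / 2 * (\<mu> * P)"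
    unfolding abs_mult[of "w y * w1 y"] using amgm t(1) by (intro mult_mono) auto
  moreover have "\<bar>w y * w2 y * (p (fst y) * p' (snd y))\<bar> \<le> ((w y)\<^sup>2 + (w2 y)\<^sup>2) / 2 * (\<mu> * P)"
    unfolding abs_mult[of "w y * w2 y"] using amgm t(2) by (intro mult_mono) auto
  moreover have "Xlim y = P * ((w1 y)\<^sup>2 + (w2 y)\<^sup>2 + s\<^sup>2 * (w y)\<^sup>2) + w y * w1 y * (p' (fst y) * p
      (snd y)) + w y * w2 y * (p (fst y) * p' (snd y))"
    using y by (simp add: Xlim_def extend0_def P_def algebra_simps)
  ultimately have "Xlim y \<ge> P * ((w1 y)\<^sup>2 + (w2 y)\<^sup>2 + s\<^sup>2 * (w y)\<^sup>2) - ((w y)\<^sup>2 + (w1 y)\<^sup>2) / 2 *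
      (\<mu> * P) - ((w y)\<^sup>2 + (w2 y)\<^sup>2) / 2 * (\<mu> * P)"
    by linarith
  also have "P * ((w1 y)\<^sup>2 + (w2 y)\<^sup>2 + s\<^sup>2 * (w y)\<^sup>2) - ((w y)\<^sup>2 + (w1 y)\<^sup>2) / 2 * (\<mu> * P) - ((w
      y)\<^sup>2 + (w2 y)\<^sup>2) / 2 * (\<mu> * P)
      = P * ((1 - \<mu> / 2) * (w1 y)\<^sup>2 + (1 - \<mu> / 2) * (w2 y)\<^sup>2 + (s\<^sup>2 - \<mu>) * (w y)\<^sup>2)"
    by (simp add: field_simps)
  finally have "P * ((1 - \<mu> / 2) * (w1 y)\<^sup>2 + (1 - \<mu> / 2) * (w2 y)\<^sup>2 + (s\<^sup>2 - \<mu>) * (w y)\<^sup>2) \<le> Xlim y" .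
  moreover have "P * (s\<^sup>2 / 2 * (w y)\<^sup>2) \<le> P * ((1 - \<mu> / 2) * (w1 y)\<^sup>2 + (1 - \<mu> / 2) * (w2 y)\<^sup>2 +
      (s\<^sup>2 - \<mu>) * (w y)\<^sup>2)"
  proof (intro mult_left_mono P)
    have "0 \<le> (1 - \<mu> / 2) * (w1 y)\<^sup>2" "0 \<le> (1 - \<mu> / 2) * (w2 y)\<^sup>2" using mu by auto
    moreover have "s\<^sup>2 / 2 * (w y)\<^sup>2 \<le> (s\<^sup>2 - \<mu>) * (w y)\<^sup>2" using mu by (intro mult_right_mono) auto
    ultimately show "s\<^sup>2 / 2 * (w y)\<^sup>2 \<le> (1 - \<mu> / 2) * (w1 y)\<^sup>2 + (1 - \<mu> / 2) * (w2 y)\<^sup>2 + (s\<^sup>2 -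
        \<mu>) * (w y)\<^sup>2"
      by linarith
  qed
  ultimately show ?thesis unfolding P_def by linarith
qed

theorem solution_eq_0:
  assumes "y \<in> Q \<phi>" shows "w y = 0"
proof -
  obtain K where K: "\<And>n y. fst y \<noteq> 0 \<Longrightarrow> snd y \<noteq> 0 \<Longrightarrow> \<bar>X n y\<bar> \<le> K * (m (fst y) * m (snd y))"
    using X_dominated by metis
  have mm: "integrable lborel (\<lambda>y. K * (m (fst y) * m (snd y)))"
    using has_bochner_integral_lborel_product[OF has_bochner_integral_integrable[OF m_integrable]
        has_bochner_integral_integrable[OF m_integrable]]
    by (auto simp: has_bochner_integral_iff)
  have bd: "AE y in lborel. norm (X n y) \<le> K * (m (fst y) * m (snd y))" for n
    using AE_fst_snd_neq(1)[of 0] AE_fst_snd_neq(2)[of 0] by eventually_elim (simp add: K)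
  have meas: "Xlim \<in> borel_measurable lborel" "X n \<in> borel_measurable lborel" for n
    using Xlim_measurable XYZ_integrable(1)[of n] by auto
  have Xint: "integrable lborel Xlim"
    by (rule integrable_dominated_convergence[OF meas mm X_tendsto bd])
  have "(\<lambda>n. \<integral>y. X n y \<partial>lborel) \<longlonglongrightarrow> (\<integral>y. Xlim y \<partial>lborel)"
    by (rule integral_dominated_convergence[OF meas mm X_tendsto bd])
  moreover have "(\<lambda>n. \<integral>y. X n y \<partial>lborel) \<longlonglongrightarrow> - 0 - 0"
  proof -
    have "(\<integral>y. X n y \<partial>lborel) = - (\<integral>y. Y n y \<partial>lborel) - (\<integral>y. Z n y \<partial>lborel)" for n
      using integral_XYZ[of n] by linarith
    then show ?thesis by (simp only:) (intro tendsto_intros Y_tendsto Z_tendsto)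
  qed
  ultimately have int0: "(\<integral>y. Xlim y \<partial>lborel) = 0" using LIMSEQ_unique by fastforce
  have nonneg: "0 \<le> Xlim y" for y
  proof (cases "y \<in> Q \<phi>")
    case True
    have "0 \<le> p (fst y) * p (snd y) * (s\<^sup>2 / 2 * (w y)\<^sup>2)" by simp
    with Xlim_lower[OF True] show ?thesis by linarith
  qed (simp add: Xlim_def extend0_def)
  have "AE y in lborel. Xlim y = 0"
    using integral_nonneg_eq_0_iff_AE[OF Xint] nonneg int0 by auto
  then obtain N where N: "N \<in> null_sets lborel" "{y. Xlim y \<noteq> 0} \<subseteq> N"
    by (auto simp: eventually_ae_filter)
  have "{y \<in> Q \<phi>. w y \<noteq> 0} \<subseteq> N"
  proof
    fix y assume y: "y \<in> {y \<in> Q \<phi>. w y \<noteq> 0}"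
    then have "0 < p (fst y) * p (snd y) * (s\<^sup>2 / 2 * (w y)\<^sup>2)" using s by simp
    with Xlim_lower[of y] y have "Xlim y \<noteq> 0" by auto
    then show "y \<in> N" using N(2) by blast
  qed
  moreover have "negligible N"
    unfolding negligible_iff_null_sets using N(1) by (rule null_sets_completionI)
  ultimately have "negligible {y \<in> Q \<phi>. w y \<noteq> 0}" using negligible_subset by blast
  \<comment> \<open>A null set that is open is empty; this passes from almost everywhere to
    everywhere.\<close>
  moreover have "open {y \<in> Q \<phi>. w y \<noteq> 0}"
  proof -
    have "open (Q \<phi> \<inter> w -` (- {0}))" by (rule continuous_open_preimage[OF w_cont U]) auto
    moreover have "Q \<phi> \<inter> w -` (- {0}) = {y \<in> Q \<phi>. w y \<noteq> 0}" by auto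
    ultimately show ?thesis by simp
  qed
  ultimately have "{y \<in> Q \<phi>. w y \<noteq> 0} = {}" using open_not_negligible by blast
  then show ?thesis using assms by blast
qed

end

section \<open>Uniqueness\<close>

lemma zero_notin_Q: "0 < \<phi> \<Longrightarrow> \<phi> < pi \<Longrightarrow> 0 \<notin> Q \<phi>"
  by (simp add: Q_eq)

lemma laplacian_eq_0:
  assumes "open V" "\<And>y. y \<in> V \<Longrightarrow> f y = 0" "y \<in> V"
  shows "laplacian f y = 0"
  unfolding laplacian_def
  by (rule sum.neutral, rule ballI, rule iter_pd_eq_0[OF segment_set_UNIV assms(1)]) (use assms in auto)

text \<open>At \<open>\<i> * s\<close> the equation and the homogeneous boundary conditions have
  real coefficients, so they survive a real-linear p. Stating it for p treats real and imaginary
  part at once; |p z| \<le> norm z transfers the bounds of \<open>E_space\<close>.\<close>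

lemma wedge_helmholtz_projection:
  fixes p :: "complex \<Rightarrow> real"
  assumes phi: "0 < \<phi>" "\<phi> < pi" and eps: "0 < \<epsilon>" "\<epsilon> < 1" and s: "s > 0"
    and f: "f \<in> E_space \<phi> \<epsilon>" and g: "g \<in> E_space \<phi> \<epsilon>"
    and hf: "helmholtz \<phi> (\<i> * of_real s) f" and hg: "helmholtz \<phi> (\<i> * of_real s) g"
    and b1: "\<And>y. y \<in> Q1 \<Longrightarrow> B1 bc \<phi> f y = B1 bc \<phi> g y"
    and b2: "\<And>y. y \<in> Q2 \<phi> \<Longrightarrow> B2 bc \<phi> f y = B2 bc \<phi> g y"
    and p: "bounded_linear p" "\<And>z. \<bar>p z\<bar> \<le> norm z"
  shows "\<exists>M. wedge_helmholtz \<phi> s (\<lambda>y. p (f y - g y)) (\<lambda>y. p (fst (grad \<phi> f y) - fst (grad \<phi> g y)))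
    (\<lambda>y. p (snd (grad \<phi> f y) - snd (grad \<phi> g y))) \<epsilon> M"
proof -
  let ?K = "closure (Q \<phi>)"
  define w where "w y = p (f y - g y)" for y
  define w1 where "w1 y = p (fst (grad \<phi> f y) - fst (grad \<phi> g y))" for y
  define w2 where "w2 y = p (snd (grad \<phi> f y) - snd (grad \<phi> g y))" for y
  have QK: "Q \<phi> \<subseteq> ?K - {0}" using closure_subset zero_notin_Q[OF phi] by blast
  have oQ: "open (Q \<phi>)" by (rule open_Q[OF phi])
  have pl: "linear p" using p(1) by (rule bounded_linear.linear)
  have p0: "p 0 = 0" using pl by (rule linear_0)
  have pr: "p (z * of_real r) = p z * r" for r z
    using linear_cmul[OF pl, of r z] by (simp add: scaleR_conv_of_real mult.commute)
  have pdiff: "p (a - b) = p a - p b" for a b using pl by (rule linear_diff)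
  have pcont: "continuous_on A (\<lambda>y. p (h y))" if
      "continuous_on A h" for A and h :: "real \<times> real \<Rightarrow> complex"
    using bounded_linear.continuous_on[OF p(1) that] .
  obtain Mf Mf' Mg Mg' where M:
    "\<And>y. y \<in> ?K \<Longrightarrow> norm (f y) \<le> Mf" "\<And>y. y \<in> ?K \<Longrightarrow> norm (g y) \<le> Mg"
    "\<And>y. y \<in> ?K - {0} \<Longrightarrow> (norm y / (1 + norm y)) powr \<epsilon> * norm (grad \<phi> f y) \<le> Mf'"
    "\<And>y. y \<in> ?K - {0} \<Longrightarrow> (norm y / (1 + norm y)) powr \<epsilon> * norm (grad \<phi> g y) \<le> Mg'"
    using f g unfolding E_space_def bdd_above_def by fastforce
  define Mm where "Mm = max (Mf + Mg) (Mf' + Mg')"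
  have cf: "continuous_on ?K f" "continuous_on ?K g"
    and cgr: "continuous_on (?K - {0}) (grad \<phi> f)" "continuous_on (?K - {0}) (grad \<phi> g)"
    using f g by (auto simp: E_space_def)
  have cw: "continuous_on ?K w" unfolding w_def[abs_def] by (intro pcont continuous_intros cf)
  have cw1: "continuous_on (?K - {0}) w1" unfolding w1_def[abs_def] by (intro pcont
      continuous_intros cgr)
  have cw2: "continuous_on (?K - {0}) w2" unfolding w2_def[abs_def] by (intro pcont
      continuous_intros cgr)
  define F where "F y = frechet_derivative f (at y within ?K)" for y
  define G where "G y = frechet_derivative g (at y within ?K)" for y
  have dF: "(f has_derivative F y) (at y within ?K)" and dG: "(g has_derivative G y) (at y within ?K)"
    if "y \<in> ?K - {0}" for y
    using f g that unfolding E_space_def F_def G_def frechet_derivative_works by blast+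
  have lin: "linear (F y)" "linear (G y)" if "y \<in> ?K - {0}" for y
    using has_derivative_linear[OF dF[OF that]] has_derivative_linear[OF dG[OF that]] by auto
  have FG: "F y (a, b) = a *\<^sub>R fst (grad \<phi> f y) + b *\<^sub>R snd (grad \<phi> f y)"
    "G y (a, b) = a *\<^sub>R fst (grad \<phi> g y) + b *\<^sub>R snd (grad \<phi> g y)" if "y \<in> ?K - {0}" for y a b
  proof -
    have e: "(a, b) = a *\<^sub>R (1, 0) + b *\<^sub>R (0, 1)" by simp
    show "F y (a, b) = a *\<^sub>R fst (grad \<phi> f y) + b *\<^sub>R snd (grad \<phi> f y)"
      unfolding e linear_add[OF lin(1)[OF that]] linear_cmul[OF lin(1)[OF that]] by (simp add:
          grad_def F_def)
    show "G y (a, b) = a *\<^sub>R fst (grad \<phi> g y) + b *\<^sub>R snd (grad \<phi> g y)"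
      unfolding e linear_add[OF lin(2)[OF that]] linear_cmul[OF lin(2)[OF that]] by (simp add:
          grad_def G_def)
  qed
  have dw: "(w has_derivative (\<lambda>h. fst h * w1 y + snd h * w2 y)) (at y)" if y: "y \<in> Q \<phi>" for y
  proof -
    have yK: "y \<in> ?K - {0}" using QK y by blast
    have "(w has_derivative (\<lambda>h. p (F y h - G y h))) (at y within ?K)"
      unfolding w_def[abs_def]
      by (rule bounded_linear.has_derivative[OF p(1) has_derivative_diff[OF dF[OF yK] dG[OF yK]]])
    \<comment> \<open>The derivative within the closure is an ordinary one at points of the open set
      \<open>Q \<phi>\<close>.\<close>
    then have "(w has_derivative (\<lambda>h. p (F y h - G y h))) (at y within Q \<phi>)"
      by (rule has_derivative_subset) (rule closure_subset)
    then have "(w has_derivative (\<lambda>h. p (F y h - G y h))) (at y)"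
      using at_within_open[OF y oQ] by simp
    moreover have "(\<lambda>h. p (F y h - G y h)) = (\<lambda>h. fst h * w1 y + snd h * w2 y)"
    proof
      fix h :: "real \<times> real"
      obtain a b where [simp]: "h = (a, b)" by (cases h)
      have "F y h - G y h = a *\<^sub>R (fst (grad \<phi> f y) - fst (grad \<phi> g y)) + b *\<^sub>R (snd (grad \<phi> f y) -
          snd (grad \<phi> g y))"
        by (simp add: FG[OF yK] scaleR_diff_right)
      then show "p (F y h - G y h) = fst h * w1 y + snd h * w2 y"
        by (simp add: w1_def w2_def linear_add[OF pl] linear_cmul[OF pl])
    qed
    ultimately show ?thesis by simp
  qed
  have grad_bound: "norm (grad \<phi> h y) \<le> Mh * sing \<epsilon> (norm y)"
    if "(norm y / (1 + norm y)) powr \<epsilon> * norm (grad \<phi> h y) \<le> Mh" "y \<noteq> 0" for h y Mh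
  proof -
    have "norm y / (1 + norm y) > 0" using that(2) by (simp add: add_pos_nonneg)
    then have "norm y / (1 + norm y) \<noteq> 0" by linarith
    then have "(norm y / (1 + norm y)) powr \<epsilon> > 0" by (simp only: powr_gt_zero not_False_eq_True)
    then show ?thesis using that(1) by (simp add: sing_def powr_minus field_simps)
  qed
  have bd: "norm (grad \<phi> f y) + norm (grad \<phi> g y) \<le> Mm * sing \<epsilon> (norm y)" if y: "y \<in> ?K - {0}" for y
  proof -
    have "norm (grad \<phi> f y) + norm (grad \<phi> g y) \<le> Mf' * sing \<epsilon> (norm y) + Mg' * sing \<epsilon> (norm y)"
      using y by (intro add_mono grad_bound M(3,4)) auto
    also have "\<dots> = (Mf' + Mg') * sing \<epsilon> (norm y)" by (simp add: distrib_right)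
    also have "\<dots> \<le> Mm * sing \<epsilon> (norm y)" unfolding Mm_def by (intro mult_right_mono sing_nonneg) simp
    finally show ?thesis .
  qed
  have p_le: "\<bar>p (a - b)\<bar> \<le> norm a + norm b" for a b
    by (rule order_trans[OF p(2) norm_triangle_ineq4])
  have comp_le: "norm (fst z) \<le> norm z" "norm (snd z) \<le> norm z" for z :: "complex \<times> complex"
    using norm_fst_le[of "fst z" "snd z"] norm_snd_le[of "snd z" "fst z"] by auto
  have "wedge_helmholtz \<phi> s w w1 w2 \<epsilon> Mm"
  proof unfold_locales
    show "open (Q \<phi>)" by (rule oQ)
    show "continuous_on (Q \<phi>) w" by (rule continuous_on_subset[OF cw]) (use QK in auto)
    show "continuous_on (Q \<phi>) w1" by (rule continuous_on_subset[OF cw1 QK])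
    show "continuous_on (Q \<phi>) w2" by (rule continuous_on_subset[OF cw2 QK])
    show "((\<lambda>t. w (t, y)) has_real_derivative w1 (x, y)) (at x)" if "(x, y) \<in> Q \<phi>" for x y
    proof -
      have "((\<lambda>t. (t, y)) has_derivative (\<lambda>h. (h, 0))) (at x)" by (auto intro!: derivative_eq_intros)
      from has_derivative_compose[OF this dw[OF that]] show ?thesis
        by (rule has_derivative_imp_has_field_derivative) simp
    qed
    show "((\<lambda>t. w (x, t)) has_real_derivative w2 (x, y)) (at y)" if "(x, y) \<in> Q \<phi>" for x y
    proof -
      have "((\<lambda>t. (x, t)) has_derivative (\<lambda>h. (0, h))) (at y)" by (auto intro!: derivative_eq_intros)
      from has_derivative_compose[OF this dw[OF that]] show ?thesis
        by (rule has_derivative_imp_has_field_derivative) simp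
    qed
    show "(\<integral>y. extend0 (Q \<phi>) (\<lambda>y. w y * (s\<^sup>2 * \<psi> y - L y)) y \<partial>lborel) = 0"
      if \<psi>: "smooth_within UNIV (\<lambda>y. complex_of_real (\<psi> y))" "compact (closure {y. \<psi> y \<noteq> 0})"
        "closure {y. \<psi> y \<noteq> 0} \<subseteq> Q \<phi>" and L: "\<And>y. laplacian (\<lambda>y. complex_of_real (\<psi> y)) y =
            of_real (L y)" for \<psi> L
    proof -
      let ?S = "closure {y. \<psi> y \<noteq> 0}"
      have out: "\<psi> y = 0 \<and> L y = 0" if y: "y \<notin> ?S" for y
      proof -
        have z: "\<psi> y = 0" if "y \<in> - ?S" for y using that closure_subset[of "{y. \<psi> y \<noteq> 0}"] by blast
        have yc: "y \<in> - ?S" using y unfolding Compl_iff .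
        have "laplacian (\<lambda>y. complex_of_real (\<psi> y)) y = 0"
          by (rule laplacian_eq_0[of "- ?S", OF _ _ yc]) (rule open_Compl closed_closure | simp
              only: z of_real_0)+
        then have "complex_of_real (L y) = 0" unfolding L .
        moreover have "\<psi> y = 0" by (rule z[OF yc])
        ultimately show ?thesis by simp
      qed
      have cont: "continuous_on UNIV (\<lambda>y. complex_of_real (s\<^sup>2 * \<psi> y - L y))"
      proof -
        have "continuous_on UNIV (\<lambda>y. complex_of_real (\<psi> y))" using iter_pd_continuous_on[OF \<psi>(1),
            of "[]"] by simp
        from continuous_on_Re[OF this] have c\<psi>: "continuous_on UNIV \<psi>" by simp
        have "continuous_on UNIV (laplacian (\<lambda>y. complex_of_real (\<psi> y)))"
          unfolding laplacian_def[abs_def]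
          by (intro continuous_on_sum iter_pd_continuous_on[OF \<psi>(1)]) auto
        from continuous_on_Re[OF this] have cL: "continuous_on UNIV L" by (simp add: L)
        show ?thesis by (intro continuous_intros c\<psi> cL)
      qed
      \<comment> \<open>Integrable because \<psi> and L vanish off a compact subset of
        \<open>Q \<phi>\<close>, on which h is continuous; only then may p be exchanged with the
        integral.\<close>
      define I where "I h y = indicator (Q \<phi>) y *\<^sub>R (h y * complex_of_real (s\<^sup>2 * \<psi> y - L y))" for h y
      have int: "integrable lborel (I h)" if "continuous_on ?K h" for h
      proof -
        have "integrable lborel (\<lambda>y. indicator ?S y *\<^sub>R (h y * complex_of_real (s\<^sup>2 * \<psi> y - L y)))"
          using \<psi>(3) QK by (intro borel_integrable_compact[OF \<psi>(2)] continuous_intros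
              continuous_on_subset[OF that] continuous_on_subset[OF cont]) auto
        moreover have "I h = (\<lambda>y. indicator ?S y *\<^sub>R (h y * complex_of_real (s\<^sup>2 * \<psi> y - L y)))"
        proof
          fix y show "I h y = indicator ?S y *\<^sub>R (h y * complex_of_real (s\<^sup>2 * \<psi> y - L y))"
          proof (cases "y \<in> ?S")
            case True
            then have "y \<in> Q \<phi>" using \<psi>(3) by blast
            with True show ?thesis by (simp add: I_def)
          next
            case False
            then show ?thesis using out[OF False] by (simp add: I_def)
          qed
        qed
        ultimately show ?thesis by simp
      qed
      have zero: "(\<integral>y. I h y \<partial>lborel) = 0" if "helmholtz \<phi> (\<i> * of_real s) h" for h
      proof -
        have "(LINT y:Q \<phi>|lborel. h y * (- laplacian (\<lambda>y. complex_of_real (\<psi> y)) y - (\<i> * of_real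
            s)\<^sup>2 * complex_of_real (\<psi> y))) = 0"
          by (rule that[unfolded helmholtz_def, THEN spec, THEN mp, THEN mp, THEN mp, OF \<psi>(1)])
            (simp_all only: of_real_eq_0_iff \<psi>)
        moreover have "h y * (- laplacian (\<lambda>y. complex_of_real (\<psi> y)) y - (\<i> * of_real s)\<^sup>2 *
            complex_of_real (\<psi> y))
            = h y * complex_of_real (s\<^sup>2 * \<psi> y - L y)" for y
          unfolding L by (simp add: power_mult_distrib)
        ultimately show ?thesis unfolding set_lebesgue_integral_def I_def[abs_def] by simp
      qed
      have "extend0 (Q \<phi>) (\<lambda>y. w y * (s\<^sup>2 * \<psi> y - L y)) y = p (I f y) - p (I g y)" for y
        by (simp add: extend0_def I_def w_def pr pdiff p0 left_diff_distrib del: of_real_diff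
            of_real_mult)
      then have "(\<integral>y. extend0 (Q \<phi>) (\<lambda>y. w y * (s\<^sup>2 * \<psi> y - L y)) y \<partial>lborel) =
          (\<integral>y. p (I f y) - p (I g y) \<partial>lborel)"
        by simp
      also have "\<dots> = (\<integral>y. p (I f y) \<partial>lborel) - (\<integral>y. p (I g y) \<partial>lborel)"
        using int cf by (intro Bochner_Integration.integral_diff integrable_bounded_linear[OF p(1)]) auto
      also have "\<dots> = p (\<integral>y. I f y \<partial>lborel) - p (\<integral>y. I g y \<partial>lborel)"
        using integral_bounded_linear[OF p(1) int[OF cf(1)]] integral_bounded_linear[OF p(1) int[OF
            cf(2)]] by simp
      also have "\<dots> = 0" by (simp add: zero[OF hf] zero[OF hg])
      finally show ?thesis .
    qed
    show "0 < \<phi>" "\<phi> < pi" "0 < \<epsilon>" "\<epsilon> < 1" "s \<noteq> 0" using phi eps s by auto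
    show "continuous_on ?K w" by (rule cw)
    show "continuous_on (?K - {0}) w1" "continuous_on (?K - {0}) w2" by (rule cw1 cw2)+
    show "\<bar>w y\<bar> \<le> Mm" if y: "y \<in> Q \<phi>" for y
    proof -
      have yK: "y \<in> ?K" using y QK by blast
      have "\<bar>w y\<bar> \<le> norm (f y) + norm (g y)" unfolding w_def by (rule p_le)
      also have "\<dots> \<le> Mf + Mg" by (intro add_mono M yK)
      finally show ?thesis by (simp add: Mm_def)
    qed
    show "\<bar>w1 y\<bar> \<le> Mm * sing \<epsilon> (norm y)" if y: "y \<in> Q \<phi>" for y
    proof -
      have "\<bar>w1 y\<bar> \<le> norm (fst (grad \<phi> f y)) + norm (fst (grad \<phi> g y))" unfolding w1_def by (rule p_le)
      also have "\<dots> \<le> norm (grad \<phi> f y) + norm (grad \<phi> g y)" by (intro add_mono comp_le)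
      also have "\<dots> \<le> Mm * sing \<epsilon> (norm y)" by (rule bd) (use y QK in blast)
      finally show ?thesis .
    qed
    show "\<bar>w2 y\<bar> \<le> Mm * sing \<epsilon> (norm y)" if y: "y \<in> Q \<phi>" for y
    proof -
      have "\<bar>w2 y\<bar> \<le> norm (snd (grad \<phi> f y)) + norm (snd (grad \<phi> g y))" unfolding w2_def by (rule p_le)
      also have "\<dots> \<le> norm (grad \<phi> f y) + norm (grad \<phi> g y)" by (intro add_mono comp_le)
      also have "\<dots> \<le> Mm * sing \<epsilon> (norm y)" by (rule bd) (use y QK in blast)
      finally show ?thesis .
    qed
    show "w (r, 0) * w2 (r, 0) = 0" if r: "r > 0" for r
    proof -
      have "(r, 0) \<in> Q1" using r by (simp add: Q1_def)
      from b1[OF this] show ?thesis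
        by (cases bc) (auto simp: w_def w2_def p0 normal_deriv_def normal1_def grad_def)
    qed
    show "w (r * cos \<phi>, r * sin \<phi>) * (sin \<phi> * w1 (r * cos \<phi>, r * sin \<phi>) - cos \<phi> * w2 (r * cos \<phi>,
        r * sin \<phi>)) = 0"
      if r: "r > 0" for r
    proof -
      let ?y = "(r * cos \<phi>, r * sin \<phi>)"
      have y: "?y \<in> Q2 \<phi>" using r by (auto simp: Q2_def)
      have yK: "?y \<in> ?K - {0}" using r sin_gt_zero[OF phi] by (simp add: closure_Q[OF phi]
          zero_prod_def mult_ac)
      show ?thesis
      \<comment> \<open>The second side carries a Neumann condition for NN only; for DD and DN it is
        a Dirichlet side.\<close>
      proof (cases "bc = NN")
        case True
        then have "F ?y (sin \<phi>, - cos \<phi>) = G ?y (sin \<phi>, - cos \<phi>)"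
          using b2[OF y] by (simp add: normal_deriv_def normal2_def F_def G_def)
        then have eq: "sin \<phi> *\<^sub>R (fst (grad \<phi> f ?y) - fst (grad \<phi> g ?y)) - cos \<phi> *\<^sub>R (snd (grad \<phi> f
            ?y) - snd (grad \<phi> g ?y)) = 0"
          unfolding FG[OF yK] by (simp add: algebra_simps)
        have "sin \<phi> * w1 ?y - cos \<phi> * w2 ?y =
            p (sin \<phi> *\<^sub>R (fst (grad \<phi> f ?y) - fst (grad \<phi> g ?y)) - cos \<phi> *\<^sub>R (snd (grad \<phi> f ?y) -
            snd (grad \<phi> g ?y)))"
          by (simp only: w1_def w2_def pdiff[of "sin \<phi> *\<^sub>R _"] linear_cmul[OF pl] real_scaleR_def)
        then show ?thesis unfolding eq p0 by simp
      next
        case False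
        then have "f ?y = g ?y" using b2[OF y] by (cases bc) auto
        then show ?thesis by (simp add: w_def p0)
      qed
    qed
  qed
  then show ?thesis unfolding w_def[abs_def] w1_def[abs_def] w2_def[abs_def] by blast
qed

lemma helmholtz_wedge_unique:
  assumes phi: "0 < \<phi>" "\<phi> < pi" and eps: "0 < \<epsilon>" "\<epsilon> < 1" and s: "s > 0"
    and f: "f \<in> E_space \<phi> \<epsilon>" and g: "g \<in> E_space \<phi> \<epsilon>"
    and hf: "helmholtz \<phi> (\<i> * of_real s) f" and hg: "helmholtz \<phi> (\<i> * of_real s) g"
    and b1: "\<And>y. y \<in> Q1 \<Longrightarrow> B1 bc \<phi> f y = B1 bc \<phi> g y"
    and b2: "\<And>y. y \<in> Q2 \<phi> \<Longrightarrow> B2 bc \<phi> f y = B2 bc \<phi> g y"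
    and y: "y \<in> closure (Q \<phi>)"
  shows "f y = g y"
proof -
  have "Re (f y - g y) = 0 \<and> Im (f y - g y) = 0" if y: "y \<in> Q \<phi>" for y
  proof
    note P = wedge_helmholtz_projection[OF phi eps s f g hf hg b1 b2]
    show "Re (f y - g y) = 0"
      using P[OF _ _ bounded_linear_Re abs_Re_le_cmod] wedge_helmholtz.solution_eq_0[OF _ y] by blast
    show "Im (f y - g y) = 0"
      using P[OF _ _ bounded_linear_Im abs_Im_le_cmod] wedge_helmholtz.solution_eq_0[OF _ y] by blast
  qed
  then have z: "f y - g y = 0" if "y \<in> Q \<phi>" for y using that by (simp add: complex_eq_iff)
  have "continuous_on (closure (Q \<phi>)) (\<lambda>y. f y - g y)"
    using f g by (auto simp: E_space_def intro!: continuous_intros)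
  from continuous_constant_on_closure[OF this z y] show ?thesis by simp
qed

theorem theorem3p1:
  fixes \<phi> \<alpha> \<epsilon> :: real and bc :: bc_type
    and F :: "(real \<Rightarrow> complex) \<Rightarrow> complex"
    and u v :: "((real \<times> real) \<times> real \<Rightarrow> complex) \<Rightarrow> complex"
  assumes "0 < \<phi>" and "\<phi> < pi"
    and "max 0 (\<phi> - pi / 2) < \<alpha>" and "\<alpha> < min (pi / 2) \<phi>"
    and "F \<in> tempered_dist UNIV" and "dist_supported UNIV {0..} F"
    and "0 < \<epsilon>" and "\<epsilon> < 1"
    and "scattering_solution \<phi> \<alpha> \<epsilon> bc F u"
    and "scattering_solution \<phi> \<alpha> \<epsilon> bc F v"
  shows "u = v"
\<comment> \<open>The inhomogeneous data are the same for u and v, so at each frequency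
  \<open>\<i> * s\<close> the two densities have equal boundary values or normal derivatives, and
  the homogeneous problem decides.\<close>
proof (rule tempered_dist_eqI)
  let ?K = "closure (Q \<phi>)"
  show "segment_set ?K" by (rule segment_set_closure_Q[OF assms(1,2)])
  show "?K \<noteq> {}" by (auto simp: closure_Q[OF assms(1,2)])
  show "u \<in> tempered_dist (?K \<times> UNIV)" "v \<in> tempered_dist (?K \<times> UNIV)"
    "dist_supported (?K \<times> UNIV) (?K \<times> {0..}) u" "dist_supported (?K \<times> UNIV) (?K \<times> {0..}) v"
    using assms(9,10) by (auto simp: scattering_solution_def M_space_def)
  fix \<psi> :: "real \<times> real \<Rightarrow> complex" and s :: real
  assume \<psi>: "\<psi> \<in> schwartz ?K" and s: "s > 0"
  let ?\<omega> = "\<i> * complex_of_real s"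
  have \<omega>: "?\<omega> \<in> upper_half" using s by (simp add: upper_half_def)
  obtain f where f: "f \<in> E_space \<phi> \<epsilon>" "has_FL \<phi> u ?\<omega> f" "helmholtz \<phi> ?\<omega> f"
    "\<forall>y\<in>Q1. B1 bc \<phi> f y = - FL F ?\<omega> * B1 bc \<phi> (plane_wave \<alpha> ?\<omega>) y"
    "\<forall>y\<in>Q2 \<phi>. B2 bc \<phi> f y = - FL F ?\<omega> * B2 bc \<phi> (plane_wave \<alpha> ?\<omega>) y"
    using assms(9) \<omega> unfolding scattering_solution_def holomorphic_E_def by blast
  obtain g where g: "g \<in> E_space \<phi> \<epsilon>" "has_FL \<phi> v ?\<omega> g" "helmholtz \<phi> ?\<omega> g"
    "\<forall>y\<in>Q1. B1 bc \<phi> g y = - FL F ?\<omega> * B1 bc \<phi> (plane_wave \<alpha> ?\<omega>) y"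
    "\<forall>y\<in>Q2 \<phi>. B2 bc \<phi> g y = - FL F ?\<omega> * B2 bc \<phi> (plane_wave \<alpha> ?\<omega>) y"
    using assms(10) \<omega> unfolding scattering_solution_def holomorphic_E_def by blast
  have fg: "f y = g y" if "y \<in> ?K" for y
    by (rule helmholtz_wedge_unique[where bc=bc,
        OF assms(1,2,7,8) s f(1) g(1) f(3) g(3) _ _ that]) (use f g in auto)
  \<comment> \<open>The densities are known to agree on the closure only; the set integral sees
    nothing else.\<close>
  have "(LINT y:?K|lborel. f y * \<psi> y) = (LINT y:?K|lborel. g y * \<psi> y)"
    unfolding set_lebesgue_integral_def
    by (rule Bochner_Integration.integral_cong[OF refl]) (use fg in \<open>auto simp: indicator_def\<close>)
  then show "u (\<lambda>(y, t). \<psi> y * FL_kernel ?\<omega> t) = v (\<lambda>(y, t). \<psi> y * FL_kernel ?\<omega> t)"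
    using f(2) g(2) \<psi> unfolding has_FL_def by simp
qed

end
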